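(* Let $m\neq p$ and $n>p$, let $\mathbf{Z}\sim \mathbb{C}N_{m\times p}(\mathbf{\Xi},\mathbf{I}_m\otimes\mathbf{\Sigma})$ and $\mathbf{S}\sim\mathbb{C}W_p(\mathbf{\Sigma},n)$ be independent, where $\mathbf{\Xi}\in\mathbb{C}^{m\times p}$ and $\mathbf{\Sigma}$ is a $p\times p$ positive definite Hermitian matrix. Let $\mathbf{H}=\mathbf{H}(\mathbf{F})=\mathrm{Diag}(h_1(\mathbf{F}),\ldots,h_{\min(m,p)}(\mathbf{F}))$, where each $h_k$ is a real-valued function of $\mathbf{F}=\mathrm{Diag}(f_1,\ldots,f_{\min(m,p)})$, i.e. a function on $\mathbb{R}^{\min(m,p)}_{>}$, and let $$\widehat{\mathbf{\Xi}}_H=\begin{cases}\mathbf{Z}\{\mathbf{I}_p+\mathbf{A}\,\mathbf{H}(\mathbf{F})\,\mathbf{A}^{-1}\} & \text{if } m>p,\\ \{\mathbf{I}_m+\mathbf{U}\,\mathbf{H}(\mathbf{F})\,\mathbf{U}^*\}\mathbf{Z} & \text{if } p>m,\end{cases}$$ with $\mathbf{A},\mathbf{U},\mathbf{F}$ as defined in the context. For positive integers $\nu$, $a$, $q$ and a diagonal matrix function $\mathbf{H}=\mathrm{Diag}(h_1,\ldots,h_q)$ of $\mathbf{F}=\mathrm{Diag}(f_1,\ldots,f_q)$, put $h_{kk}(\mathbf{F})=(\partial h_k/\partial f_k)(\mathbf{F})$ and $$\widehat\Delta(\nu,a,q;\mathbf{H})=\sum_{k=1}^q\Big\{2(a-q+1)h_k+2f_kh_{kk}+4\sum_{b>k}\frac{f_kh_k-f_bh_b}{f_k-f_b}+(\nu+q-2)f_kh_k^2-2f_k^2h_{kk}h_k-2\sum_{b>k}\frac{f_k^2h_k^2-f_b^2h_b^2}{f_k-f_b}\Big\},$$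 where all $h_k,h_{kk}$ are evaluated at $\mathbf{F}$ and $b$ ranges over $k<b\le q$. Under the regularity conditions on $\mathbf{H}$ stated in the context, the risk of $\widehat{\mathbf{\Xi}}_H$ is $$\mathcal{R}(\widehat{\mathbf{\Xi}}_H,(\mathbf{\Xi},\mathbf{\Sigma}))=\begin{cases} mp+\mathbb{E}\big[\widehat\Delta(n,m,p;\mathbf{H})\big] & \text{if } m>p,\\ mp+\mathbb{E}\big[\widehat\Delta(n+m-p,p,m;\mathbf{H})\big] & \text{if } p>m.\end{cases}$$
   Context: $^*$ denotes conjugate transpose and $'$ transpose. $\mathbb{R}^q_{>}=\{(\ell_1,\ldots,\ell_q)\in\mathbb{R}^q:\ell_1>\cdots>\ell_q>0\}$. Distributions. $\mathbf{Z}\sim\mathbb{C}N_{m\times p}(\mathbf{\Xi},\mathbf{I}_m\otimes\mathbf{\Sigma})$ means that $\mathbf{Z}$ has density $\pi^{-mp}\mathrm{Det}(\mathbf{\Sigma})^{-m}\exp\{-\mathrm{Tr}((\mathbf{z}-\mathbf{\Xi})\mathbf{\Sigma}^{-1}(\mathbf{z}-\mathbf{\Xi})^* )\}$ with respect to Lebesgue measure on $\mathbb{C}^{m\times p}$. $\mathbf{S}\sim\mathbb{C}W_p(\mathbf{\Sigma},n)$ (complex Wishart) means that $\mathbf{S}$ has density $\mathrm{Det}(\mathbf{s})^{n-p}\exp(-\mathrm{Tr}(\mathbf{s}\mathbf{\Sigma}^{-1}))/\{\mathrm{Det}(\mathbf{\Sigma})^n\pi^{p(p-1)/2}\prod_{k=1}^p\Gamma(n+1-k)\}$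 with respect to Lebesgue measure on the set of $p\times p$ positive definite Hermitian matrices. Risk. $\mathcal{R}(\widehat{\mathbf{\Xi}},(\mathbf{\Xi},\mathbf{\Sigma}))=\mathbb{E}[\mathrm{Tr}\{\mathbf{\Sigma}^{-1}(\widehat{\mathbf{\Xi}}-\mathbf{\Xi})^*(\widehat{\mathbf{\Xi}}-\mathbf{\Xi})\}]$, the expectation being over the joint distribution of $(\mathbf{Z},\mathbf{S})$. Decompositions. $\mathbf{F}=\mathrm{Diag}(f_1,\ldots,f_{\min(m,p)})$ consists of the (nonzero) eigenvalues of $\mathbf{Z}^*\mathbf{Z}\mathbf{S}^{-1}$, with $f_1>f_2>\cdots>f_{\min(m,p)}>0$ (almost surely). If $m>p$, $\mathbf{A}$ is a nonsingular $p\times p$ matrix with $\mathbf{S}=(\mathbf{A}^* )^{-1}\mathbf{A}^{-1}$ and $\mathbf{Z}^*\mathbf{Z}=(\mathbf{A}^* )^{-1}\mathbf{F}\mathbf{A}^{-1}$. If $p>m$, $\mathbf{U}$ is an $m\times m$ unitary matrix with $\mathbf{Z}\mathbf{S}^{-1}\mathbf{Z}^*=\mathbf{U}\mathbf{F}\mathbf{U}^*$. Differential operators. For $z=x+\sqrt{-1}\,y$, $\partial/\partial z=\frac12(\partial/\partial x-\sqrt{-1}\,\partial/\partial y)$. For an $m\times p$ matrix function $\mathbf{G}=(g_{ij})$, $\mathrm{Tr}\{\mathrm{Re}(\nabla_Z'\mathbf{G})\}=\mathrm{Re}\sum_{i,j}\partial g_{ij}/\partial z_{ij}$. For Hermitian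 $\mathbf{S}=(s_{jk})$, $\mathbf{D}_S=(\partial/\partial s_{jk})_{j,k}$ with $\frac{\partial}{\partial s_{jk}}=\frac12(1+\delta_{jk})\{\frac{\partial}{\partial(\mathrm{Re}\,s_{jk})}+(1-\delta_{jk})\sqrt{-1}\frac{\partial}{\partial(\mathrm{Im}\,s_{jk})}\}$, where $\delta_{jk}$ is the Kronecker delta (so that $\partial s_{kl}/\partial s_{ij}=\delta_{il}\delta_{jk}$), and $(\mathbf{D}_S\mathbf{M})_{jk}=\sum_l\partial M_{lk}/\partial s_{jl}$. Regularity conditions on $\mathbf{H}$. The $h_k$ are differentiable, and $\mathbf{G}:=\widehat{\mathbf{\Xi}}_H-\mathbf{Z}$ is such that the complex Stein identity and the complex Stein-Haff identity apply to it, i.e. the expectations involved (including $\mathbb{E}[\widehat\Delta]$ and the risk) are finite and $$\mathbb{E}[\mathrm{Tr}\{\mathbf{\Sigma}^{-1}((\mathbf{Z}-\mathbf{\Xi})^*\mathbf{G}+\mathbf{G}^*(\mathbf{Z}-\mathbf{\Xi}))\}]=\mathbb{E}[2\,\mathrm{Tr}\{\mathrm{Re}(\nabla_Z'\mathbf{G})\}],$$ $$\mathbb{E}[\mathrm{Tr}(\mathbf{G}^*\mathbf{G}\mathbf{\Sigma}^{-1})]=\mathbb{E}[(n-p)\mathrm{Tr}(\mathbf{G}^*\mathbf{G}\mathbf{S}^{-1})+\mathrm{Tr}(\mathbf{D}_S\mathbf{G}^*\mathbf{G})].$$ *)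

theory Defs
  imports "HOL-Probability.Probability"
begin

text \<open>
  An m-by-p complex matrix has type \<open>('m, 'p) cmat\<close>, also written \<open>complex^'p^'m\<close>; on this Euclidean
  space \<open>lborel\<close> is Lebesgue measure in the real and imaginary parts of the entries. The linear
  order on an index type of cardinality \<open>q\<close> stands for the order of the indices \<open>1, \<dots>, q\<close>.
  (The synonyms are needed because \<open>^\<close> forces sort \<open>finite\<close> on a bare index variable, which clashes
  with a declaration \<open>'p::{finite,linorder}\<close>.)
\<close>

type_synonym ('m, 'p) cmat = "((complex, 'p) vec, 'm) vec"
type_synonym 'q rvec = "(real, 'q) vec"

definition conj_transpose :: "complex^'b^'a \<Rightarrow> complex^'a^'b"  ("_\<^sup>\<dagger>" [1000] 1000) where
  "A\<^sup>\<dagger> = (\<chi> i j. cnj (A $ j $ i))"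

definition Diag :: "('q::finite \<Rightarrow> real) \<Rightarrow> complex^'q^'q" where
  "Diag d = (\<chi> i j. if i = j then complex_of_real (d i) else 0)"

definition unitary :: "complex^'a^'a \<Rightarrow> bool" where
  "unitary U \<longleftrightarrow> U ** U\<^sup>\<dagger> = mat 1 \<and> U\<^sup>\<dagger> ** U = mat 1"

text \<open>For Hermitian \<open>A\<close> the quadratic form is real-valued, so \<open>Re\<close> discards nothing.\<close>

definition pos_def_hermitian :: "complex^'a^'a \<Rightarrow> bool" where
  "pos_def_hermitian A \<longleftrightarrow>
     A\<^sup>\<dagger> = A \<and> (\<forall>v. v \<noteq> 0 \<longrightarrow> Re (\<Sum>i\<in>UNIV. cnj (v $ i) * (A *v v) $ i) > 0)"

definition eigenvalue :: "complex^'a^'a \<Rightarrow> complex \<Rightarrow> bool" where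
  "eigenvalue A c \<longleftrightarrow> (\<exists>v. v \<noteq> 0 \<and> A *v v = c *s v)"

definition unit_mat :: "'a \<Rightarrow> 'b \<Rightarrow> complex \<Rightarrow> complex^'b^'a" where
  "unit_mat i j c = axis i (axis j c)"

text \<open>
  The determinants and traces in the two densities are real when \<open>\<Sigma>\<close> and \<open>s\<close> are positive
  definite Hermitian; \<open>Re\<close> only changes the type.
\<close>

definition cnormal_density :: "complex^'p^'m \<Rightarrow> complex^'p^'p \<Rightarrow> complex^'p^'m \<Rightarrow> real" where
  "cnormal_density \<Xi> \<Sigma> z =
     exp (- Re (trace ((z - \<Xi>) ** matrix_inv \<Sigma> ** (z - \<Xi>)\<^sup>\<dagger>)))
       / (pi ^ (CARD('m) * CARD('p)) * Re (det \<Sigma>) ^ CARD('m))"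

text \<open>
  A Hermitian matrix is coded by its real coordinates: the diagonal entries, and for \<open>j < k\<close> the
  real part of entry \<open>(j,k)\<close> (stored at \<open>(j,k)\<close>) and its imaginary part (stored at \<open>(k,j)\<close>).
\<close>

definition herm_of_coords :: "(('p::{finite,linorder}) rvec, 'p) vec \<Rightarrow> ('p, 'p) cmat" where
  "herm_of_coords x = (\<chi> j k.
     if j = k then complex_of_real (x $ j $ j)
     else if j < k then Complex (x $ j $ k) (x $ k $ j)
     else Complex (x $ k $ j) (- (x $ j $ k)))"

definition herm_lborel :: "(('p::{finite,linorder}, 'p) cmat) measure" where
  "herm_lborel = distr lborel borel herm_of_coords"

lemma herm_of_coords_measurable: "herm_of_coords \<in> borel_measurable borel"
proof (rule borel_measurable_continuous_onI)
  show "continuous_on UNIV (herm_of_coords :: (('p::{finite,linorder}) rvec, 'p) vec \<Rightarrow> _)"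
    unfolding herm_of_coords_def Complex_eq
  proof (intro continuous_on_vec_lambda, goal_cases)
    case (1 j k)
    show ?case
      by (cases "j = k"; cases "j < k"; simp; intro continuous_intros)
  qed
qed

text \<open>The exponent \<open>n - CARD('p)\<close> is a natural number; the density is meant for \<open>n \<ge> CARD('p)\<close>.\<close>

definition cwishart_density :: "complex^'p^'p \<Rightarrow> nat \<Rightarrow> complex^'p^'p \<Rightarrow> real" where
  "cwishart_density \<Sigma> n s =
     (if pos_def_hermitian s
      then Re (det s) ^ (n - CARD('p)) * exp (- Re (trace (s ** matrix_inv \<Sigma>)))
             / (Re (det \<Sigma>) ^ n * pi powr (real CARD('p) * (real CARD('p) - 1) / 2)
                 * (\<Prod>k=1..CARD('p). Gamma (real n + 1 - real k)))
      else 0)"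

text \<open>
  The library's \<open>indep_var\<close> forces both variables to have the same type; this is its
  characterisation \<open>indep_var_eq\<close> at two different types, by independence of the generated
  \<open>\<sigma>\<close>-algebras.
\<close>

definition independent_rv ::
    "'w measure \<Rightarrow> ('w \<Rightarrow> 'a::topological_space) \<Rightarrow> ('w \<Rightarrow> 'b::topological_space) \<Rightarrow> bool" where
  "independent_rv M X Y \<longleftrightarrow>
     X \<in> borel_measurable M \<and> Y \<in> borel_measurable M \<and>
     prob_space.indep_set M {X -` B \<inter> space M | B. B \<in> sets borel}
                            {Y -` B \<inter> space M | B. B \<in> sets borel}"

definition ordered_cone :: "(('q::{finite,linorder}) rvec) set" where
  "ordered_cone = {f. (\<forall>k. f $ k > 0) \<and> (\<forall>k b. k < b \<longrightarrow> f $ k > f $ b)}"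

definition nonzero_spectrum :: "('p::finite, 'p) cmat \<Rightarrow> ('q::{finite,linorder}) rvec \<Rightarrow> bool" where
  "nonzero_spectrum W f \<longleftrightarrow>
     f \<in> ordered_cone \<and>
     range (\<lambda>k. complex_of_real (f $ k)) = {c. c \<noteq> 0 \<and> eigenvalue W c}"

definition distinct_spectrum ::
    "('q::{finite,linorder}) itself \<Rightarrow> ('m::finite, 'p::finite) cmat \<Rightarrow> ('p, 'p) cmat \<Rightarrow> bool" where
  "distinct_spectrum q z s \<longleftrightarrow>
     pos_def_hermitian s \<and> (\<exists>f :: 'q rvec. nonzero_spectrum (z\<^sup>\<dagger> ** z ** matrix_inv s) f)"

text \<open>
  \<open>F_of z s\<close> is unique when it exists, since its entries are the elements of a finite set in
  decreasing order; it is unspecified off \<open>distinct_spectrum\<close>.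
\<close>

definition F_of :: "('m::finite, 'p::finite) cmat \<Rightarrow> ('p, 'p) cmat \<Rightarrow> ('q::{finite,linorder}) rvec" where
  "F_of z s = (THE f. nonzero_spectrum (z\<^sup>\<dagger> ** z ** matrix_inv s) f)"

definition decomposition_A ::
    "(('m::finite, 'p::{finite,linorder}) cmat \<Rightarrow> ('p, 'p) cmat \<Rightarrow> ('p, 'p) cmat) \<Rightarrow> bool" where
  "decomposition_A A \<longleftrightarrow> (\<forall>z s. distinct_spectrum TYPE('p) z s \<longrightarrow>
     invertible (A z s) \<and>
     s = matrix_inv ((A z s)\<^sup>\<dagger>) ** matrix_inv (A z s) \<and>
     z\<^sup>\<dagger> ** z = matrix_inv ((A z s)\<^sup>\<dagger>) ** Diag (\<lambda>k. F_of z s $ k) ** matrix_inv (A z s))"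

definition decomposition_U ::
    "(('m::{finite,linorder}, 'p::finite) cmat \<Rightarrow> ('p, 'p) cmat \<Rightarrow> ('m, 'm) cmat) \<Rightarrow> bool" where
  "decomposition_U U \<longleftrightarrow> (\<forall>z s. distinct_spectrum TYPE('m) z s \<longrightarrow>
     unitary (U z s) \<and>
     z ** matrix_inv s ** z\<^sup>\<dagger> = U z s ** Diag (\<lambda>k. F_of z s $ k) ** (U z s)\<^sup>\<dagger>)"

definition estimator_A ::
    "('p::{finite,linorder} \<Rightarrow> 'p rvec \<Rightarrow> real) \<Rightarrow> (('m::finite, 'p) cmat \<Rightarrow> ('p, 'p) cmat \<Rightarrow> ('p, 'p) cmat)
      \<Rightarrow> ('m, 'p) cmat \<Rightarrow> ('p, 'p) cmat \<Rightarrow> ('m, 'p) cmat" where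
  "estimator_A h A z s =
     z ** (mat 1 + A z s ** Diag (\<lambda>k. h k (F_of z s)) ** matrix_inv (A z s))"

definition estimator_U ::
    "('m::{finite,linorder} \<Rightarrow> 'm rvec \<Rightarrow> real) \<Rightarrow> (('m, 'p::finite) cmat \<Rightarrow> ('p, 'p) cmat \<Rightarrow> ('m, 'm) cmat)
      \<Rightarrow> ('m, 'p) cmat \<Rightarrow> ('p, 'p) cmat \<Rightarrow> ('m, 'p) cmat" where
  "estimator_U h U z s =
     (mat 1 + U z s ** Diag (\<lambda>k. h k (F_of z s)) ** (U z s)\<^sup>\<dagger>) ** z"

text \<open>The trace in the loss is real (and nonnegative) for positive definite \<open>\<Sigma>\<close>.\<close>

definition loss :: "complex^'p^'m \<Rightarrow> complex^'p^'p \<Rightarrow> complex^'p^'m \<Rightarrow> real" where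
  "loss \<Xi> \<Sigma> x = Re (trace (matrix_inv \<Sigma> ** (x - \<Xi>)\<^sup>\<dagger> ** (x - \<Xi>)))"

definition risk ::
    "'w measure \<Rightarrow> ('w \<Rightarrow> complex^'p^'m) \<Rightarrow> ('w \<Rightarrow> complex^'p^'p)
      \<Rightarrow> complex^'p^'m \<Rightarrow> complex^'p^'p
      \<Rightarrow> (complex^'p^'m \<Rightarrow> complex^'p^'p \<Rightarrow> complex^'p^'m) \<Rightarrow> real" where
  "risk M Z S \<Xi> \<Sigma> est = (\<integral>\<omega>. loss \<Xi> \<Sigma> (est (Z \<omega>) (S \<omega>)) \<partial>M)"

definition dir_deriv :: "('a::real_normed_vector \<Rightarrow> 'b::real_normed_vector) \<Rightarrow> 'a \<Rightarrow> 'a \<Rightarrow> 'b" where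
  "dir_deriv g x v = vector_derivative (\<lambda>t. g (x + t *\<^sub>R v)) (at 0)"

definition deriv_z :: "'m \<Rightarrow> 'p \<Rightarrow> (complex^'p^'m \<Rightarrow> complex) \<Rightarrow> complex^'p^'m \<Rightarrow> complex" where
  "deriv_z i j g z =
     1/2 * (dir_deriv g z (unit_mat i j 1) - \<i> * dir_deriv g z (unit_mat i j \<i>))"

definition tr_re_nabla :: "(complex^'p^'m \<Rightarrow> complex^'p^'m) \<Rightarrow> complex^'p^'m \<Rightarrow> real" where
  "tr_re_nabla G z = Re (\<Sum>i\<in>UNIV. \<Sum>j\<in>UNIV. deriv_z i j (\<lambda>z. G z $ i $ j) z)"

text \<open>
  Since entry \<open>(k,j)\<close> of a Hermitian matrix is the conjugate of entry \<open>(j,k)\<close>, varying the real or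
  imaginary part of entry \<open>(j,k)\<close> inside the Hermitian matrices changes both entries.
\<close>

definition herm_re_dir :: "'p \<Rightarrow> 'p \<Rightarrow> complex^'p^'p" where
  "herm_re_dir j k = (if j = k then unit_mat j j 1 else unit_mat j k 1 + unit_mat k j 1)"

definition herm_im_dir :: "'p \<Rightarrow> 'p \<Rightarrow> complex^'p^'p" where
  "herm_im_dir j k = unit_mat j k \<i> - unit_mat k j \<i>"

definition deriv_s :: "'p \<Rightarrow> 'p \<Rightarrow> (complex^'p^'p \<Rightarrow> complex) \<Rightarrow> complex^'p^'p \<Rightarrow> complex" where
  "deriv_s j k g s =
     1/2 * (1 + of_bool (j = k)) *
       (dir_deriv g s (herm_re_dir j k)
          + (1 - of_bool (j = k)) * \<i> * dir_deriv g s (herm_im_dir j k))"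

definition D_S :: "(complex^'p^'p \<Rightarrow> complex^'p^'p) \<Rightarrow> complex^'p^'p \<Rightarrow> complex^'p^'p" where
  "D_S Q s = (\<chi> j k. \<Sum>l\<in>UNIV. deriv_s j l (\<lambda>s. Q s $ l $ k) s)"

lemma dir_deriv_entry: "dir_deriv (\<lambda>s. s $ k $ l) s v = (v :: complex^'p^'p) $ k $ l"
proof -
  have "((\<lambda>t. (s + t *\<^sub>R v) $ k $ l) has_vector_derivative v $ k $ l) (at 0)"
    by (auto intro!: derivative_eq_intros simp: has_vector_derivative_def)
  then show ?thesis
    unfolding dir_deriv_def by (rule vector_derivative_at)
qed

lemma deriv_s_entry: "deriv_s i j (\<lambda>s. s $ k $ l) s = of_bool (i = l \<and> j = k)"
  unfolding deriv_s_def dir_deriv_entry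
  by (auto simp: herm_re_dir_def herm_im_dir_def unit_mat_def axis_def)

definition stein_identity ::
    "'w measure \<Rightarrow> ('w \<Rightarrow> complex^'p^'m) \<Rightarrow> ('w \<Rightarrow> complex^'p^'p)
      \<Rightarrow> complex^'p^'m \<Rightarrow> complex^'p^'p
      \<Rightarrow> (complex^'p^'m \<Rightarrow> complex^'p^'p \<Rightarrow> complex^'p^'m) \<Rightarrow> bool" where
  "stein_identity M Z S \<Xi> \<Sigma> G \<longleftrightarrow>
     (let lhs = (\<lambda>\<omega>. trace (matrix_inv \<Sigma> **
                  ((Z \<omega> - \<Xi>)\<^sup>\<dagger> ** G (Z \<omega>) (S \<omega>) + (G (Z \<omega>) (S \<omega>))\<^sup>\<dagger> ** (Z \<omega> - \<Xi>))));
          rhs = (\<lambda>\<omega>. 2 * tr_re_nabla (\<lambda>z. G z (S \<omega>)) (Z \<omega>))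
      in integrable M lhs \<and> integrable M rhs \<and>
         (\<integral>\<omega>. lhs \<omega> \<partial>M) = complex_of_real (\<integral>\<omega>. rhs \<omega> \<partial>M))"

definition stein_haff_identity ::
    "'w measure \<Rightarrow> ('w \<Rightarrow> complex^'p^'m) \<Rightarrow> ('w \<Rightarrow> complex^'p^'p)
      \<Rightarrow> complex^'p^'p \<Rightarrow> nat
      \<Rightarrow> (complex^'p^'m \<Rightarrow> complex^'p^'p \<Rightarrow> complex^'p^'m) \<Rightarrow> bool" where
  "stein_haff_identity M Z S \<Sigma> n G \<longleftrightarrow>
     (let GG = (\<lambda>z s. (G z s)\<^sup>\<dagger> ** G z s);
          lhs = (\<lambda>\<omega>. trace (GG (Z \<omega>) (S \<omega>) ** matrix_inv \<Sigma>));
          rhs = (\<lambda>\<omega>. (of_nat n - of_nat CARD('p)) * trace (GG (Z \<omega>) (S \<omega>) ** matrix_inv (S \<omega>))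
                       + trace (D_S (GG (Z \<omega>)) (S \<omega>)))
      in integrable M lhs \<and> integrable M rhs \<and> (\<integral>\<omega>. lhs \<omega> \<partial>M) = (\<integral>\<omega>. rhs \<omega> \<partial>M))"

definition h_diag_deriv :: "('q::finite \<Rightarrow> real^'q \<Rightarrow> real) \<Rightarrow> 'q \<Rightarrow> real^'q \<Rightarrow> real" where
  "h_diag_deriv h k f = deriv (\<lambda>t. h k (\<chi> i. if i = k then t else f $ i)) (f $ k)"

text \<open>The parameter \<open>q\<close> is the number of components, \<open>CARD('q)\<close>.\<close>

definition Delta_hat ::
    "nat \<Rightarrow> nat \<Rightarrow> ('q::{finite,linorder} \<Rightarrow> 'q rvec \<Rightarrow> real) \<Rightarrow> 'q rvec \<Rightarrow> real" where
  "Delta_hat \<nu> a h f =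
     (let q = real CARD('q); hh = (\<lambda>k. h k f); hd = (\<lambda>k. h_diag_deriv h k f)
      in \<Sum>k\<in>UNIV.
           2 * (real a - q + 1) * hh k + 2 * f $ k * hd k
           + 4 * (\<Sum>b | k < b. (f $ k * hh k - f $ b * hh b) / (f $ k - f $ b))
           + (real \<nu> + q - 2) * f $ k * (hh k)\<^sup>2
           - 2 * (f $ k)\<^sup>2 * hd k * hh k
           - 2 * (\<Sum>b | k < b. ((f $ k)\<^sup>2 * (hh k)\<^sup>2 - (f $ b)\<^sup>2 * (hh b)\<^sup>2) / (f $ k - f $ b)))"

definition regular ::
    "'w measure \<Rightarrow> ('w \<Rightarrow> ('m::finite, 'p::finite) cmat) \<Rightarrow> ('w \<Rightarrow> ('p, 'p) cmat)
      \<Rightarrow> ('m, 'p) cmat \<Rightarrow> ('p, 'p) cmat \<Rightarrow> nat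
      \<Rightarrow> (('m, 'p) cmat \<Rightarrow> ('p, 'p) cmat \<Rightarrow> ('m, 'p) cmat)
      \<Rightarrow> ('q::{finite,linorder} \<Rightarrow> 'q rvec \<Rightarrow> real) \<Rightarrow> ('q rvec \<Rightarrow> real) \<Rightarrow> bool" where
  "regular M Z S \<Xi> \<Sigma> n est h \<Delta> \<longleftrightarrow>
     (\<forall>k. h k differentiable_on ordered_cone) \<and>
     stein_identity M Z S \<Xi> \<Sigma> (\<lambda>z s. est z s - z) \<and>
     stein_haff_identity M Z S \<Sigma> n (\<lambda>z s. est z s - z) \<and>
     integrable M (\<lambda>\<omega>. loss \<Xi> \<Sigma> (est (Z \<omega>) (S \<omega>))) \<and>
     integrable M (\<lambda>\<omega>. \<Delta> (F_of (Z \<omega>) (S \<omega>)))"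

end

theory Submission
  imports Defs "HOL-Computational_Algebra.Fundamental_Theorem_Algebra"
begin

text \<open>
  Put \<open>G\<close> for the difference between the estimator and \<open>Z\<close>.  Expanding the quadratic loss around
  \<open>Z\<close> leaves the loss of \<open>Z\<close>, whose expectation is \<open>m p\<close> (\<open>cnormal_loss\<close>), a cross term and a term
  quadratic in \<open>G\<close>.  The Stein identity and the Stein-Haff identity replace the last two by expectations
  of divergences that do not involve \<open>\<Xi>\<close> and \<open>\<Sigma>\<close> (\<open>risk_from_stein_identities\<close>).  It remains to show
  that at almost every \<open>(Z, S)\<close> these divergences add up to \<open>Delta_hat\<close> at \<open>F\<close>.

  Both regimes are governed by a definite pencil \<open>N - x T\<close>: by \<open>(Z\<^sup>* Z, S)\<close> if \<open>m > p\<close> (tall) and by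
  \<open>(Z S\<^sup>-\<^sup>1 Z\<^sup>*, I)\<close> if \<open>p > m\<close> (wide).  There is \<open>X\<close> with \<open>X\<^sup>* T X = I\<close> and \<open>X\<^sup>* N X = diag(f)\<close>, and
  \<open>\<Phi> = X diag(h) X\<^sup>-\<^sup>1\<close> is the function \<open>h\<close> of \<open>W = T\<^sup>-\<^sup>1 N\<close>; the correction \<open>G\<close> is \<open>Z \<Phi>\<close> or \<open>\<Phi> Z\<close>.  In the
  basis \<open>X\<close> the differential of \<open>\<Phi>\<close> multiplies the off-diagonal entries of \<open>X\<^sup>-\<^sup>1 dW X\<close> by the divided
  differences \<open>(h i - h j) / (f i - f j)\<close> and applies the partial derivatives of \<open>h\<close> to the diagonal
  (\<open>pencil_function_derivative\<close>).  A divergence sums the \<open>(a,b)\<close> entries of the responses to the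
  perturbations \<open>E\<^sub>a\<^sub>b\<close>; in that sum \<open>X\<close> is contracted with \<open>X\<^sup>-\<^sup>1\<close> or with its image under the pencil, and
  only sums of divided differences weighted by the \<open>f k\<close> are left (\<open>spectral_divergence\<close>).  Symmetrized
  over pairs of indices they give \<open>Delta_hat\<close> (\<open>unbiased_risk_tall\<close>, \<open>unbiased_risk_wide\<close>).

  The matrices \<open>A\<close> and \<open>U\<close> are arbitrary selections, without any continuity.  The differentiability of
  the \<open>f k\<close> is therefore derived from the characteristic polynomial of the pencil
  (\<open>pencil_roots_persist\<close>, \<open>pencil_roots_derivative\<close>), and the differentiability of \<open>\<Phi>\<close> from Lagrange
  interpolation, which expresses \<open>\<Phi>\<close> by \<open>W\<close>, \<open>f\<close> and \<open>h\<close> (\<open>spectral_function_differentiable\<close>).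

  The decomposition is available where the spectrum is simple.  A Hermitian pencil has a simple
  spectrum as soon as some vector is cyclic for \<open>W\<close> (\<open>cyclic_imp_distinct_roots\<close>), and cyclicity of a
  fixed vector is the nonvanishing of a polynomial in \<open>Z\<close> and \<open>S\<close>.  This polynomial is not zero, so
  its zero set meets every ray from a suitable point in finitely many points and is a null set
  (\<open>AE_distinct_spectrum_tall\<close>, \<open>AE_distinct_spectrum_wide\<close>).
\<close>

section \<open>Matrix algebra\<close>

lemma conj_transpose_nth [simp]: "A\<^sup>\<dagger> $ i $ j = cnj (A $ j $ i)"
  by (simp add: conj_transpose_def)

lemma conj_transpose_idem [simp]: "(A\<^sup>\<dagger>)\<^sup>\<dagger> = A"
  by (simp add: vec_eq_iff)

lemma conj_transpose_mult: "(A ** B)\<^sup>\<dagger> = B\<^sup>\<dagger> ** A\<^sup>\<dagger>"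
  by (simp add: vec_eq_iff matrix_matrix_mult_def mult.commute)

lemma conj_transpose_mat_1 [simp]: "(mat 1 :: complex^'a^'a)\<^sup>\<dagger> = mat 1"
  by (simp add: vec_eq_iff mat_def)

lemma conj_transpose_add: "(A + B)\<^sup>\<dagger> = A\<^sup>\<dagger> + B\<^sup>\<dagger>"
  by (simp add: vec_eq_iff)

lemma conj_transpose_scaleR: "(c *\<^sub>R A)\<^sup>\<dagger> = c *\<^sub>R A\<^sup>\<dagger>"
  by (simp add: vec_eq_iff)

lemma bounded_linear_conj_transpose: "bounded_linear (conj_transpose :: complex^'b^'a \<Rightarrow> _)"
  by (intro linear_linear[THEN iffD2] linear_conv_bounded_linear[THEN iffD1] linearI)
     (simp_all add: conj_transpose_add conj_transpose_scaleR)

lemma Diag_nth [simp]: "Diag d $ i $ j = (if i = j then complex_of_real (d i) else 0)"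
  by (simp add: Diag_def)

lemma conj_transpose_Diag [simp]: "(Diag d)\<^sup>\<dagger> = Diag d"
  by (simp add: vec_eq_iff)

lemma matrix_mult_nth: "(A ** B) $ i $ j = (\<Sum>k\<in>UNIV. A $ i $ k * B $ k $ j)"
  by (simp add: matrix_matrix_mult_def)

lemma mult_Diag_nth [simp]: "(A ** Diag d) $ i $ j = A $ i $ j * of_real (d j)"
  by (simp add: matrix_mult_nth if_distrib[of "\<lambda>x. _ * x"] cong: if_cong)

lemma Diag_mult_nth [simp]: "(Diag d ** A) $ i $ j = of_real (d i) * A $ i $ j"
  by (simp add: matrix_mult_nth if_distrib[of "\<lambda>x. x * _"] cong: if_cong)

lemma Diag_mult_Diag: "Diag d ** Diag e = Diag (\<lambda>k. d k * e k)"
  by (simp add: vec_eq_iff)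

lemma Diag_1: "Diag (\<lambda>k. 1) = mat 1"
  by (simp add: vec_eq_iff mat_def)

lemma det_Diag: "det (Diag d) = (\<Prod>k\<in>UNIV. of_real (d k))"
  by (subst det_diagonal) auto

lemma det_conj_transpose: "det (A\<^sup>\<dagger>) = cnj (det A)"
proof -
  have "A\<^sup>\<dagger> = transpose (\<chi> i j. cnj (A $ i $ j))"
    by (simp add: vec_eq_iff transpose_def)
  then have "det (A\<^sup>\<dagger>) = det (\<chi> i j. cnj (A $ i $ j))"
    by simp
  then show ?thesis by (simp add: det_def)
qed

lemma matrix_inv_right: "invertible A \<Longrightarrow> A ** matrix_inv A = mat 1"
  and matrix_inv_left: "invertible A \<Longrightarrow> matrix_inv A ** A = mat 1"
  unfolding invertible_def matrix_inv_def by (metis (mono_tags, lifting) someI_ex)+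

lemma matrix_inv_unique:
  fixes A :: "'a::field^'n^'n"
  assumes "A ** B = mat 1"
  shows "matrix_inv A = B"
proof -
  have "B ** A = mat 1" using assms matrix_left_right_inverse by blast
  then have inv: "invertible A" using assms invertible_def by blast
  have "matrix_inv A = matrix_inv A ** (A ** B)" by (simp add: assms)
  also have "\<dots> = B" by (simp add: matrix_mul_assoc matrix_inv_left[OF inv])
  finally show ?thesis .
qed

lemma invertibleI: "A ** B = mat 1 \<Longrightarrow> invertible (A :: 'a::field^'n^'n)"
  using invertible_right_inverse by blast

lemma invertible_conj_transpose: "invertible A \<Longrightarrow> invertible (A\<^sup>\<dagger>)"
  for A :: "complex^'n^'n"
  by (simp add: invertible_det_nz det_conj_transpose)

lemma matrix_inv_conj_transpose:
  fixes A :: "complex^'n^'n"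
  assumes "invertible A"
  shows "matrix_inv (A\<^sup>\<dagger>) = (matrix_inv A)\<^sup>\<dagger>"
  by (rule matrix_inv_unique)
     (simp flip: conj_transpose_mult add: matrix_inv_left assms)

lemma matrix_inv_mat_1 [simp]: "matrix_inv (mat 1 :: 'a::field^'n^'n) = mat 1"
  by (rule matrix_inv_unique) simp

lemma matrix_mult_diff_right: "A ** (B - C) = A ** B - A ** (C :: 'a::ring_1^_^_)"
  by (simp add: vec_eq_iff matrix_mult_nth right_diff_distrib sum_subtractf)

lemma matrix_mult_diff_left: "(A - B) ** C = A ** C - B ** (C :: 'a::ring_1^_^_)"
  by (simp add: vec_eq_iff matrix_mult_nth left_diff_distrib sum_subtractf)

lemma matrix_mult_minus_right: "A ** (- B) = - (A ** (B :: 'a::ring_1^_^_))"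
  by (simp add: vec_eq_iff matrix_mult_nth sum_negf)

lemma matrix_mult_minus_left: "(- A) ** B = - (A ** (B :: 'a::ring_1^_^_))"
  by (simp add: vec_eq_iff matrix_mult_nth sum_negf)

lemma matrix_mult_zero [simp]: "A ** 0 = (0 :: 'a::ring_1^_^_)" "0 ** A = (0 :: 'a::ring_1^_^_)"
  by (simp_all add: vec_eq_iff matrix_mult_nth)

lemma matrix_mult_add_left: "(A + B) ** C = A ** C + B ** (C :: 'a::ring_1^_^_)"
  by (simp add: vec_eq_iff matrix_mult_nth distrib_right sum.distrib)

lemma trace_Diag: "trace (Diag d) = of_real (\<Sum>k\<in>UNIV. d k)"
  by (simp add: trace_def)

lemma mat_nth: "mat c $ i $ j = (if i = j then c else 0)"
  by (simp add: mat_def)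

lemma mat_mult_nth [simp]: "(mat c ** A) $ i $ j = c * A $ i $ j"
  by (simp add: matrix_mult_nth mat_def if_distrib[of "\<lambda>x. x * _"] cong: if_cong)

lemma mult_mat_nth [simp]: "(A ** mat c) $ i $ j = A $ i $ j * c"
  by (simp add: matrix_mult_nth mat_def if_distrib[of "\<lambda>x. _ * x"] cong: if_cong)

lemma mat_mult_vec: "mat c *v v = c *s v"
  by (simp add: vec_eq_iff matrix_vector_mult_def mat_def if_distrib[of "\<lambda>x. x * _"] cong: if_cong)

lemma det_eq_0_iff_kernel:
  "det (A :: 'a::field^'n^'n) = 0 \<longleftrightarrow> (\<exists>v. v \<noteq> 0 \<and> A *v v = 0)"
  by (metis invertible_det_nz invertible_left_inverse matrix_left_invertible_ker)

lemma mat_commute: "A ** mat c = mat c ** (A :: 'a::comm_ring_1^'n^'n)"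
  by (simp add: vec_eq_iff mat_mult_nth mult_mat_nth mult.commute)

lemma conj_transpose_zero [simp]: "(0 :: complex^'b^'a)\<^sup>\<dagger> = 0"
  by (simp add: vec_eq_iff)

definition cinner :: "complex^'n \<Rightarrow> complex^'n \<Rightarrow> complex" where
  "cinner u v = (\<Sum>i\<in>UNIV. cnj (u $ i) * v $ i)"

lemma cinner_self: "cinner u u = of_real ((norm u)\<^sup>2)"
  by (simp add: cinner_def norm_vec_def L2_set_def sum_nonneg mult.commute[of "cnj _"]
      complex_norm_square del: of_real_power)

lemma cinner_matrix_left: "cinner (A *v u) v = cinner u (A\<^sup>\<dagger> *v v)"
  unfolding cinner_def matrix_vector_mult_def
  by (simp add: sum_distrib_left sum_distrib_right, subst sum.swap) (simp add: mult_ac)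

lemma cinner_matrix_right: "cinner u (A *v v) = cinner (A\<^sup>\<dagger> *v u) v"
  by (simp add: cinner_matrix_left)

lemma cinner_commute: "cinner v u = cnj (cinner u v)"
  by (simp add: cinner_def mult.commute)

lemma cinner_diff_right: "cinner u (v - w) = cinner u v - cinner u w"
  by (simp add: cinner_def right_diff_distrib sum_subtractf)

lemma cinner_scale_right: "cinner u (c *s v) = c * cinner u v"
  by (simp add: cinner_def sum_distrib_left mult_ac)

lemma cinner_scale_left: "cinner (c *s u) v = cnj c * cinner u v"
  by (simp add: cinner_def sum_distrib_left mult_ac)

lemma pos_def_hermitian_iff:
  "pos_def_hermitian A \<longleftrightarrow> A\<^sup>\<dagger> = A \<and> (\<forall>v. v \<noteq> 0 \<longrightarrow> Re (cinner v (A *v v)) > 0)"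
  by (simp add: pos_def_hermitian_def cinner_def)

lemma pos_def_hermitian_invertible:
  assumes "pos_def_hermitian A"
  shows "invertible A"
proof -
  have "x = 0" if "A *v x = 0" for x
    using assms that unfolding pos_def_hermitian_iff by (force simp: cinner_def)
  then show ?thesis
    by (metis invertible_left_inverse matrix_left_invertible_ker)
qed

lemma hermitian_matrix_inv:
  fixes A :: "complex^'n^'n"
  assumes "A\<^sup>\<dagger> = A" "invertible A"
  shows "(matrix_inv A)\<^sup>\<dagger> = matrix_inv A"
  using assms matrix_inv_conj_transpose by metis

lemma pos_def_hermitian_matrix_inv:
  assumes "pos_def_hermitian A"
  shows "pos_def_hermitian (matrix_inv A)"
  unfolding pos_def_hermitian_iff
proof (intro conjI allI impI)
  have inv: "invertible A" using assms by (rule pos_def_hermitian_invertible)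
  have herm: "A\<^sup>\<dagger> = A" using assms by (simp add: pos_def_hermitian_iff)
  show hi: "(matrix_inv A)\<^sup>\<dagger> = matrix_inv A" using hermitian_matrix_inv[OF herm inv] .
  fix v :: "complex^'a" assume "v \<noteq> 0"
  define u where "u = matrix_inv A *v v"
  have v: "v = A *v u" by (simp add: u_def matrix_vector_mul_assoc matrix_inv_right inv)
  with \<open>v \<noteq> 0\<close> have "u \<noteq> 0" by auto
  then have "Re (cinner u (A *v u)) > 0" using assms by (simp add: pos_def_hermitian_iff)
  also have "cinner u (A *v u) = cinner v (matrix_inv A *v v)"
    by (metis u_def v cinner_matrix_left herm)
  finally show "Re (cinner v (matrix_inv A *v v)) > 0" .
qed

text \<open>Cramer's formula defines the adjugate polynomially in the entries.\<close>

definition adjugate :: "complex^'n^'n \<Rightarrow> complex^'n^'n" where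
  "adjugate A = (\<chi> k l. det (\<chi> i j. if j = k then axis l 1 $ i else A $ i $ j))"

lemma adjugate_eq:
  assumes "invertible A"
  shows "adjugate A = mat (det A) ** matrix_inv A"
proof -
  have "adjugate A $ k $ l = det A * matrix_inv A $ k $ l" for k l
  proof -
    have "A *v (matrix_inv A *v axis l 1) = axis l 1"
      by (simp add: matrix_vector_mul_assoc matrix_inv_right assms)
    then have "matrix_inv A *v axis l 1 = (\<chi> k. adjugate A $ k $ l / det A)"
      using cramer[of A] assms by (simp add: invertible_det_nz adjugate_def)
    then have "(matrix_inv A *v axis l 1) $ k = adjugate A $ k $ l / det A" by simp
    moreover have "(matrix_inv A *v axis l 1) $ k = matrix_inv A $ k $ l"
      by (simp add: matrix_vector_mult_def axis_def if_distrib[of "\<lambda>x. _ * x"] cong: if_cong)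
    ultimately show ?thesis using assms by (simp add: invertible_det_nz)
  qed
  then show ?thesis by (simp add: vec_eq_iff)
qed

section \<open>Matrix curves\<close>

lemma bounded_bilinear_matrix_mult:
  "bounded_bilinear ((**) :: complex^'b^'a \<Rightarrow> complex^'c^'b \<Rightarrow> complex^'c^'a)"
  by (intro bilinear_conv_bounded_bilinear[THEN iffD1])
     (auto simp: bilinear_def vec_eq_iff matrix_mult_nth algebra_simps sum.distrib scaleR_sum_right
       intro!: linearI)

lemmas matrix_mult_scaleR =
  bounded_bilinear.scaleR_left[OF bounded_bilinear_matrix_mult]
  bounded_bilinear.scaleR_right[OF bounded_bilinear_matrix_mult]
lemmas tendsto_matrix_mult = bounded_bilinear.tendsto[OF bounded_bilinear_matrix_mult]
lemmas has_vector_derivative_matrix_mult =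
  bounded_bilinear.has_vector_derivative[OF bounded_bilinear_matrix_mult]
lemmas has_vector_derivative_conj_transpose =
  bounded_linear.has_vector_derivative[OF bounded_linear_conj_transpose]

lemma has_vector_derivative_nth:
  "(A has_vector_derivative A') F \<Longrightarrow> ((\<lambda>t. A t $ i) has_vector_derivative A' $ i) F"
  by (rule bounded_linear.has_vector_derivative[OF bounded_linear_vec_nth])

lemma tendsto_det:
  fixes A :: "'b \<Rightarrow> complex^'n^'n"
  assumes "(A \<longlongrightarrow> B) F"
  shows "((\<lambda>t. det (A t)) \<longlongrightarrow> det B) F"
  unfolding det_def by (intro tendsto_intros assms)

lemma tendsto_vecI:
  assumes "\<And>i. ((\<lambda>t. A t $ i) \<longlongrightarrow> B $ i) F"
  shows "(A \<longlongrightarrow> B) F"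
  using assms by (intro vec_tendstoI)

lemma tendsto_matrix_inv:
  fixes A :: "'b \<Rightarrow> complex^'n^'n"
  assumes lim: "(A \<longlongrightarrow> B) F" and inv: "invertible B"
  shows "((\<lambda>t. matrix_inv (A t)) \<longlongrightarrow> matrix_inv B) F"
proof -
  have entry: "adjugate C $ k $ l / det C = matrix_inv C $ k $ l" if "invertible C" for C :: "complex^'n^'n" and k l
    using that by (simp add: adjugate_eq invertible_det_nz)
  have nz: "det B \<noteq> 0" using inv by (simp add: invertible_det_nz)
  have "\<forall>\<^sub>F t in F. det (A t) \<noteq> 0"
    using tendsto_imp_eventually_ne[OF tendsto_det[OF lim] nz] .
  then have ev: "\<forall>\<^sub>F t in F. adjugate (A t) $ k $ l / det (A t) = matrix_inv (A t) $ k $ l" for k l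
    by eventually_elim (simp add: entry invertible_det_nz)
  have "((\<lambda>t. adjugate (A t) $ k $ l / det (A t)) \<longlongrightarrow> adjugate B $ k $ l / det B) F" for k l
    unfolding adjugate_def vec_lambda_beta
    by (intro tendsto_divide tendsto_det lim nz tendsto_vecI)
       (auto intro!: tendsto_intros lim)
  then have "((\<lambda>t. matrix_inv (A t) $ k $ l) \<longlongrightarrow> matrix_inv B $ k $ l) F" for k l
    using Lim_transform_eventually[OF _ ev] by (simp add: entry inv)
  then show ?thesis by (intro tendsto_vecI)
qed

lemma has_vector_derivative_at_0_iff:
  "(f has_vector_derivative D) (at 0) \<longleftrightarrow> ((\<lambda>t. (f t - f 0) /\<^sub>R t) \<longlongrightarrow> D) (at 0)"
  for f :: "real \<Rightarrow> 'a::real_normed_vector"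
proof -
  have "norm (f t - f 0 - t *\<^sub>R D) / \<bar>t\<bar> = norm ((f t - f 0) /\<^sub>R t - D)" if "t \<noteq> 0" for t
  proof -
    have "(f t - f 0) /\<^sub>R t - D = (f t - f 0 - t *\<^sub>R D) /\<^sub>R t"
      using that by (simp add: algebra_simps)
    then show ?thesis by (simp add: divide_inverse_commute)
  qed
  then have "((\<lambda>t. norm (f t - f 0 - t *\<^sub>R D) / \<bar>t\<bar>) \<longlongrightarrow> 0) (at 0)
      \<longleftrightarrow> ((\<lambda>t. norm ((f t - f 0) /\<^sub>R t - D)) \<longlongrightarrow> 0) (at 0)"
    by (intro tendsto_cong) (auto simp: eventually_at_filter)
  then show ?thesis
    unfolding has_vector_derivative_def has_derivative_at
    by (simp add: bounded_linear_scaleR_left tendsto_norm_zero_iff LIM_zero_iff)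
qed

lemma has_vector_derivative_matrix_inv:
  fixes A :: "real \<Rightarrow> complex^'n^'n"
  assumes deriv: "(A has_vector_derivative A') (at 0)" and inv: "invertible (A 0)"
  shows "((\<lambda>t. matrix_inv (A t)) has_vector_derivative
           - (matrix_inv (A 0) ** A' ** matrix_inv (A 0))) (at 0)"
proof -
  have lim: "(A \<longlongrightarrow> A 0) (at 0)"
    using has_vector_derivative_continuous[OF deriv] by (simp add: continuous_within)
  have "det (A 0) \<noteq> 0" using inv by (simp add: invertible_det_nz)
  from tendsto_imp_eventually_ne[OF tendsto_det[OF lim] this]
  have ev: "\<forall>\<^sub>F t in at 0. - (matrix_inv (A t) ** ((A t - A 0) /\<^sub>R t) ** matrix_inv (A 0))
      = (matrix_inv (A t) - matrix_inv (A 0)) /\<^sub>R t"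
  proof eventually_elim
    case (elim t)
    then have inv_t: "invertible (A t)" by (simp add: invertible_det_nz)
    have "matrix_inv (A t) ** ((A t - A 0) /\<^sub>R t) ** matrix_inv (A 0)
        = (matrix_inv (A t) ** (A t - A 0) ** matrix_inv (A 0)) /\<^sub>R t"
      by (simp add: matrix_mult_scaleR)
    also have "matrix_inv (A t) ** (A t - A 0) ** matrix_inv (A 0)
        = matrix_inv (A 0) - matrix_inv (A t)"
      by (simp add: matrix_mult_diff_left matrix_mult_diff_right matrix_inv_left inv_t
          matrix_mul_assoc[symmetric] matrix_inv_right inv)
    finally show ?case by (simp flip: scaleR_minus_right)
  qed
  have "((\<lambda>t. - (matrix_inv (A t) ** ((A t - A 0) /\<^sub>R t) ** matrix_inv (A 0)))
      \<longlongrightarrow> - (matrix_inv (A 0) ** A' ** matrix_inv (A 0))) (at 0)"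
    using deriv unfolding has_vector_derivative_at_0_iff
    by (intro tendsto_minus tendsto_matrix_mult tendsto_matrix_inv lim inv tendsto_const)
  then show ?thesis
    unfolding has_vector_derivative_at_0_iff using ev by (rule Lim_transform_eventually)
qed

section \<open>Perturbation of a definite pencil\<close>

text \<open>A null vector \<open>v\<close> of \<open>N - c T\<close> satisfies \<open>v\<^sup>* N v = c v\<^sup>* T v\<close>; both quadratic forms are real and the
  second one is nonzero.\<close>

lemma definite_pencil_root_real:
  assumes N: "N\<^sup>\<dagger> = N" and T: "pos_def_hermitian T" and root: "det (N - mat c ** T) = 0"
  shows "Im c = 0"
proof -
  obtain v where v: "v \<noteq> 0" "N *v v = c *s (T *v v)"
    using root unfolding det_eq_0_iff_kernel
    by (auto simp: matrix_vector_mult_diff_rdistrib matrix_vector_mul_assoc[symmetric] mat_mult_vec)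
  have herm: "Im (cinner v (B *v v)) = 0" if "B\<^sup>\<dagger> = B" for B
  proof -
    have "cinner v (B *v v) = cnj (cinner v (B *v v))"
      by (metis cinner_commute cinner_matrix_right that)
    then show ?thesis by (simp add: complex_eq_iff)
  qed
  have "cinner v (N *v v) = c * cinner v (T *v v)"
    by (simp add: v cinner_scale_right)
  then have "Im c * Re (cinner v (T *v v)) = 0"
    using herm[OF N] herm[of T] T by (simp add: pos_def_hermitian_iff)
  moreover have "Re (cinner v (T *v v)) > 0" using T v by (simp add: pos_def_hermitian_iff)
  ultimately show ?thesis by simp
qed

lemma degree_prod_linear_le:
  "degree (\<Prod>i\<in>A. [:a i, b i:]) \<le> card A" if "finite A" for a b :: "'i \<Rightarrow> 'a::comm_semiring_1"
proof -
  have "degree (\<Prod>i\<in>A. [:a i, b i:]) \<le> sum (degree \<circ> (\<lambda>i. [:a i, b i:])) A"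
    by (rule degree_prod_sum_le[OF that])
  also have "\<dots> \<le> (\<Sum>i\<in>A. 1)" by (intro sum_mono) auto
  finally show ?thesis by simp
qed

text \<open>In \<open>c\<close> the determinant is a polynomial of degree at most \<open>q\<close>, and it is not the zero polynomial
  because the imaginary unit is not a root.\<close>

lemma definite_pencil_roots:
  fixes N T :: "complex^'q^'q"
  assumes N: "N\<^sup>\<dagger> = N" and T: "pos_def_hermitian T"
  shows "finite {c. det (N - mat c ** T) = 0}" "card {c. det (N - mat c ** T) = 0} \<le> CARD('q)"
proof -
  define p where "p = (\<Sum>\<pi>\<in>{\<pi>. \<pi> permutes (UNIV :: 'q set)}.
    smult (of_int (sign \<pi>)) (\<Prod>i\<in>UNIV. [:N $ i $ \<pi> i, - (T $ i $ \<pi> i):]))"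
  have p: "poly p c = det (N - mat c ** T)" for c
    by (simp add: p_def det_def poly_sum poly_prod)
  have deg: "degree p \<le> CARD('q)"
    unfolding p_def
    by (intro degree_sum_le order.trans[OF degree_smult_le] degree_prod_linear_le) auto
  have "poly p \<i> \<noteq> 0" using definite_pencil_root_real[OF N T, of \<i>] by (auto simp: p)
  then have "p \<noteq> 0" by auto
  then show "finite {c. det (N - mat c ** T) = 0}" "card {c. det (N - mat c ** T) = 0} \<le> CARD('q)"
    using poly_roots_finite[of p] card_poly_roots_bound[of p] deg by (auto simp: p)
qed

text \<open>Consequently it is enough to exhibit \<open>q\<close> distinct roots in order to know the whole spectrum.\<close>

lemma definite_pencil_roots_range:
  fixes N T :: "complex^'q^'q" and f :: "real^'q"
  assumes N: "N\<^sup>\<dagger> = N" and T: "pos_def_hermitian T"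
    and root: "\<And>k. det (N - mat (of_real (f $ k)) ** T) = 0" and inj: "inj (($) f)"
  shows "{c. det (N - mat c ** T) = 0} = range (\<lambda>k. complex_of_real (f $ k))"
proof (rule card_seteq[symmetric])
  show "finite {c. det (N - mat c ** T) = 0}" by (rule definite_pencil_roots[OF N T])
  have "card (range (\<lambda>k. complex_of_real (f $ k))) = CARD('q)"
    using inj by (intro card_image) (auto simp: inj_def)
  then show "card {c. det (N - mat c ** T) = 0} \<le> card (range (\<lambda>k. complex_of_real (f $ k)))"
    using definite_pencil_roots[OF N T] by simp
qed (use root in auto)

lemma ordered_coneD:
  assumes "f \<in> ordered_cone"
  shows "f $ k > 0" "k < b \<Longrightarrow> f $ k > f $ b" "k \<noteq> b \<Longrightarrow> f $ k \<noteq> f $ b" "inj (($) f)"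
proof -
  show "f $ k > 0" and lt: "k < b \<Longrightarrow> f $ k > f $ b" for k b
    using assms by (auto simp: ordered_cone_def)
  show ne: "f $ k \<noteq> f $ b" if "k \<noteq> b" for k b
    using lt[of k b] lt[of b k] that by (cases k b rule: linorder_cases) auto
  show "inj (($) f)" using ne by (auto simp: inj_def)
qed

text \<open>Each index is determined by the number of larger entries.\<close>

lemma ordered_cone_unique:
  assumes f: "f \<in> ordered_cone" and g: "g \<in> ordered_cone" and range: "range (($) f) = range (($) g)"
  shows "f = g"
proof -
  have card: "card {x \<in> range (($) h). x > h $ k} = card {b. b < k}" if "h \<in> ordered_cone" for h k
  proof -
    have "h $ b > h $ k \<longleftrightarrow> b < k" for b
      using ordered_coneD(2)[OF that, of b k] ordered_coneD(2)[OF that, of k b]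
      by (cases b k rule: linorder_cases) auto
    then have "{x \<in> range (($) h). x > h $ k} = ($) h ` {b. b < k}" by auto
    then show ?thesis
      using ordered_coneD(4)[OF that] by (simp add: card_image inj_on_subset)
  qed
  have rank: "k = j" if "card {b. b < k} = card {b. b < j}" for k j :: 'a
  proof (rule ccontr)
    assume "k \<noteq> j"
    have "card {b. b < k} < card {b. b < j}" if "k < j" for k j :: 'a
      using that by (intro psubset_card_mono) auto
    then show False using \<open>k \<noteq> j\<close> that by (metis less_irrefl linorder_neqE)
  qed
  have "f $ k = g $ k" for k
  proof -
    obtain j where j: "f $ k = g $ j" using range by (metis rangeE rangeI)
    have "card {b. b < k} = card {b. b < j}"
      using card[OF f, of k] card[OF g, of j] range j by simp
    then show ?thesis using rank j by blast
  qed
  then show ?thesis by (simp add: vec_eq_iff)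
qed

lemma kernel_diag_bound:
  fixes M :: "complex^'q^'q"
  assumes sing: "det M = 0" and off: "\<And>i j. i \<noteq> j \<Longrightarrow> cmod (M $ i $ j) \<le> \<epsilon>"
    and diag: "\<And>i. i \<noteq> k \<Longrightarrow> c \<le> cmod (M $ i $ i)"
    and small: "real CARD('q) * \<epsilon> < c" and pos: "0 \<le> \<epsilon>"
  shows "cmod (M $ k $ k) \<le> (real CARD('q) * \<epsilon>)\<^sup>2 / c"
proof -
  have c: "c > 0" using small pos by (smt (verit) mult_nonneg_nonneg of_nat_0_le_iff)
  obtain v where v: "v \<noteq> 0" "M *v v = 0" using sing by (auto simp: det_eq_0_iff_kernel)
  have "Max (range (\<lambda>i. cmod (v $ i))) \<in> range (\<lambda>i. cmod (v $ i))" by (rule Max_in) auto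
  then obtain l where "Max (range (\<lambda>i. cmod (v $ i))) = cmod (v $ l)" by (rule rangeE)
  then have l: "cmod (v $ i) \<le> cmod (v $ l)" for i by (metis Max_ge finite finite_imageI rangeI)
  obtain i where "v $ i \<noteq> 0" using v(1) by (auto simp: vec_eq_iff)
  then have vl: "cmod (v $ l) > 0" using l[of i] by (metis le_less_trans not_le zero_less_norm_iff)
  have row: "cmod (M $ i $ i) * cmod (v $ i) \<le> real CARD('q) * (\<epsilon> * b)"
    if b: "\<And>j. j \<noteq> i \<Longrightarrow> cmod (v $ j) \<le> b" "b \<ge> 0" for i b
  proof -
    have "(M *v v) $ i = 0" using v by simp
    then have "M $ i $ i * v $ i = - (\<Sum>j\<in>UNIV - {i}. M $ i $ j * v $ j)"
      by (simp add: matrix_vector_mult_def sum.remove[of UNIV i] add_eq_0_iff2)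
    then have "cmod (M $ i $ i) * cmod (v $ i) = cmod (\<Sum>j\<in>UNIV - {i}. M $ i $ j * v $ j)"
      by (metis norm_minus_cancel norm_mult)
    also have "\<dots> \<le> (\<Sum>j\<in>UNIV - {i}. \<epsilon> * b)"
      by (rule sum_norm_le) (use off b pos in \<open>auto simp: norm_mult intro!: mult_mono\<close>)
    also have "\<dots> \<le> (\<Sum>j\<in>(UNIV :: 'q set). \<epsilon> * b)"
      using pos b by (intro sum_mono2) auto
    finally show ?thesis by simp
  qed
  have "l = k"
  proof (rule ccontr)
    assume "l \<noteq> k"
    then have "c * cmod (v $ l) \<le> cmod (M $ l $ l) * cmod (v $ l)"
      using diag by (intro mult_right_mono) auto
    also have "\<dots> \<le> real CARD('q) * (\<epsilon> * cmod (v $ l))" using l by (intro row) auto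
    finally have "c \<le> real CARD('q) * \<epsilon>" using vl by (simp flip: mult.assoc)
    then show False using small by simp
  qed
  have vj: "cmod (v $ j) \<le> real CARD('q) * (\<epsilon> * cmod (v $ k)) / c" if "j \<noteq> k" for j
  proof -
    have "c * cmod (v $ j) \<le> cmod (M $ j $ j) * cmod (v $ j)"
      using diag that by (intro mult_right_mono) auto
    also have "\<dots> \<le> real CARD('q) * (\<epsilon> * cmod (v $ k))" using l \<open>l = k\<close> by (intro row) auto
    finally show ?thesis using c by (simp add: field_simps)
  qed
  have "cmod (M $ k $ k) * cmod (v $ k)
      \<le> real CARD('q) * (\<epsilon> * (real CARD('q) * (\<epsilon> * cmod (v $ k)) / c))"
    using c pos by (intro row vj) auto
  also have "\<dots> = (real CARD('q) * \<epsilon>)\<^sup>2 / c * cmod (v $ k)" by (simp add: power2_eq_square)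
  finally show ?thesis using vl \<open>l = k\<close> by (simp only: mult_le_cancel_right_pos)
qed

lemma has_vector_derivative_bound:
  fixes f :: "real \<Rightarrow> 'a::real_normed_vector"
  assumes "(f has_vector_derivative D) (at 0)"
  shows "\<forall>\<^sub>F t in at 0. norm (f t - f 0) \<le> (norm D + 1) * \<bar>t\<bar>"
proof -
  have "((\<lambda>t. norm ((f t - f 0) /\<^sub>R t)) \<longlongrightarrow> norm D) (at 0)"
    using assms by (intro tendsto_norm) (simp add: has_vector_derivative_at_0_iff)
  then have "\<forall>\<^sub>F t in at 0. norm ((f t - f 0) /\<^sub>R t) < norm D + 1"
    by (rule order_tendstoD) simp
  moreover have "\<forall>\<^sub>F t in at 0. t \<noteq> (0::real)" by (simp add: eventually_at_filter)
  ultimately show ?thesis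
  proof eventually_elim
    case (elim t)
    then have "norm (f t - f 0) / \<bar>t\<bar> < norm D + 1" by (simp add: divide_inverse_commute)
    with elim show ?case by (simp add: field_simps)
  qed
qed

text \<open>Near \<open>t = 0\<close> the real polynomial \<open>det (N t - x T t)\<close> still changes sign around each of the
  simple roots \<open>f k\<close>, so it keeps a root near each of them.\<close>

lemma pencil_roots_persist_normalized:
  fixes N T :: "real \<Rightarrow> ('q::{finite,linorder}, 'q) cmat" and f :: "'q rvec"
  assumes N: "(N \<longlongrightarrow> Diag (($) f)) (at 0)" "\<And>t. (N t)\<^sup>\<dagger> = N t"
    and T: "(T \<longlongrightarrow> mat 1) (at 0)" "\<And>t. (T t)\<^sup>\<dagger> = T t"
    and f: "f \<in> ordered_cone" and e: "e > 0"
  shows "\<forall>\<^sub>F t in at 0. \<exists>g \<in> ordered_cone.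
           (\<forall>k. \<bar>g $ k - f $ k\<bar> < e \<and> det (N t - mat (of_real (g $ k)) ** T t) = 0)"
proof -
  have "\<forall>\<^sub>F d in at_right 0. 0 < d \<and> d < e \<and> (\<forall>k. d < f $ k) \<and> (\<forall>k b. k \<noteq> b \<longrightarrow> 2 * d < \<bar>f $ k - f $ b\<bar>)"
  proof (intro eventually_conj eventually_all_finite)
    show "\<forall>\<^sub>F d in at_right 0. 0 < (d::real)" by (simp add: eventually_at_right_less)
    have lt: "\<forall>\<^sub>F d in at_right 0. d < c" if "c > 0" for c :: real
      using that eventually_at_right_field by blast
    show "\<forall>\<^sub>F d in at_right 0. d < e" using lt e .
    show "\<forall>\<^sub>F d in at_right 0. d < f $ k" for k using lt ordered_coneD(1)[OF f] .
    fix k b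
    show "\<forall>\<^sub>F d in at_right 0. k \<noteq> b \<longrightarrow> 2 * d < \<bar>f $ k - f $ b\<bar>"
    proof (cases "k = b")
      case False
      then have "\<bar>f $ k - f $ b\<bar> / 2 > 0" using ordered_coneD(3)[OF f] by simp
      from lt[OF this] show ?thesis by eventually_elim auto
    qed simp
  qed
  from eventually_happens'[OF trivial_limit_at_right_real this]
  obtain d where d: "0 < d" "d < e" "\<And>k. d < f $ k" "\<And>k b. k \<noteq> b \<Longrightarrow> 2 * d < \<bar>f $ k - f $ b\<bar>"
    by blast
  define r where "r t x = Re (det (N t - mat (of_real x) ** T t))" for t x
  have det_r: "det (N t - mat (of_real x) ** T t) = of_real (r t x)" for t x
  proof -
    have "(N t - mat (of_real x) ** T t)\<^sup>\<dagger> = N t - mat (of_real x) ** T t"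
      using N(2)[of t] T(2)[of t] by (simp add: vec_eq_iff)
    then have "cnj (det (N t - mat (of_real x) ** T t)) = det (N t - mat (of_real x) ** T t)"
      by (metis det_conj_transpose)
    then show ?thesis by (simp add: r_def complex_eq_iff)
  qed
  have lim: "((\<lambda>t. r t x) \<longlongrightarrow> (\<Prod>b\<in>UNIV. f $ b - x)) (at 0)" for x
  proof -
    have "((\<lambda>t. det (N t - mat (of_real x) ** T t)) \<longlongrightarrow>
        det (Diag (($) f) - mat (of_real x) ** mat 1)) (at 0)"
      by (intro tendsto_det tendsto_diff tendsto_matrix_mult tendsto_const N T)
    also have "Diag (($) f) - mat (of_real x) ** mat 1 = Diag (\<lambda>b. f $ b - x)"
      by (simp add: vec_eq_iff mat_nth)
    finally have "((\<lambda>t. r t x) \<longlongrightarrow> Re (of_real (\<Prod>b\<in>UNIV. f $ b - x))) (at 0)"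
      unfolding r_def det_Diag of_real_prod by (rule tendsto_Re)
    then show ?thesis by (simp only: Re_complex_of_real)
  qed
  have cont: "continuous_on A (r t)" for A t
  proof -
    have "continuous_on A (\<lambda>x. det (N t - mat (complex_of_real x) ** T t))"
      unfolding det_def by (simp, intro continuous_intros)
    then show ?thesis unfolding r_def by (rule continuous_on_Re)
  qed
  \<comment> \<open>Exactly one root of the unperturbed polynomial lies between \<open>f k - d\<close> and \<open>f k + d\<close>.\<close>
  have "\<forall>\<^sub>F t in at 0. \<forall>k. r t (f $ k - d) * r t (f $ k + d) < 0"
  proof (rule eventually_all_finite)
    fix k
    have "(\<Prod>b\<in>UNIV. f $ b - (f $ k - d)) * (\<Prod>b\<in>UNIV. f $ b - (f $ k + d))
        = (\<Prod>b\<in>UNIV. (f $ b - f $ k)\<^sup>2 - d\<^sup>2)"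
      by (simp flip: prod.distrib) (simp add: algebra_simps power2_eq_square)
    also have "\<dots> = - d\<^sup>2 * (\<Prod>b\<in>UNIV - {k}. (f $ b - f $ k)\<^sup>2 - d\<^sup>2)"
      by (simp add: prod.remove[of UNIV k])
    also have "\<dots> < 0"
    proof -
      have "(f $ b - f $ k)\<^sup>2 - d\<^sup>2 > 0" if "b \<noteq> k" for b
        using d(4)[OF that] d(1) power_strict_mono[of d "\<bar>f $ b - f $ k\<bar>" 2] by simp
      then have "(\<Prod>b\<in>UNIV - {k}. (f $ b - f $ k)\<^sup>2 - d\<^sup>2) > 0" by (intro prod_pos) auto
      then show ?thesis using d(1) by (simp add: mult_less_0_iff)
    qed
    finally show "\<forall>\<^sub>F t in at 0. r t (f $ k - d) * r t (f $ k + d) < 0"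
      by (rule order_tendstoD(2)[OF tendsto_mult[OF lim lim]])
  qed
  then show ?thesis
  proof eventually_elim
    case (elim t)
    have "\<exists>x. \<bar>x - f $ k\<bar> < d \<and> r t x = 0" for k
    proof -
      have neg: "r t (f $ k - d) * r t (f $ k + d) < 0" using elim by blast
      have le: "f $ k - d \<le> f $ k + d" using d(1) by simp
      have "\<exists>x. f $ k - d \<le> x \<and> x \<le> f $ k + d \<and> r t x = 0"
      proof (cases "r t (f $ k - d) \<le> 0")
        case True
        then have "0 \<le> r t (f $ k + d)" using neg by (smt (verit) mult_nonpos_nonpos)
        then show ?thesis using IVT'[OF True _ le cont] by blast
      next
        case False
        then have "r t (f $ k + d) \<le> 0" using neg by (smt (verit) mult_nonneg_nonneg)
        then show ?thesis using IVT2'[OF _ _ le cont, of t 0] False by auto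
      qed
      then obtain x where x: "f $ k - d \<le> x" "x \<le> f $ k + d" "r t x = 0" by blast
      with neg have "x \<noteq> f $ k - d" "x \<noteq> f $ k + d" by auto
      with x show ?thesis by (intro exI[of _ x]) (auto simp: abs_less_iff)
    qed
    then obtain x where x: "\<And>k. \<bar>x k - f $ k\<bar> < d" "\<And>k. r t (x k) = 0" by metis
    have "x k > 0" for k using x(1)[of k] d(3)[of k] by simp
    moreover have "x b < x k" if "k < b" for k b
      using x(1)[of k] x(1)[of b] d(4)[OF less_imp_neq[OF that]] ordered_coneD(2)[OF f that]
      by linarith
    ultimately have "(\<chi> k. x k) \<in> ordered_cone" by (simp add: ordered_cone_def)
    moreover have "\<bar>x k - f $ k\<bar> < e" for k using x(1)[of k] d(2) by simp
    ultimately show ?case using x(2) by (intro bexI[of _ "\<chi> k. x k"]) (auto simp: det_r)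
  qed
qed

lemma has_vector_derivative_sandwich:
  fixes A :: "real \<Rightarrow> complex^'b^'a" and L :: "complex^'a^'c" and R :: "complex^'d^'b"
  assumes "(A has_vector_derivative A') F"
  shows "((\<lambda>t. L ** A t ** R) has_vector_derivative L ** A' ** R) F"
  by (intro assms bounded_linear.has_vector_derivative[
        OF bounded_bilinear.bounded_linear_left[OF bounded_bilinear_matrix_mult]]
      bounded_linear.has_vector_derivative[
        OF bounded_bilinear.bounded_linear_right[OF bounded_bilinear_matrix_mult]])

lemma det_congruence_eq_0_iff:
  fixes N T X :: "complex^'q^'q"
  assumes "invertible X"
  shows "det (X\<^sup>\<dagger> ** N ** X - mat c ** (X\<^sup>\<dagger> ** T ** X)) = 0 \<longleftrightarrow> det (N - mat c ** T) = 0"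
proof -
  have "mat c ** (X\<^sup>\<dagger> ** T ** X) = X\<^sup>\<dagger> ** (mat c ** T) ** X"
    by (metis matrix_mul_assoc mat_commute)
  then have "X\<^sup>\<dagger> ** N ** X - mat c ** (X\<^sup>\<dagger> ** T ** X) = X\<^sup>\<dagger> ** (N - mat c ** T) ** X"
    by (simp add: matrix_mult_diff_left matrix_mult_diff_right)
  then show ?thesis
    using assms by (simp add: det_mul det_conj_transpose invertible_det_nz)
qed

lemma invertible_of_congruence:
  fixes X T :: "complex^'q^'q"
  assumes "X\<^sup>\<dagger> ** T ** X = mat 1"
  shows "invertible X"
  using assms invertible_left_inverse by blast

lemma cmod_entry_le_norm: "cmod (B $ i $ j) \<le> norm B" for B :: "complex^'b^'a"
  by (rule order_trans[OF Finite_Cartesian_Product.norm_nth_le Finite_Cartesian_Product.norm_nth_le])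

lemma pencil_roots_persist:
  fixes N T :: "real \<Rightarrow> ('q::{finite,linorder}, 'q) cmat" and f :: "'q rvec"
  assumes N: "(N \<longlongrightarrow> N0) (at 0)" "\<And>t. (N t)\<^sup>\<dagger> = N t"
    and T: "(T \<longlongrightarrow> T0) (at 0)" "\<And>t. (T t)\<^sup>\<dagger> = T t"
    and X: "X\<^sup>\<dagger> ** T0 ** X = mat 1" "X\<^sup>\<dagger> ** N0 ** X = Diag (($) f)"
    and f: "f \<in> ordered_cone" and e: "e > 0"
  shows "\<forall>\<^sub>F t in at 0. \<exists>g \<in> ordered_cone.
           (\<forall>k. \<bar>g $ k - f $ k\<bar> < e \<and> det (N t - mat (of_real (g $ k)) ** T t) = 0)"
proof -
  have inv: "invertible X" using X(1) by (rule invertible_of_congruence)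
  have "((\<lambda>t. X\<^sup>\<dagger> ** N t ** X) \<longlongrightarrow> Diag (($) f)) (at 0)"
    "((\<lambda>t. X\<^sup>\<dagger> ** T t ** X) \<longlongrightarrow> mat 1) (at 0)"
    unfolding X[symmetric] by (intro tendsto_matrix_mult tendsto_const N T)+
  moreover have "(X\<^sup>\<dagger> ** N t ** X)\<^sup>\<dagger> = X\<^sup>\<dagger> ** N t ** X" "(X\<^sup>\<dagger> ** T t ** X)\<^sup>\<dagger> = X\<^sup>\<dagger> ** T t ** X" for t
    by (simp_all add: conj_transpose_mult N(2) T(2) matrix_mul_assoc)
  ultimately show ?thesis
    using pencil_roots_persist_normalized[OF _ _ _ _ f e,
        of "\<lambda>t. X\<^sup>\<dagger> ** N t ** X" "\<lambda>t. X\<^sup>\<dagger> ** T t ** X"]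
    by (simp only: det_congruence_eq_0_iff[OF inv])
qed

lemma has_vector_derivative_imp_tendsto:
  "(f has_vector_derivative D) (at 0) \<Longrightarrow> (f \<longlongrightarrow> f 0) (at 0)"
  using has_vector_derivative_continuous by (auto simp: continuous_within)

text \<open>First-order perturbation of the roots.  In the coordinates \<open>X\<close> the singular matrix
  \<open>N t - \<phi> k t * T t\<close> has off-diagonal entries of order \<open>t\<close>, so its vanishing diagonal entry is of
  order \<open>t\<^sup>2\<close>, which pins \<open>\<phi> k t\<close> down to first order.\<close>

lemma pencil_roots_derivative:
  fixes N T :: "real \<Rightarrow> ('q::{finite,linorder}, 'q) cmat" and \<phi> :: "real \<Rightarrow> 'q rvec"
  assumes N: "(N has_vector_derivative N') (at 0)" "\<And>t. (N t)\<^sup>\<dagger> = N t"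
    and T: "(T has_vector_derivative T') (at 0)" "\<And>t. (T t)\<^sup>\<dagger> = T t"
    and X: "X\<^sup>\<dagger> ** T 0 ** X = mat 1" "X\<^sup>\<dagger> ** N 0 ** X = Diag (($) (\<phi> 0))"
    and \<phi>: "\<phi> 0 \<in> ordered_cone"
    and ev: "\<forall>\<^sub>F t in at 0. pos_def_hermitian (T t) \<and> \<phi> t \<in> ordered_cone \<and>
               (\<forall>k. det (N t - mat (of_real (\<phi> t $ k)) ** T t) = 0)"
  shows "((\<lambda>t. \<phi> t $ k) has_real_derivative
           Re ((X\<^sup>\<dagger> ** N' ** X) $ k $ k - \<phi> 0 $ k * (X\<^sup>\<dagger> ** T' ** X) $ k $ k)) (at 0)"
proof -
  define f where "f = \<phi> 0"
  define n where "n t = X\<^sup>\<dagger> ** N t ** X" for t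
  define \<tau> where "\<tau> t = X\<^sup>\<dagger> ** T t ** X" for t
  define n' where "n' = X\<^sup>\<dagger> ** N' ** X"
  define \<tau>' where "\<tau>' = X\<^sup>\<dagger> ** T' ** X"
  have inv: "invertible X" using X(1) by (rule invertible_of_congruence)
  have n': "(n has_vector_derivative n') (at 0)" and \<tau>': "(\<tau> has_vector_derivative \<tau>') (at 0)"
    unfolding n_def n'_def \<tau>_def \<tau>'_def by (intro has_vector_derivative_sandwich N T)+
  have n0: "n 0 = Diag (($) f)" and \<tau>0: "\<tau> 0 = mat 1" by (simp_all add: n_def \<tau>_def X f_def)
  have close: "\<forall>\<^sub>F t in at 0. \<forall>k. \<bar>\<phi> t $ k - f $ k\<bar> < e" if "e > 0" for e
  proof -
    have "\<forall>\<^sub>F t in at 0. \<exists>g \<in> ordered_cone.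
        (\<forall>k. \<bar>g $ k - f $ k\<bar> < e \<and> det (N t - mat (of_real (g $ k)) ** T t) = 0)"
      unfolding f_def by (rule pencil_roots_persist[OF has_vector_derivative_imp_tendsto[OF N(1)] N(2)
            has_vector_derivative_imp_tendsto[OF T(1)] T(2) X \<phi> that])
    with ev show ?thesis
    proof eventually_elim
      case (elim t)
      then obtain g where g: "g \<in> ordered_cone"
        "\<And>k. \<bar>g $ k - f $ k\<bar> < e" "\<And>k. det (N t - mat (of_real (g $ k)) ** T t) = 0" by blast
      have "range (\<lambda>k. complex_of_real (g $ k)) = range (\<lambda>k. complex_of_real (\<phi> t $ k))"
        using definite_pencil_roots_range[OF N(2)[of t], of "T t"] elim g ordered_coneD(4) by metis
      then have "complex_of_real ` range (($) g) = complex_of_real ` range (($) (\<phi> t))"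
        by (simp add: image_image)
      then have "range (($) g) = range (($) (\<phi> t))"
        by (subst (asm) inj_image_eq_iff) (auto simp: inj_def)
      then have "g = \<phi> t" using ordered_cone_unique g(1) elim by blast
      then show ?case using g(2) by blast
    qed
  qed
  define M where "M t = n t - mat (of_real (\<phi> t $ k)) ** \<tau> t" for t
  have lim\<phi>: "((\<lambda>t. \<phi> t $ k) \<longlongrightarrow> f $ k) (at 0)"
    by (rule tendstoI) (use close in \<open>fastforce simp: dist_real_def elim: eventually_mono\<close>)
  have limM: "((\<lambda>t. M t $ i $ i) \<longlongrightarrow> of_real (f $ i - f $ k)) (at 0)" for i
  proof -
    have "((\<lambda>t. n t $ i $ i - of_real (\<phi> t $ k) * \<tau> t $ i $ i) \<longlongrightarrow>
        n 0 $ i $ i - of_real (f $ k) * \<tau> 0 $ i $ i) (at 0)"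
      by (intro tendsto_diff tendsto_mult tendsto_of_real lim\<phi> tendsto_vec_nth
          has_vector_derivative_imp_tendsto[OF n'] has_vector_derivative_imp_tendsto[OF \<tau>'])
    then show ?thesis by (simp add: M_def n0 \<tau>0 mat_nth)
  qed
  define C where "C = (norm n' + 1) + (f $ k + 1) * (norm \<tau>' + 1)"
  have fk: "f $ k > 0" using ordered_coneD(1) \<phi> by (auto simp: f_def)
  then have C: "C \<ge> 0" by (auto simp: C_def)
  have off: "\<forall>\<^sub>F t in at 0. \<forall>i j. i \<noteq> j \<longrightarrow> cmod (M t $ i $ j) \<le> C * \<bar>t\<bar>"
    using close[of 1, simplified] has_vector_derivative_bound[OF n'] has_vector_derivative_bound[OF \<tau>']
  proof eventually_elim
    case (elim t)
    have abs: "\<bar>\<phi> t $ k\<bar> \<le> f $ k + 1" using spec[OF elim(1), of k] fk by linarith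
    show ?case
    proof (intro allI impI)
      fix i j :: 'q assume "i \<noteq> j"
      then have "M t $ i $ j = (n t - n 0) $ i $ j - of_real (\<phi> t $ k) * (\<tau> t - \<tau> 0) $ i $ j"
        by (simp add: M_def n0 \<tau>0 mat_nth)
      also have "cmod \<dots> \<le> cmod ((n t - n 0) $ i $ j) + \<bar>\<phi> t $ k\<bar> * cmod ((\<tau> t - \<tau> 0) $ i $ j)"
        by (rule order_trans[OF norm_triangle_ineq4]) (simp add: norm_mult)
      also have "\<dots> \<le> (norm n' + 1) * \<bar>t\<bar> + (f $ k + 1) * ((norm \<tau>' + 1) * \<bar>t\<bar>)"
        using elim fk abs
        by (intro add_mono mult_mono order_trans[OF cmod_entry_le_norm]) auto
      also have "\<dots> = C * \<bar>t\<bar>" by (simp add: C_def algebra_simps)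
      finally show "cmod (M t $ i $ j) \<le> C * \<bar>t\<bar>" .
    qed
  qed
  obtain c where c: "c > 0" "\<And>i. i \<noteq> k \<Longrightarrow> c < \<bar>f $ i - f $ k\<bar>"
  proof -
    have "\<forall>\<^sub>F c in at_right 0. 0 < c \<and> (\<forall>i. i \<noteq> k \<longrightarrow> c < \<bar>f $ i - f $ k\<bar>)"
    proof (intro eventually_conj eventually_all_finite)
      fix i
      show "\<forall>\<^sub>F c in at_right 0. i \<noteq> k \<longrightarrow> c < \<bar>f $ i - f $ k\<bar>"
        using eventually_at_right_field[of "\<lambda>c. c < \<bar>f $ i - f $ k\<bar>" 0] ordered_coneD(3)[OF \<phi>, of i k]
        by (cases "i = k") (auto simp: f_def intro!: exI[of _ "\<bar>f $ i - f $ k\<bar>"])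
    qed (simp add: eventually_at_right_less)
    from eventually_happens'[OF trivial_limit_at_right_real this] that show thesis by blast
  qed
  have diag: "\<forall>\<^sub>F t in at 0. \<forall>i. i \<noteq> k \<longrightarrow> c \<le> cmod (M t $ i $ i)"
  proof (rule eventually_all_finite)
    fix i
    show "\<forall>\<^sub>F t in at 0. i \<noteq> k \<longrightarrow> c \<le> cmod (M t $ i $ i)"
    proof (cases "i = k")
      case False
      have "((\<lambda>t. cmod (M t $ i $ i)) \<longlongrightarrow> \<bar>f $ i - f $ k\<bar>) (at 0)"
        using tendsto_norm[OF limM[of i]] by (simp only: norm_of_real)
      from order_tendstoD(1)[OF this c(2)[OF False]] show ?thesis
        by eventually_elim auto
    qed simp
  qed
  have small: "\<forall>\<^sub>F t in at 0. real CARD('q) * (C * \<bar>t\<bar>) < c"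
  proof (rule order_tendstoD(2)[OF _ c(1)])
    show "((\<lambda>t. real CARD('q) * (C * \<bar>t\<bar>)) \<longlongrightarrow> 0) (at 0)" by (auto intro!: tendsto_eq_intros)
  qed
  define K where "K = (real CARD('q) * C)\<^sup>2 / c"
  have Mkk: "\<forall>\<^sub>F t in at 0. cmod (M t $ k $ k) \<le> K * \<bar>t\<bar>\<^sup>2"
    using off diag small ev
  proof eventually_elim
    case (elim t)
    have "det (M t) = 0"
      using elim det_congruence_eq_0_iff[OF inv] by (simp add: M_def n_def \<tau>_def)
    then have "cmod (M t $ k $ k) \<le> (real CARD('q) * (C * \<bar>t\<bar>))\<^sup>2 / c"
      by (rule kernel_diag_bound) (use elim C in auto)
    then show ?case by (simp add: K_def power_mult_distrib)
  qed
  have M0: "M 0 = Diag (\<lambda>i. f $ i - f $ k)"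
    by (simp add: M_def n0 \<tau>0 vec_eq_iff mat_nth flip: f_def)
  have dM: "((\<lambda>t. M t $ k $ k) has_vector_derivative 0) (at 0)"
    unfolding has_vector_derivative_at_0_iff
  proof (rule Lim_null_comparison)
    show "\<forall>\<^sub>F t in at 0. norm ((M t $ k $ k - M 0 $ k $ k) /\<^sub>R t) \<le> K * \<bar>t\<bar>"
      using Mkk
    proof eventually_elim
      case (elim t)
      then show ?case
        by (cases "t = 0") (auto simp: M0 field_simps power2_eq_square)
    qed
    show "((\<lambda>t. K * \<bar>t\<bar>) \<longlongrightarrow> 0) (at 0)" by (auto intro!: tendsto_eq_intros)
  qed
  have entry: "((\<lambda>t. Re (B t $ k $ k)) has_real_derivative Re (B' $ k $ k)) (at 0)"
    if "(B has_vector_derivative B') (at 0)" for B :: "real \<Rightarrow> ('q, 'q) cmat" and B'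
    unfolding has_real_derivative_iff_has_vector_derivative
    by (intro bounded_linear.has_vector_derivative[OF bounded_linear_Re] has_vector_derivative_nth that)
  have real: "Im (B $ k $ k) = 0" if "B\<^sup>\<dagger> = B" for B :: "('q, 'q) cmat"
    using arg_cong[OF that, of "\<lambda>B. Im (B $ k $ k)"] by simp
  have dM': "((\<lambda>t. Re (M t $ k $ k)) has_real_derivative 0) (at 0)"
    using bounded_linear.has_vector_derivative[OF bounded_linear_Re dM]
    by (simp add: has_real_derivative_iff_has_vector_derivative)
  have quot: "((\<lambda>t. (Re (n t $ k $ k) - Re (M t $ k $ k)) / Re (\<tau> t $ k $ k)) has_real_derivative
      Re (n' $ k $ k) - f $ k * Re (\<tau>' $ k $ k)) (at 0)"
    by (rule derivative_eq_intros entry[OF n'] entry[OF \<tau>'] dM' refl)+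
       (simp_all add: n0 \<tau>0 M0 mat_nth)
  have eq: "\<phi> t $ k = (Re (n t $ k $ k) - Re (M t $ k $ k)) / Re (\<tau> t $ k $ k)"
    if "Re (\<tau> t $ k $ k) \<noteq> 0" for t
    using that by (simp add: M_def)
  have "((\<lambda>t. Re (\<tau> t $ k $ k)) \<longlongrightarrow> Re (\<tau> 0 $ k $ k)) (at 0)"
    by (intro tendsto_intros has_vector_derivative_imp_tendsto[OF \<tau>'])
  from tendsto_imp_eventually_ne[OF this, of 0]
  have "\<forall>\<^sub>F t in nhds 0. Re (\<tau> t $ k $ k) \<noteq> 0"
    by (simp add: \<tau>0 mat_nth eventually_nhds_conv_at)
  then have cong: "\<forall>\<^sub>F t in nhds 0. (Re (n t $ k $ k) - Re (M t $ k $ k)) / Re (\<tau> t $ k $ k) = \<phi> t $ k"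
    by eventually_elim (simp add: eq)
  have "((\<lambda>t. \<phi> t $ k) has_real_derivative Re (n' $ k $ k) - f $ k * Re (\<tau>' $ k $ k)) (at 0)"
    by (rule iffD1[OF DERIV_cong_ev[OF refl cong refl] quot])
  then show ?thesis by (simp add: n'_def \<tau>'_def f_def)
qed

text \<open>The quadratic form is bounded below on the compact unit sphere, so a small Hermitian perturbation
  leaves it positive.\<close>

lemma pos_def_hermitian_persists:
  fixes T :: "'b \<Rightarrow> complex^'n^'n"
  assumes lim: "(T \<longlongrightarrow> T0) F" and herm: "\<And>t. (T t)\<^sup>\<dagger> = T t" and T0: "pos_def_hermitian T0"
  shows "\<forall>\<^sub>F t in F. pos_def_hermitian (T t)"
proof -
  have cont: "continuous_on (sphere 0 1) (\<lambda>v. Re (cinner v (T0 *v v)))"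
    unfolding cinner_def matrix_vector_mult_def by (simp, intro continuous_intros)
  obtain u where u: "u \<in> sphere 0 1"
    "\<And>v. v \<in> sphere 0 1 \<Longrightarrow> Re (cinner u (T0 *v u)) \<le> Re (cinner v (T0 *v v))"
  proof -
    have "sphere (0 :: complex^'n) 1 \<noteq> {}" by (simp add: sphere_eq_empty)
    from continuous_attains_inf[OF compact_sphere this cont] that show thesis by blast
  qed
  define c where "c = Re (cinner u (T0 *v u))"
  have "u \<noteq> 0" using u(1) by auto
  then have c: "c > 0" using T0 by (simp add: pos_def_hermitian_iff c_def)
  define K where "K = real CARD('n) * real CARD('n)"
  have form: "cmod (cinner v (E *v v)) \<le> K * norm E" if "norm v = 1" for v and E :: "complex^'n^'n"
  proof -
    have "cinner v (E *v v) = (\<Sum>i\<in>UNIV. \<Sum>j\<in>UNIV. cnj (v $ i) * (E $ i $ j * v $ j))"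
      by (simp add: cinner_def matrix_vector_mult_def sum_distrib_left)
    also have "cmod \<dots> \<le> (\<Sum>i\<in>(UNIV :: 'n set). \<Sum>j\<in>(UNIV :: 'n set). 1 * (norm E * 1))"
    proof (intro sum_norm_le)
      fix i j
      have v: "cmod (v $ i) \<le> 1" for i using Finite_Cartesian_Product.norm_nth_le[of v i] that by simp
      show "cmod (cnj (v $ i) * (E $ i $ j * v $ j)) \<le> 1 * (norm E * 1)"
        unfolding norm_mult using v by (intro mult_mono cmod_entry_le_norm) auto
    qed
    finally show ?thesis by (simp add: K_def mult.assoc)
  qed
  have "((\<lambda>t. K * norm (T t - T0)) \<longlongrightarrow> K * norm (T0 - T0)) F" by (intro tendsto_intros lim)
  then have "\<forall>\<^sub>F t in F. K * norm (T t - T0) < c" using c by (intro order_tendstoD(2)) auto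
  then show ?thesis
  proof eventually_elim
    case (elim t)
    have pos: "Re (cinner v (T t *v v)) > 0" if "norm v = 1" for v
    proof -
      have "cinner v (T t *v v) = cinner v (T0 *v v) + cinner v ((T t - T0) *v v)"
        by (simp add: cinner_def matrix_vector_mult_diff_rdistrib algebra_simps flip: sum.distrib)
      moreover have "\<bar>Re (cinner v ((T t - T0) *v v))\<bar> < c"
        using form[OF that, of "T t - T0"] elim abs_Re_le_cmod order_trans
        by (meson le_less_trans)
      moreover have "c \<le> Re (cinner v (T0 *v v))" using u(2)[of v] that by (simp add: c_def)
      ultimately show ?thesis by simp
    qed
    have "Re (cinner v (T t *v v)) > 0" if "v \<noteq> 0" for v
    proof -
      define u where "u = complex_of_real (1 / norm v) *s v"
      have "cinner u (T t *v u) = of_real ((1 / norm v)\<^sup>2) * cinner v (T t *v v)"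
        by (simp add: u_def vector_scalar_commute cinner_scale_left cinner_scale_right power2_eq_square)
      moreover have "u = v /\<^sub>R norm v"
        unfolding u_def vec_eq_iff vector_smult_component vector_scaleR_component
        by (simp add: scaleR_conv_of_real divide_inverse)
      then have "Re (cinner u (T t *v u)) > 0" using that by (intro pos) simp
      ultimately have "(1 / norm v)\<^sup>2 * Re (cinner v (T t *v v)) > 0" by (simp del: of_real_power)
      then show ?thesis using that by (simp add: zero_less_mult_iff)
    qed
    then show ?case using herm by (simp add: pos_def_hermitian_iff)
  qed
qed

section \<open>Derivatives of spectral functions\<close>

lemma has_vector_derivative_transform_eventually:
  fixes f g :: "real \<Rightarrow> 'a::real_normed_vector"
  assumes f: "(f has_vector_derivative D) (at 0)" and ev: "\<forall>\<^sub>F t in at 0. f t = g t" and 0: "f 0 = g 0"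
  shows "(g has_vector_derivative D) (at 0)"
proof -
  have "\<forall>\<^sub>F t in at 0. (f t - f 0) /\<^sub>R t = (g t - g 0) /\<^sub>R t" using ev by eventually_elim (simp add: 0)
  with f show ?thesis
    unfolding has_vector_derivative_at_0_iff by (rule Lim_transform_eventually)
qed

text \<open>The unnormalized Lagrange polynomial that vanishes at the listed nodes, evaluated at a matrix.\<close>

fun shifted_product :: "complex^'q^'q \<Rightarrow> real list \<Rightarrow> complex^'q^'q" where
  "shifted_product W [] = mat 1"
| "shifted_product W (c # cs) = (W - c *\<^sub>R mat 1) ** shifted_product W cs"

lemma sandwich_mult:
  fixes X :: "complex^'q^'q"
  assumes "invertible X"
  shows "(X ** B ** matrix_inv X) ** (X ** C ** matrix_inv X) = X ** (B ** C) ** matrix_inv X"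
proof -
  have "(X ** B ** matrix_inv X) ** (X ** C ** matrix_inv X) = X ** B ** (matrix_inv X ** X) ** C ** matrix_inv X"
    by (simp add: matrix_mul_assoc)
  then show ?thesis by (simp add: matrix_inv_left assms matrix_mul_assoc)
qed

lemma sandwich_cancel:
  fixes X :: "complex^'q^'q"
  assumes "invertible X"
  shows "matrix_inv X ** (X ** B ** matrix_inv X) ** X = B" "X ** (matrix_inv X ** B ** X) ** matrix_inv X = B"
proof -
  have "matrix_inv X ** (X ** B ** matrix_inv X) ** X = (matrix_inv X ** X) ** B ** (matrix_inv X ** X)"
    "X ** (matrix_inv X ** B ** X) ** matrix_inv X = (X ** matrix_inv X) ** B ** (X ** matrix_inv X)"
    by (simp_all only: matrix_mul_assoc)
  then show "matrix_inv X ** (X ** B ** matrix_inv X) ** X = B"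
    "X ** (matrix_inv X ** B ** X) ** matrix_inv X = B"
    by (simp_all add: matrix_inv_left matrix_inv_right assms)
qed

lemma scaleR_matrix_nth: "(c *\<^sub>R A) $ i $ j = of_real c * A $ i $ j" for A :: "complex^'b^'a"
  by (simp only: vector_scaleR_component) (simp add: scaleR_conv_of_real)

lemma shifted_product_diagonalized:
  fixes X :: "complex^'q^'q"
  assumes "invertible X"
  shows "shifted_product (X ** Diag d ** matrix_inv X) cs
       = X ** Diag (\<lambda>k. prod_list (map (\<lambda>c. d k - c) cs)) ** matrix_inv X"
proof (induction cs)
  case Nil
  then show ?case by (simp add: Diag_1 matrix_inv_right assms)
next
  case (Cons c cs)
  have "c *\<^sub>R mat 1 = X ** (c *\<^sub>R mat 1) ** matrix_inv X"
    by (simp add: matrix_mult_scaleR matrix_inv_right assms)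
  then have "X ** Diag d ** matrix_inv X - c *\<^sub>R mat 1
      = X ** (Diag d - c *\<^sub>R mat 1) ** matrix_inv X"
    by (simp add: matrix_mult_diff_left matrix_mult_diff_right)
  also have "Diag d - c *\<^sub>R mat 1 = Diag (\<lambda>k. d k - c)"
    by (simp add: vec_eq_iff mat_nth scaleR_matrix_nth del: vector_scaleR_component)
  finally show ?case
    by (simp add: Cons.IH sandwich_mult[OF assms] Diag_mult_Diag)
qed

lemma has_vector_derivative_shifted_product:
  fixes W :: "real \<Rightarrow> complex^'q^'q" and \<phi> :: "'q \<Rightarrow> real \<Rightarrow> real"
  assumes W: "(W has_vector_derivative W') (at 0)"
    and \<phi>: "\<And>k. (\<phi> k has_real_derivative \<phi>' k) (at 0)"
  shows "\<exists>D. ((\<lambda>t. shifted_product (W t) (map (\<lambda>k. \<phi> k t) ks)) has_vector_derivative D) (at 0)"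
proof (induction ks)
  case (Cons k ks)
  then obtain D where D: "((\<lambda>t. shifted_product (W t) (map (\<lambda>k. \<phi> k t) ks)) has_vector_derivative D) (at 0)"
    by blast
  have "((\<lambda>t. W t - \<phi> k t *\<^sub>R mat 1) has_vector_derivative W' - \<phi>' k *\<^sub>R mat 1) (at 0)"
    by (intro has_vector_derivative_diff W)
       (use has_vector_derivative_scaleR[OF \<phi> has_vector_derivative_const] in auto)
  from has_vector_derivative_matrix_mult[OF this D] show ?case by (auto intro: exI)
qed (auto intro: exI[of _ 0])

text \<open>Lagrange interpolation writes \<open>A diag(\<eta>) A\<^sup>-\<^sup>1\<close> as a polynomial in \<open>W\<close> whose coefficients are
  rational functions of \<open>\<phi>\<close> and \<open>\<eta>\<close>.  Hence it is differentiable although the eigenvectors \<open>A\<close>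
  may depend on \<open>t\<close> in an arbitrary way.\<close>

lemma spectral_function_differentiable:
  fixes W A :: "real \<Rightarrow> complex^'q^'q" and \<phi> \<eta> :: "'q \<Rightarrow> real \<Rightarrow> real"
  assumes W: "(W has_vector_derivative W') (at 0)"
    and \<phi>: "\<And>k. (\<phi> k has_real_derivative \<phi>' k) (at 0)"
    and \<eta>: "\<And>k. (\<eta> k has_real_derivative \<eta>' k) (at 0)"
    and ev: "\<forall>\<^sub>F t in nhds 0. invertible (A t) \<and> inj (\<lambda>k. \<phi> k t) \<and>
               W t = A t ** Diag (\<lambda>k. \<phi> k t) ** matrix_inv (A t)"
  shows "\<exists>D. ((\<lambda>t. A t ** Diag (\<lambda>k. \<eta> k t) ** matrix_inv (A t)) has_vector_derivative D) (at 0)"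
proof -
  define others where "others k = (SOME ks. distinct ks \<and> set ks = UNIV - {k})" for k :: 'q
  have others: "distinct (others k)" "set (others k) = UNIV - {k}" for k
  proof -
    have "\<exists>ks. distinct ks \<and> set ks = UNIV - {k}" using finite_distinct_list[of "UNIV - {k}"] by auto
    from someI_ex[OF this] show "distinct (others k)" "set (others k) = UNIV - {k}"
      unfolding others_def by auto
  qed
  define \<delta> where "\<delta> k t = (\<Prod>b\<in>UNIV - {k}. \<phi> k t - \<phi> b t)" for k t
  define L where "L k t = shifted_product (W t) (map (\<lambda>b. \<phi> b t) (others k))" for k t
  have ev0: "invertible (A 0) \<and> inj (\<lambda>k. \<phi> k 0) \<and> W 0 = A 0 ** Diag (\<lambda>k. \<phi> k 0) ** matrix_inv (A 0)"
    using ev by (rule eventually_nhds_x_imp_x)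
  have \<delta>0: "\<delta> k 0 \<noteq> 0" for k
    using ev0 by (auto simp: \<delta>_def inj_def)
  have interpolation: "A t ** Diag (\<lambda>k. \<eta> k t) ** matrix_inv (A t) = (\<Sum>k\<in>UNIV. (\<eta> k t / \<delta> k t) *\<^sub>R L k t)"
    if t: "invertible (A t) \<and> inj (\<lambda>k. \<phi> k t) \<and> W t = A t ** Diag (\<lambda>k. \<phi> k t) ** matrix_inv (A t)" for t
  proof -
    have \<delta>: "\<delta> k t \<noteq> 0" for k
      using t by (auto simp: \<delta>_def inj_def)
    have L: "L k t = A t ** Diag (\<lambda>j. if j = k then \<delta> k t else 0) ** matrix_inv (A t)" for k
    proof -
      have "prod_list (map (\<lambda>c. \<phi> j t - c) (map (\<lambda>b. \<phi> b t) (others k))) = (\<Prod>b\<in>UNIV - {k}. \<phi> j t - \<phi> b t)" for j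
        using others[of k] by (simp add: comp_def prod.distinct_set_conv_list flip: others(2))
      also have "\<dots>j = (if j = k then \<delta> k t else 0)" for j
        by (auto simp: \<delta>_def intro!: prod_zero)
      finally show ?thesis
        using t by (simp add: L_def shifted_product_diagonalized)
    qed
    have "complex_of_real (\<eta> x t) * of_real (if i = x then \<delta> x t else 0) / of_real (\<delta> x t)
        = (if i = x then of_real (\<eta> x t) else 0)" for i x
      using \<delta>[of x] by simp
    then have "Diag (\<lambda>k. \<eta> k t) = (\<Sum>k\<in>UNIV. (\<eta> k t / \<delta> k t) *\<^sub>R Diag (\<lambda>j. if j = k then \<delta> k t else 0))"
      by (simp add: vec_eq_iff scaleR_matrix_nth del: vector_scaleR_component)
    then show ?thesis
      by (simp add: L bounded_bilinear.sum_right[OF bounded_bilinear_matrix_mult]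
          bounded_bilinear.sum_left[OF bounded_bilinear_matrix_mult]
          matrix_mult_scaleR)
  qed
  have "\<exists>D. (L k has_vector_derivative D) (at 0)" for k
    unfolding L_def by (rule has_vector_derivative_shifted_product[OF W \<phi>])
  then obtain L' where L': "(L k has_vector_derivative L' k) (at 0)" for k by metis
  have "\<exists>D. ((\<lambda>t. \<eta> k t / \<delta> k t) has_real_derivative D) (at 0)" for k
  proof -
    have "\<exists>D. (\<delta> k has_real_derivative D) (at 0)"
      unfolding \<delta>_def by (rule exI, rule has_field_derivative_prod, rule DERIV_diff[OF \<phi> \<phi>])
    then show ?thesis using \<eta>[of k] \<delta>0[of k] by (auto intro: exI DERIV_divide)
  qed
  then obtain c' where c': "((\<lambda>t. \<eta> k t / \<delta> k t) has_real_derivative c' k) (at 0)" for k by metis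
  have "((\<lambda>t. \<Sum>k\<in>UNIV. (\<eta> k t / \<delta> k t) *\<^sub>R L k t) has_vector_derivative
      (\<Sum>k\<in>UNIV. (\<eta> k 0 / \<delta> k 0) *\<^sub>R L' k + c' k *\<^sub>R L k 0)) (at 0)"
    by (intro has_vector_derivative_sum has_vector_derivative_scaleR c' L')
  then have "((\<lambda>t. A t ** Diag (\<lambda>k. \<eta> k t) ** matrix_inv (A t)) has_vector_derivative
      (\<Sum>k\<in>UNIV. (\<eta> k 0 / \<delta> k 0) *\<^sub>R L' k + c' k *\<^sub>R L k 0)) (at 0)"
  proof (rule has_vector_derivative_transform_eventually)
    show "\<forall>\<^sub>F t in at 0. (\<Sum>k\<in>UNIV. (\<eta> k t / \<delta> k t) *\<^sub>R L k t) = A t ** Diag (\<lambda>k. \<eta> k t) ** matrix_inv (A t)"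
      using ev unfolding eventually_nhds_conv_at
      by (auto elim!: eventually_mono simp: interpolation)
  qed (simp add: interpolation[OF ev0])
  then show ?thesis ..
qed

text \<open>Off the diagonal the derivative is found by differentiating the commutation relation of the
  spectral function with \<open>W\<close>; on the diagonal, by differentiating \<open>\<Phi> P = \<eta> k P\<close> for the \<open>k\<close>-th
  spectral projector \<open>P\<close>.\<close>

lemma spectral_function_derivative:
  fixes W A :: "real \<Rightarrow> complex^'q^'q" and \<phi> \<eta> :: "'q \<Rightarrow> real \<Rightarrow> real"
  assumes W: "(W has_vector_derivative W') (at 0)"
    and \<phi>: "\<And>k. (\<phi> k has_real_derivative \<phi>' k) (at 0)"
    and \<eta>: "\<And>k. (\<eta> k has_real_derivative \<eta>' k) (at 0)"
    and ev: "\<forall>\<^sub>F t in nhds 0. invertible (A t) \<and> inj (\<lambda>k. \<phi> k t) \<and>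
               W t = A t ** Diag (\<lambda>k. \<phi> k t) ** matrix_inv (A t)"
  defines "w \<equiv> matrix_inv (A 0) ** W' ** A 0"
  shows "((\<lambda>t. A t ** Diag (\<lambda>k. \<eta> k t) ** matrix_inv (A t)) has_vector_derivative
      A 0 ** (\<chi> i j. if i = j then of_real (\<eta>' i)
                    else of_real ((\<eta> i 0 - \<eta> j 0) / (\<phi> i 0 - \<phi> j 0)) * w $ i $ j) ** matrix_inv (A 0)) (at 0)"
proof -
  define spec where "spec e t = A t ** Diag (\<lambda>k. e k t) ** matrix_inv (A t)" for e t
  have ev0: "invertible (A 0) \<and> inj (\<lambda>k. \<phi> k 0) \<and> W 0 = A 0 ** Diag (\<lambda>k. \<phi> k 0) ** matrix_inv (A 0)"
    using ev by (rule eventually_nhds_x_imp_x)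
  then have inv: "invertible (A 0)" by blast
  have ev': "\<forall>\<^sub>F t in at 0. invertible (A t) \<and> inj (\<lambda>k. \<phi> k t) \<and> W t = spec \<phi> t"
    using ev unfolding eventually_nhds_conv_at spec_def by blast
  have spec_mult: "spec e t ** spec e' t = spec (\<lambda>k t. e k t * e' k t) t" if "invertible (A t)" for e e' t
    unfolding spec_def sandwich_mult[OF that] Diag_mult_Diag ..
  obtain D where D: "(spec \<eta> has_vector_derivative D) (at 0)"
    using spectral_function_differentiable[of W W' \<phi> \<phi>' \<eta> \<eta>' A, OF W \<phi> \<eta> ev] unfolding spec_def by blast
  define x where "x = matrix_inv (A 0) ** D ** A 0"
  have off: "x $ i $ j = of_real ((\<eta> i 0 - \<eta> j 0) / (\<phi> i 0 - \<phi> j 0)) * w $ i $ j" if "i \<noteq> j" for i j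
  proof -
    have "((\<lambda>t. spec \<eta> t ** W t) has_vector_derivative spec \<eta> 0 ** W' + D ** W 0) (at 0)"
      by (rule has_vector_derivative_matrix_mult[OF D W])
    moreover have "((\<lambda>t. spec \<eta> t ** W t) has_vector_derivative W 0 ** D + W' ** spec \<eta> 0) (at 0)"
    proof (rule has_vector_derivative_transform_eventually[OF has_vector_derivative_matrix_mult[OF W D]])
      show "\<forall>\<^sub>F t in at 0. W t ** spec \<eta> t = spec \<eta> t ** W t"
        using ev' by eventually_elim (simp add: spec_mult mult.commute)
      show "W 0 ** spec \<eta> 0 = spec \<eta> 0 ** W 0"
        using ev0 by (simp add: spec_mult mult.commute flip: spec_def)
    qed
    ultimately have "spec \<eta> 0 ** W' + D ** W 0 = W 0 ** D + W' ** spec \<eta> 0"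
      by (rule vector_derivative_unique_at)
    then have "matrix_inv (A 0) ** (spec \<eta> 0 ** W' + D ** W 0) ** A 0
        = matrix_inv (A 0) ** (W 0 ** D + W' ** spec \<eta> 0) ** A 0" by simp
    moreover have "matrix_inv (A 0) ** (spec \<eta> 0 ** W' + D ** W 0) ** A 0
        = Diag (\<lambda>k. \<eta> k 0) ** w + x ** Diag (\<lambda>k. \<phi> k 0)"
    proof -
      have "matrix_inv (A 0) ** (spec \<eta> 0 ** W') ** A 0 = Diag (\<lambda>k. \<eta> k 0) ** w"
        unfolding spec_def w_def by (simp add: matrix_mul_assoc matrix_inv_left inv)
      moreover have "matrix_inv (A 0) ** (D ** W 0) ** A 0 = x ** Diag (\<lambda>k. \<phi> k 0)"
        using ev0 unfolding x_def by (simp flip: matrix_mul_assoc add: matrix_inv_left)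
      ultimately show ?thesis by (simp add: matrix_add_ldistrib matrix_mult_add_left)
    qed
    moreover have "matrix_inv (A 0) ** (W 0 ** D + W' ** spec \<eta> 0) ** A 0
        = Diag (\<lambda>k. \<phi> k 0) ** x + w ** Diag (\<lambda>k. \<eta> k 0)"
    proof -
      have "matrix_inv (A 0) ** (W 0 ** D) ** A 0 = Diag (\<lambda>k. \<phi> k 0) ** x"
        using ev0 unfolding x_def by (simp add: matrix_mul_assoc matrix_inv_left)
      moreover have "matrix_inv (A 0) ** (W' ** spec \<eta> 0) ** A 0 = w ** Diag (\<lambda>k. \<eta> k 0)"
        unfolding spec_def w_def by (simp flip: matrix_mul_assoc add: matrix_inv_left inv)
      ultimately show ?thesis by (simp add: matrix_add_ldistrib matrix_mult_add_left)
    qed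
    ultimately have "(Diag (\<lambda>k. \<eta> k 0) ** w + x ** Diag (\<lambda>k. \<phi> k 0)) $ i $ j
        = (Diag (\<lambda>k. \<phi> k 0) ** x + w ** Diag (\<lambda>k. \<eta> k 0)) $ i $ j" by simp
    then have "x $ i $ j * of_real (\<phi> i 0 - \<phi> j 0) = of_real (\<eta> i 0 - \<eta> j 0) * w $ i $ j"
      by (simp add: algebra_simps)
    moreover have "complex_of_real (\<phi> i 0 - \<phi> j 0) \<noteq> 0"
      using ev0 that by (auto simp: inj_def)
    ultimately show ?thesis by (simp add: field_simps)
  qed
  have diag: "x $ k $ k = of_real (\<eta>' k)" for k
  proof -
    define P where "P = spec (\<lambda>j t. if j = k then 1 else 0)"
    obtain P' where P': "(P has_vector_derivative P') (at 0)"
      using spectral_function_differentiable[of W W' \<phi> \<phi>' "\<lambda>j t. if j = k then 1 else 0" "\<lambda>_. 0" A,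
          OF W \<phi> _ ev]
      unfolding P_def spec_def by auto
    have PD: "((\<lambda>t. spec \<eta> t ** P t) has_vector_derivative spec \<eta> 0 ** P' + D ** P 0) (at 0)"
      by (rule has_vector_derivative_matrix_mult[OF D P'])
    have eigen: "\<eta> k t *\<^sub>R P t = spec \<eta> t ** P t" if "invertible (A t)" for t
    proof -
      have "Diag (\<lambda>j. \<eta> j t * (if j = k then 1 else 0)) = \<eta> k t *\<^sub>R Diag (\<lambda>j. if j = k then 1 else 0)"
        by (simp add: vec_eq_iff scaleR_matrix_nth del: vector_scaleR_component)
      then have "spec (\<lambda>j t. \<eta> j t * (if j = k then 1 else 0)) t = \<eta> k t *\<^sub>R P t"
        unfolding spec_def P_def
        by (simp only: matrix_mult_scaleR)
      then show ?thesis by (simp add: P_def spec_mult[OF that])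
    qed
    have "((\<lambda>t. spec \<eta> t ** P t) has_vector_derivative \<eta> k 0 *\<^sub>R P' + \<eta>' k *\<^sub>R P 0) (at 0)"
    proof (rule has_vector_derivative_transform_eventually[OF has_vector_derivative_scaleR[OF \<eta> P']])
      show "\<forall>\<^sub>F t in at 0. \<eta> k t *\<^sub>R P t = spec \<eta> t ** P t"
        using ev' by eventually_elim (simp add: eigen)
    qed (simp add: eigen inv)
    with PD have eq: "spec \<eta> 0 ** P' + D ** P 0 = \<eta> k 0 *\<^sub>R P' + \<eta>' k *\<^sub>R P 0"
      by (rule vector_derivative_unique_at)
    define \<pi> where "\<pi> = matrix_inv (A 0) ** P' ** A 0"
    have "matrix_inv (A 0) ** (spec \<eta> 0 ** P' + D ** P 0) ** A 0
        = Diag (\<lambda>k. \<eta> k 0) ** \<pi> + x ** Diag (\<lambda>j. if j = k then 1 else 0)"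
    proof -
      have "matrix_inv (A 0) ** (spec \<eta> 0 ** P') ** A 0 = Diag (\<lambda>k. \<eta> k 0) ** \<pi>"
        unfolding spec_def \<pi>_def by (simp add: matrix_mul_assoc matrix_inv_left inv)
      moreover have "matrix_inv (A 0) ** (D ** P 0) ** A 0 = x ** Diag (\<lambda>j. if j = k then 1 else 0)"
        unfolding x_def P_def spec_def by (simp flip: matrix_mul_assoc add: matrix_inv_left inv)
      ultimately show ?thesis by (simp add: matrix_add_ldistrib matrix_mult_add_left)
    qed
    moreover have "matrix_inv (A 0) ** (\<eta> k 0 *\<^sub>R P' + \<eta>' k *\<^sub>R P 0) ** A 0
        = \<eta> k 0 *\<^sub>R \<pi> + \<eta>' k *\<^sub>R Diag (\<lambda>j. if j = k then 1 else 0)"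
      unfolding \<pi>_def P_def spec_def
      by (simp add: matrix_add_ldistrib matrix_mult_add_left sandwich_cancel[OF inv]
          matrix_mult_scaleR)
    ultimately have "(Diag (\<lambda>k. \<eta> k 0) ** \<pi> + x ** Diag (\<lambda>j. if j = k then 1 else 0)) $ k $ k
        = (\<eta> k 0 *\<^sub>R \<pi> + \<eta>' k *\<^sub>R Diag (\<lambda>j. if j = k then 1 else 0)) $ k $ k"
      by (simp add: eq)
    then show ?thesis by (simp add: scaleR_matrix_nth del: vector_scaleR_component)
  qed
  have "x = (\<chi> i j. if i = j then of_real (\<eta>' i)
                    else of_real ((\<eta> i 0 - \<eta> j 0) / (\<phi> i 0 - \<phi> j 0)) * w $ i $ j)"
    by (simp add: vec_eq_iff diag off)
  moreover have "A 0 ** x ** matrix_inv (A 0) = D" by (simp add: x_def sandwich_cancel[OF inv])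
  ultimately show ?thesis using D unfolding spec_def by simp
qed

lemma open_ordered_cone: "open (ordered_cone :: (('q::{finite,linorder}) rvec) set)"
proof -
  have "ordered_cone = (\<Inter>k. {f :: 'q rvec. f $ k > 0}) \<inter> (\<Inter>k. \<Inter>b\<in>{b. k < b}. {f. f $ k > f $ b})"
    by (auto simp: ordered_cone_def)
  also have "open \<dots>"
    by (intro open_Int open_INT ballI finite open_Collect_less continuous_intros)
  finally show ?thesis .
qed

text \<open>The first-order change of a function of a diagonal matrix: \<open>d\<close> holds its divided differences
  and \<open>g\<close> its partial derivatives.\<close>

definition spectral_diff :: "('q::finite \<Rightarrow> 'q \<Rightarrow> real) \<Rightarrow> ('q \<Rightarrow> 'q \<Rightarrow> real) \<Rightarrow> complex^'q^'q \<Rightarrow> complex^'q^'q" where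
  "spectral_diff d g w = (\<chi> i j. if i = j then \<Sum>l\<in>UNIV. of_real (g i l) * w $ l $ l
                                 else of_real (d i j) * w $ i $ j)"

definition divided_diff :: "('q::finite \<Rightarrow> real^'q \<Rightarrow> real) \<Rightarrow> real^'q \<Rightarrow> 'q \<Rightarrow> 'q \<Rightarrow> real" where
  "divided_diff h f i j = (h i f - h j f) / (f $ i - f $ j)"

definition partial_diff :: "('q::finite \<Rightarrow> real^'q \<Rightarrow> real) \<Rightarrow> real^'q \<Rightarrow> 'q \<Rightarrow> 'q \<Rightarrow> real" where
  "partial_diff h f i l = frechet_derivative (h i) (at f) (axis l 1)"

lemma differentiable_along_curve:
  fixes h :: "real^'q \<Rightarrow> real"
  assumes h: "h differentiable at (\<phi> 0)"
    and \<phi>: "\<And>l. ((\<lambda>t. \<phi> t $ l) has_real_derivative \<phi>' l) (at 0)"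
  shows "((\<lambda>t. h (\<phi> t)) has_real_derivative
           (\<Sum>l\<in>UNIV. frechet_derivative h (at (\<phi> 0)) (axis l 1) * \<phi>' l)) (at 0)"
proof -
  have D: "(h has_derivative frechet_derivative h (at (\<phi> 0))) (at (\<phi> 0))"
    using h by (simp add: frechet_derivative_works)
  have "((\<lambda>t. \<phi> t $ l) has_derivative (\<lambda>s. (s *\<^sub>R (\<chi> l. \<phi>' l)) $ l)) (at 0)" for l
    using \<phi>[of l] by (simp add: has_field_derivative_def mult_commute_abs)
  then have "(\<phi> has_derivative (\<lambda>s. s *\<^sub>R (\<chi> l. \<phi>' l))) (at 0)"
    unfolding has_derivative_componentwise_within[of \<phi>]
    by (auto simp: Basis_vec_def inner_axis)
  from diff_chain_at[OF this D]
  have "((\<lambda>t. h (\<phi> t)) has_derivative (\<lambda>s. frechet_derivative h (at (\<phi> 0)) (s *\<^sub>R (\<chi> l. \<phi>' l)))) (at 0)"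
    by (simp add: comp_def)
  moreover have lin: "linear (frechet_derivative h (at (\<phi> 0)))"
    using D has_derivative_linear by blast
  have "frechet_derivative h (at (\<phi> 0)) (\<chi> l. \<phi>' l)
      = (\<Sum>l\<in>UNIV. frechet_derivative h (at (\<phi> 0)) (axis l 1) * \<phi>' l)"
  proof -
    have "(\<chi> l. \<phi>' l) = (\<Sum>l\<in>UNIV. \<phi>' l *\<^sub>R axis l 1)"
      by (simp add: vec_eq_iff axis_def if_distrib[of "\<lambda>x. _ * x"] cong: if_cong)
    then show ?thesis by (simp add: linear_sum[OF lin] linear_scale[OF lin] mult.commute)
  qed
  ultimately show ?thesis
    by (simp add: has_field_derivative_def linear_scale[OF lin] mult_commute_abs)
qed

lemma h_diag_deriv_eq_partial_diff:
  fixes h :: "'q::finite \<Rightarrow> real^'q \<Rightarrow> real"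
  assumes "h k differentiable at f"
  shows "h_diag_deriv h k f = partial_diff h f k k"
proof -
  define \<phi> where "\<phi> t = (\<chi> i. if i = k then t + f $ k else f $ i)" for t
  have \<phi>0: "\<phi> 0 = f" by (simp add: \<phi>_def vec_eq_iff)
  have "((\<lambda>t. \<phi> t $ l) has_real_derivative of_bool (l = k)) (at 0)" for l
    by (cases "l = k") (auto simp: \<phi>_def intro!: derivative_eq_intros)
  from differentiable_along_curve[where \<phi>=\<phi>, OF _ this, of "h k"] assms
  have "((\<lambda>t. h k (\<phi> t)) has_real_derivative partial_diff h f k k) (at 0)"
    by (simp add: \<phi>0 partial_diff_def)
  then have "((\<lambda>t. h k (\<chi> i. if i = k then t else f $ i)) has_real_derivative partial_diff h f k k) (at (f $ k))"
    using DERIV_shift[of "\<lambda>t. h k (\<chi> i. if i = k then t else f $ i)" "partial_diff h f k k" 0 "f $ k"]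
    by (simp add: \<phi>_def)
  then show ?thesis unfolding h_diag_deriv_def by (rule DERIV_imp_deriv)
qed

text \<open>Put \<open>W = T\<^sup>-\<^sup>1 N\<close>, so that \<open>W = X diag(f) X\<^sup>-\<^sup>1\<close> and \<open>T\<^sup>-\<^sup>1 = X X\<^sup>*\<close> at \<open>t = 0\<close>.  Differentiating \<open>T W = N\<close> gives
  \<open>X\<^sup>-\<^sup>1 W' X = X\<^sup>* N' X - X\<^sup>* T' X diag(f)\<close>, whose diagonal is real and holds the derivatives of the roots.\<close>

lemma pencil_function_derivative:
  fixes N T A :: "real \<Rightarrow> ('q::{finite,linorder}, 'q) cmat" and \<phi> :: "real \<Rightarrow> 'q rvec"
    and h :: "'q \<Rightarrow> 'q rvec \<Rightarrow> real"
  assumes N: "(N has_vector_derivative N') (at 0)" "\<And>t. (N t)\<^sup>\<dagger> = N t"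
    and T: "(T has_vector_derivative T') (at 0)" "\<And>t. (T t)\<^sup>\<dagger> = T t"
    and ev: "\<forall>\<^sub>F t in nhds 0. pos_def_hermitian (T t) \<and> \<phi> t \<in> ordered_cone \<and>
               (A t)\<^sup>\<dagger> ** T t ** A t = mat 1 \<and> (A t)\<^sup>\<dagger> ** N t ** A t = Diag (($) (\<phi> t))"
    and h: "\<And>k. h k differentiable at (\<phi> 0)"
    and X: "X = A 0" and f: "f = \<phi> 0"
  shows "((\<lambda>t. A t ** Diag (\<lambda>k. h k (\<phi> t)) ** matrix_inv (A t)) has_vector_derivative
      X ** spectral_diff (divided_diff h f) (partial_diff h f)
            (X\<^sup>\<dagger> ** N' ** X - X\<^sup>\<dagger> ** T' ** X ** Diag (($) f)) ** matrix_inv X) (at 0)"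
proof -
  define W where "W t = matrix_inv (T t) ** N t" for t
  have inv: "invertible (A t)" "W t = A t ** Diag (($) (\<phi> t)) ** matrix_inv (A t)"
    "matrix_inv (T t) = A t ** (A t)\<^sup>\<dagger>"
    "det (N t - mat (of_real (\<phi> t $ k)) ** T t) = 0"
    if "(A t)\<^sup>\<dagger> ** T t ** A t = mat 1" "(A t)\<^sup>\<dagger> ** N t ** A t = Diag (($) (\<phi> t))" for t k
  proof -
    show A: "invertible (A t)" using that(1) by (rule invertible_of_congruence)
    have "((A t)\<^sup>\<dagger> ** T t) ** A t = mat 1" using that(1) .
    then have "A t ** ((A t)\<^sup>\<dagger> ** T t) = mat 1" using matrix_left_right_inverse by blast
    then have "(A t ** (A t)\<^sup>\<dagger>) ** T t = mat 1" by (simp add: matrix_mul_assoc)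
    then have "T t ** (A t ** (A t)\<^sup>\<dagger>) = mat 1" using matrix_left_right_inverse by blast
    then show Ti: "matrix_inv (T t) = A t ** (A t)\<^sup>\<dagger>" by (rule matrix_inv_unique)
    have "W t = A t ** ((A t)\<^sup>\<dagger> ** N t ** A t) ** matrix_inv (A t)"
      by (simp add: W_def Ti matrix_inv_right A flip: matrix_mul_assoc)
    then show "W t = A t ** Diag (($) (\<phi> t)) ** matrix_inv (A t)" by (simp add: that)
    have "(A t)\<^sup>\<dagger> ** N t ** A t - mat (of_real (\<phi> t $ k)) ** ((A t)\<^sup>\<dagger> ** T t ** A t)
        = Diag (\<lambda>j. \<phi> t $ j - \<phi> t $ k)"
      by (simp add: that vec_eq_iff mat_nth)
    then have "det ((A t)\<^sup>\<dagger> ** N t ** A t - mat (of_real (\<phi> t $ k)) ** ((A t)\<^sup>\<dagger> ** T t ** A t)) = 0"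
      by (simp add: det_Diag) (use finite in blast)
    then show "det (N t - mat (of_real (\<phi> t $ k)) ** T t) = 0"
      by (simp add: det_congruence_eq_0_iff[OF A])
  qed
  have ev0: "pos_def_hermitian (T 0)" "\<phi> 0 \<in> ordered_cone"
    "X\<^sup>\<dagger> ** T 0 ** X = mat 1" "X\<^sup>\<dagger> ** N 0 ** X = Diag (($) (\<phi> 0))"
    using eventually_nhds_x_imp_x[OF ev] by (simp_all add: X)
  define w where "w = X\<^sup>\<dagger> ** N' ** X - X\<^sup>\<dagger> ** T' ** X ** Diag (($) f)"
  have N': "N'\<^sup>\<dagger> = N'" and T': "T'\<^sup>\<dagger> = T'"
  proof -
    show "N'\<^sup>\<dagger> = N'"
      using vector_derivative_unique_at[OF has_vector_derivative_conj_transpose[OF N(1)]] N by simp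
    show "T'\<^sup>\<dagger> = T'"
      using vector_derivative_unique_at[OF has_vector_derivative_conj_transpose[OF T(1)]] T by simp
  qed
  have w_real: "of_real (Re (w $ l $ l)) = w $ l $ l" for l
  proof -
    have "(X\<^sup>\<dagger> ** N' ** X)\<^sup>\<dagger> = X\<^sup>\<dagger> ** N' ** X" "(X\<^sup>\<dagger> ** T' ** X)\<^sup>\<dagger> = X\<^sup>\<dagger> ** T' ** X"
      by (simp_all add: conj_transpose_mult N' T' matrix_mul_assoc)
    then have "cnj ((X\<^sup>\<dagger> ** N' ** X) $ l $ l) = (X\<^sup>\<dagger> ** N' ** X) $ l $ l"
      "cnj ((X\<^sup>\<dagger> ** T' ** X) $ l $ l) = (X\<^sup>\<dagger> ** T' ** X) $ l $ l"
      by (metis conj_transpose_nth)+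
    then have "cnj (w $ l $ l) = w $ l $ l" by (simp add: w_def)
    then show ?thesis by (simp add: complex_eq_iff)
  qed
  have \<phi>': "((\<lambda>t. \<phi> t $ k) has_real_derivative Re (w $ k $ k)) (at 0)" for k
  proof -
    have "\<forall>\<^sub>F t in at 0. pos_def_hermitian (T t) \<and> \<phi> t \<in> ordered_cone \<and>
               (\<forall>k. det (N t - mat (of_real (\<phi> t $ k)) ** T t) = 0)"
      using ev unfolding eventually_nhds_conv_at by (auto elim!: eventually_mono simp: inv(4))
    from pencil_roots_derivative[OF N T ev0(3,4,2) this, of k]
    show ?thesis by (simp add: w_def f mult.commute)
  qed
  have \<eta>': "((\<lambda>t. h k (\<phi> t)) has_real_derivative (\<Sum>l\<in>UNIV. partial_diff h f k l * Re (w $ l $ l))) (at 0)" for k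
    using differentiable_along_curve[where \<phi>=\<phi>, OF h \<phi>'] by (simp add: partial_diff_def f)
  define W' where "W' = matrix_inv (T 0) ** N' - matrix_inv (T 0) ** T' ** matrix_inv (T 0) ** N 0"
  have W': "(W has_vector_derivative W') (at 0)"
    unfolding W_def W'_def
    using has_vector_derivative_matrix_mult[OF has_vector_derivative_matrix_inv[OF T(1)
        pos_def_hermitian_invertible[OF ev0(1)]] N(1)]
    by (simp add: matrix_mult_minus_left)
  have evW: "\<forall>\<^sub>F t in nhds 0. invertible (A t) \<and> inj (\<lambda>k. \<phi> t $ k) \<and>
               W t = A t ** Diag (\<lambda>k. \<phi> t $ k) ** matrix_inv (A t)"
    using ev by eventually_elim (auto simp: inv ordered_coneD(4))
  have w: "matrix_inv (A 0) ** W' ** A 0 = w"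
  proof -
    have Ai: "invertible X" using ev0(3) by (rule invertible_of_congruence)
    have Ti: "matrix_inv (T 0) = X ** X\<^sup>\<dagger>" using inv(3)[of 0] ev0 by (simp add: X)
    have W0: "matrix_inv (T 0) ** N 0 ** X = X ** Diag (($) f)"
      using inv(2)[of 0] ev0 Ai by (simp add: W_def X f matrix_inv_left flip: matrix_mul_assoc)
    have "matrix_inv X ** (matrix_inv (T 0) ** N') ** X = X\<^sup>\<dagger> ** N' ** X"
      by (simp add: Ti matrix_mul_assoc matrix_inv_left Ai)
    moreover have "matrix_inv X ** (matrix_inv (T 0) ** T' ** matrix_inv (T 0) ** N 0) ** X
        = matrix_inv X ** matrix_inv (T 0) ** T' ** (matrix_inv (T 0) ** N 0 ** X)"
      by (simp add: matrix_mul_assoc)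
    moreover have "\<dots> = X\<^sup>\<dagger> ** T' ** X ** Diag (($) f)"
      unfolding W0 by (simp add: Ti matrix_mul_assoc matrix_inv_left Ai)
    ultimately show ?thesis
      by (simp add: W'_def w_def X[symmetric] matrix_mult_diff_left matrix_mult_diff_right)
  qed
  have eq: "(\<chi> i j. if i = j then of_real (\<Sum>l\<in>UNIV. partial_diff h f i l * Re (w $ l $ l))
          else of_real ((h i (\<phi> 0) - h j (\<phi> 0)) / (\<phi> 0 $ i - \<phi> 0 $ j)) * w $ i $ j)
      = spectral_diff (divided_diff h f) (partial_diff h f) w"
    by (simp add: vec_eq_iff spectral_diff_def divided_diff_def f w_real)
  from spectral_function_derivative[of W W' "\<lambda>k t. \<phi> t $ k" "\<lambda>k. Re (w $ k $ k)" "\<lambda>k t. h k (\<phi> t)", OF W' \<phi>' \<eta>' evW]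
  have "((\<lambda>t. A t ** Diag (\<lambda>k. h k (\<phi> t)) ** matrix_inv (A t)) has_vector_derivative
      A 0 ** spectral_diff (divided_diff h f) (partial_diff h f) w ** matrix_inv (A 0)) (at 0)"
    by (simp only: w eq)
  then show ?thesis by (simp only: X w_def)
qed

section \<open>Divergences\<close>

lemma spectral_diff_sandwich_linear:
  assumes "\<And>k l. w $ k $ l = a * w1 $ k $ l + b * w2 $ k $ l"
  shows "(P ** spectral_diff d g w ** T) $ i $ j
       = a * (P ** spectral_diff d g w1 ** T) $ i $ j + b * (P ** spectral_diff d g w2 ** T) $ i $ j"
proof -
  have "spectral_diff d g w $ k $ l = a * spectral_diff d g w1 $ k $ l + b * spectral_diff d g w2 $ k $ l" for k l
    by (simp add: spectral_diff_def assms sum_distrib_left algebra_simps flip: sum.distrib)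
  then show ?thesis
    by (simp add: matrix_mult_nth sum_distrib_left sum_distrib_right algebra_simps flip: sum.distrib)
qed

lemma unit_mat_nth: "unit_mat a b c $ i $ j = (if i = a then if j = b then c else 0 else 0)"
  by (simp add: unit_mat_def axis_def)

lemma mult_unit_mat_mult: "(Q ** unit_mat a b c ** R) $ i $ j = c * Q $ i $ a * R $ b $ j"
  by (simp add: matrix_mult_nth unit_mat_nth if_distrib[of "\<lambda>x. _ * x"] if_distrib[of "\<lambda>x. x * _"]
      cong: if_cong)

text \<open>Summing the \<open>(a,b)\<close> entry of the response to a perturbation in direction \<open>E\<^sub>a\<^sub>b\<close> contracts the
  outer factors with the inner ones.  When both contractions are diagonal, only the diagonal
  partial derivatives survive.\<close>

lemma spectral_divergence:
  fixes P :: "complex^'q^'a" and T :: "complex^'b^'q" and Q :: "complex^'a^'q" and R :: "complex^'q^'b"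
  assumes QP: "Q ** P = Diag \<alpha>" and TR: "T ** R = Diag \<beta>"
  shows "(\<Sum>a\<in>UNIV. \<Sum>b\<in>UNIV. (P ** spectral_diff d g (Q ** unit_mat a b 1 ** R) ** T) $ a $ b)
       = of_real ((\<Sum>i\<in>UNIV. \<Sum>j\<in>UNIV - {i}. d i j * \<alpha> i * \<beta> j) + (\<Sum>i\<in>UNIV. g i i * \<alpha> i * \<beta> i))"
proof -
  define L where "L a b = spectral_diff d g (Q ** unit_mat a b 1 ** R)" for a b
  have QP': "(\<Sum>a\<in>UNIV. Q $ i $ a * P $ a $ j) = (if i = j then of_real (\<alpha> i) else 0)" for i j
    using arg_cong[OF QP, of "\<lambda>M. M $ i $ j"] by (simp add: matrix_mult_nth)
  have TR': "(\<Sum>b\<in>UNIV. T $ i $ b * R $ b $ j) = (if i = j then of_real (\<beta> i) else 0)" for i j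
    using arg_cong[OF TR, of "\<lambda>M. M $ i $ j"] by (simp add: matrix_mult_nth)
  have contract: "(\<Sum>a\<in>UNIV. \<Sum>b\<in>UNIV. P $ a $ i * (Q $ k $ a * R $ b $ l) * T $ j $ b)
      = (if k = i then of_real (\<alpha> i) else 0) * (if j = l then of_real (\<beta> j) else 0)" for i j k l
  proof -
    have "(\<Sum>a\<in>UNIV. \<Sum>b\<in>UNIV. P $ a $ i * (Q $ k $ a * R $ b $ l) * T $ j $ b)
        = (\<Sum>a\<in>UNIV. Q $ k $ a * P $ a $ i) * (\<Sum>b\<in>UNIV. T $ j $ b * R $ b $ l)"
      by (simp add: sum_product mult_ac)
    then show ?thesis by (simp add: QP' TR')
  qed
  have "(\<Sum>a\<in>UNIV. \<Sum>b\<in>UNIV. (P ** L a b ** T) $ a $ b)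
      = (\<Sum>a\<in>UNIV. \<Sum>b\<in>UNIV. \<Sum>j\<in>UNIV. \<Sum>i\<in>UNIV. P $ a $ i * L a b $ i $ j * T $ j $ b)"
    by (simp add: matrix_mult_nth sum_distrib_right)
  also have "\<dots> = (\<Sum>j\<in>UNIV. \<Sum>i\<in>UNIV. \<Sum>a\<in>UNIV. \<Sum>b\<in>UNIV. P $ a $ i * L a b $ i $ j * T $ j $ b)"
  proof -
    have "(\<Sum>a\<in>UNIV. \<Sum>b\<in>UNIV. \<Sum>j\<in>UNIV. \<Sum>i\<in>UNIV. P $ a $ i * L a b $ i $ j * T $ j $ b)
        = (\<Sum>a\<in>UNIV. \<Sum>j\<in>UNIV. \<Sum>b\<in>UNIV. \<Sum>i\<in>UNIV. P $ a $ i * L a b $ i $ j * T $ j $ b)"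
      by (rule sum.cong[OF refl], rule sum.swap)
    also have "\<dots> = (\<Sum>j\<in>UNIV. \<Sum>a\<in>UNIV. \<Sum>b\<in>UNIV. \<Sum>i\<in>UNIV. P $ a $ i * L a b $ i $ j * T $ j $ b)"
      by (rule sum.swap)
    also have "\<dots> = (\<Sum>j\<in>UNIV. \<Sum>a\<in>UNIV. \<Sum>i\<in>UNIV. \<Sum>b\<in>UNIV. P $ a $ i * L a b $ i $ j * T $ j $ b)"
      by (rule sum.cong[OF refl], rule sum.cong[OF refl], rule sum.swap)
    also have "\<dots> = (\<Sum>j\<in>UNIV. \<Sum>i\<in>UNIV. \<Sum>a\<in>UNIV. \<Sum>b\<in>UNIV. P $ a $ i * L a b $ i $ j * T $ j $ b)"
      by (rule sum.cong[OF refl], rule sum.swap)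
    finally show ?thesis .
  qed
  also have "\<dots> = (\<Sum>j\<in>UNIV. \<Sum>i\<in>UNIV. if i = j then of_real (g i i * \<alpha> i * \<beta> i)
      else of_real (d i j * \<alpha> i * \<beta> j))"
  proof (intro sum.cong refl)
    fix i j
    show "(\<Sum>a\<in>UNIV. \<Sum>b\<in>UNIV. P $ a $ i * L a b $ i $ j * T $ j $ b)
        = (if i = j then of_real (g i i * \<alpha> i * \<beta> i) else of_real (d i j * \<alpha> i * \<beta> j))"
    proof (cases "i = j")
      case True
      have "(\<Sum>a\<in>UNIV. \<Sum>b\<in>UNIV. P $ a $ i * L a b $ i $ j * T $ j $ b)
          = (\<Sum>a\<in>UNIV. \<Sum>b\<in>UNIV. \<Sum>l\<in>UNIV. of_real (g i l) * (P $ a $ i * (Q $ l $ a * R $ b $ l) * T $ j $ b))"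
        using True by (simp add: L_def spectral_diff_def mult_unit_mat_mult sum_distrib_left sum_distrib_right mult_ac)
      also have "\<dots> = (\<Sum>a\<in>UNIV. \<Sum>l\<in>UNIV. \<Sum>b\<in>UNIV. of_real (g i l) * (P $ a $ i * (Q $ l $ a * R $ b $ l) * T $ j $ b))"
        by (rule sum.cong[OF refl], rule sum.swap)
      also have "\<dots> = (\<Sum>l\<in>UNIV. \<Sum>a\<in>UNIV. \<Sum>b\<in>UNIV. of_real (g i l) * (P $ a $ i * (Q $ l $ a * R $ b $ l) * T $ j $ b))"
        by (rule sum.swap)
      also have "\<dots> = (\<Sum>l\<in>UNIV. of_real (g i l) * (\<Sum>a\<in>UNIV. \<Sum>b\<in>UNIV. P $ a $ i * (Q $ l $ a * R $ b $ l) * T $ j $ b))"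
        by (simp only: sum_distrib_left)
      also have "\<dots> = of_real (g i i * \<alpha> i * \<beta> i)"
        unfolding contract using True by (simp add: if_distrib[of "\<lambda>x. _ * x"] if_distrib[of "\<lambda>x. x * _"] mult_ac cong: if_cong)
      finally show ?thesis using True by simp
    next
      case False
      have "(\<Sum>a\<in>UNIV. \<Sum>b\<in>UNIV. P $ a $ i * L a b $ i $ j * T $ j $ b)
          = of_real (d i j) * (\<Sum>a\<in>UNIV. \<Sum>b\<in>UNIV. P $ a $ i * (Q $ i $ a * R $ b $ j) * T $ j $ b)"
        using False by (simp add: L_def spectral_diff_def mult_unit_mat_mult sum_distrib_left mult_ac)
      then show ?thesis unfolding contract using False by (simp add: mult_ac)
    qed
  qed
  also have "\<dots> = of_real (\<Sum>i\<in>UNIV. \<Sum>j\<in>UNIV. if i = j then g i i * \<alpha> i * \<beta> i else d i j * \<alpha> i * \<beta> j)"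
    by (subst sum.swap) (simp add: if_distrib[of of_real] cong: if_cong)
  also have "(\<Sum>i\<in>UNIV. \<Sum>j\<in>UNIV. if i = j then g i i * \<alpha> i * \<beta> i else d i j * \<alpha> i * \<beta> j)
      = (\<Sum>i\<in>UNIV. g i i * \<alpha> i * \<beta> i + (\<Sum>j\<in>UNIV - {i}. d i j * \<alpha> i * \<beta> j))"
  proof (intro sum.cong refl)
    fix i
    have "(\<Sum>j\<in>UNIV - {i}. if i = j then g i i * \<alpha> i * \<beta> i else d i j * \<alpha> i * \<beta> j)
        = (\<Sum>j\<in>UNIV - {i}. d i j * \<alpha> i * \<beta> j)"
      by (intro sum.cong) auto
    then show "(\<Sum>j\<in>UNIV. if i = j then g i i * \<alpha> i * \<beta> i else d i j * \<alpha> i * \<beta> j)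
        = g i i * \<alpha> i * \<beta> i + (\<Sum>j\<in>UNIV - {i}. d i j * \<alpha> i * \<beta> j)"
      by (simp add: sum.remove[of UNIV i])
  qed
  finally show ?thesis by (simp add: L_def sum.distrib add.commute)
qed

section \<open>Rearranging sums of divided differences\<close>

lemma sum_off_diagonal_pairs:
  fixes F :: "'q::{finite,linorder} \<Rightarrow> 'q \<Rightarrow> real"
  shows "(\<Sum>i\<in>UNIV. \<Sum>j\<in>UNIV - {i}. F i j) = (\<Sum>k\<in>UNIV. \<Sum>b | k < b. F k b + F b k)"
proof -
  have "(\<Sum>j\<in>UNIV - {i}. F i j) = (\<Sum>j | i < j. F i j) + (\<Sum>j | j < i. F i j)" for i
  proof -
    have split: "UNIV - {i} = {j. i < j} \<union> {j. j < i}" by auto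
    show ?thesis unfolding split by (rule sum.union_disjoint) auto
  qed
  moreover have "(\<Sum>i\<in>UNIV. \<Sum>j | j < i. F i j) = (\<Sum>j\<in>UNIV. \<Sum>i | j < i. F i j)"
    using sum.swap_restrict[of UNIV UNIV F "\<lambda>i j. j < i"] by simp
  ultimately show ?thesis by (simp only: sum.distrib)
qed

lemma sum_pairs_add:
  fixes u :: "'q::{finite,linorder} \<Rightarrow> real"
  shows "(\<Sum>k\<in>UNIV. \<Sum>b | k < b. u k + u b) = (real CARD('q) - 1) * (\<Sum>k\<in>UNIV. u k)"
proof -
  have "(\<Sum>k\<in>UNIV. \<Sum>b | k < b. u k + u b) = (\<Sum>i\<in>UNIV. \<Sum>j\<in>UNIV - {i}. u i)"
    by (simp only: sum_off_diagonal_pairs)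
  also have "\<dots> = (\<Sum>i\<in>UNIV. (real CARD('q) - 1) * u i)"
    by (simp add: card_Diff_singleton of_nat_diff)
  finally show ?thesis by (simp add: sum_distrib_left)
qed

lemma divided_diff_commute: "divided_diff h f i j = divided_diff h f j i"
  using minus_divide_divide[of "h i f - h j f" "f $ i - f $ j"] by (simp add: divided_diff_def)

lemma divided_diff_identities:
  fixes x y a c :: real
  assumes "x \<noteq> y"
  shows "(a - c) / (x - y) * x + (a - c) / (x - y) * y = 2 * ((x * a - y * c) / (x - y)) - (a + c)"
    and "(a - c) / (x - y) * x * y + (a - c) / (x - y) * y * x
       = 2 * ((x\<^sup>2 * a - y\<^sup>2 * c) / (x - y)) - (2 * (x * a) + 2 * (y * c))"
proof -
  define D where "D = (a - c) / (x - y)"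
  have a: "a = c + D * (x - y)" using assms by (simp add: D_def)
  have "x * a - y * c = (c + x * D) * (x - y)" by (simp add: a algebra_simps)
  then have "(x * a - y * c) / (x - y) = c + x * D" using assms by simp
  then show "(a - c) / (x - y) * x + (a - c) / (x - y) * y = 2 * ((x * a - y * c) / (x - y)) - (a + c)"
    unfolding D_def[symmetric] by (simp add: a algebra_simps)
  have "x\<^sup>2 * a - y\<^sup>2 * c = ((x + y) * c + x\<^sup>2 * D) * (x - y)"
    by (simp add: a algebra_simps power2_eq_square)
  then have "(x\<^sup>2 * a - y\<^sup>2 * c) / (x - y) = (x + y) * c + x\<^sup>2 * D" using assms by simp
  then show "(a - c) / (x - y) * x * y + (a - c) / (x - y) * y * x
       = 2 * ((x\<^sup>2 * a - y\<^sup>2 * c) / (x - y)) - (2 * (x * a) + 2 * (y * c))"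
    unfolding D_def[symmetric] by (simp add: a algebra_simps power2_eq_square)
qed

text \<open>The terms \<open>(k,b)\<close> and \<open>(b,k)\<close> together carry the weight \<open>f k + f b\<close>.  Rewriting them with the
  differences \<open>f k h k - f b h b\<close> costs \<open>h k + h b\<close> for every pair, which adds up to \<open>q - 1\<close> copies of the
  sum of the \<open>h k\<close>.\<close>

lemma sum_divided_diff_left:
  assumes f: "f \<in> ordered_cone"
  shows "(\<Sum>i\<in>UNIV. \<Sum>j\<in>UNIV - {i}. divided_diff h f i j * f $ i)
       = (\<Sum>k\<in>UNIV. \<Sum>b | k < b. 2 * ((f $ k * h k f - f $ b * h b f) / (f $ k - f $ b)))
         - (real CARD('q) - 1) * (\<Sum>k\<in>UNIV. h (k :: 'q::{finite,linorder}) f)"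
proof -
  have pair: "divided_diff h f k b * f $ k + divided_diff h f b k * f $ b
      = 2 * ((f $ k * h k f - f $ b * h b f) / (f $ k - f $ b)) - (h k f + h b f)" if "k < b" for k b
  proof -
    have "f $ k \<noteq> f $ b" using ordered_coneD(2)[OF f that] by simp
    then show ?thesis
      unfolding divided_diff_commute[of h f b k] unfolding divided_diff_def by (rule divided_diff_identities(1))
  qed
  have "(\<Sum>i\<in>UNIV. \<Sum>j\<in>UNIV - {i}. divided_diff h f i j * f $ i)
      = (\<Sum>k\<in>UNIV. \<Sum>b | k < b. 2 * ((f $ k * h k f - f $ b * h b f) / (f $ k - f $ b)) - (h k f + h b f))"
    unfolding sum_off_diagonal_pairs by (intro sum.cong refl) (simp add: pair)
  also have "\<dots> = (\<Sum>k\<in>UNIV. \<Sum>b | k < b. 2 * ((f $ k * h k f - f $ b * h b f) / (f $ k - f $ b)))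
      - (\<Sum>k\<in>UNIV. \<Sum>b | k < b. h k f + h b f)"
    by (simp only: sum_subtractf)
  finally show ?thesis by (simp only: sum_pairs_add)
qed

lemma sum_divided_diff_right:
  "(\<Sum>i\<in>UNIV. \<Sum>j\<in>UNIV - {i}. divided_diff h f i j * f $ j)
   = (\<Sum>i\<in>UNIV. \<Sum>j\<in>UNIV - {i}. divided_diff h f (i :: 'q::{finite,linorder}) j * f $ i)"
  unfolding sum_off_diagonal_pairs
proof (intro sum.cong refl)
  fix k b :: 'q
  show "divided_diff h f k b * f $ b + divided_diff h f b k * f $ k
      = divided_diff h f k b * f $ k + divided_diff h f b k * f $ b"
    by (simp add: divided_diff_commute[of h f b k])
qed

text \<open>The same bookkeeping with the weight \<open>2 f k f b\<close> and the differences \<open>(f k)\<^sup>2 h k - (f b)\<^sup>2 h b\<close>.\<close>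

lemma sum_divided_diff_both:
  assumes f: "f \<in> ordered_cone"
  shows "(\<Sum>i\<in>UNIV. \<Sum>j\<in>UNIV - {i}. divided_diff h f i j * f $ i * f $ j)
       = (\<Sum>k\<in>UNIV. \<Sum>b | k < b. 2 * (((f $ k)\<^sup>2 * h k f - (f $ b)\<^sup>2 * h b f) / (f $ k - f $ b)))
         - 2 * (real CARD('q) - 1) * (\<Sum>k\<in>UNIV. f $ k * h (k :: 'q::{finite,linorder}) f)"
proof -
  have pair: "divided_diff h f k b * f $ k * f $ b + divided_diff h f b k * f $ b * f $ k
      = 2 * (((f $ k)\<^sup>2 * h k f - (f $ b)\<^sup>2 * h b f) / (f $ k - f $ b)) - (2 * (f $ k * h k f) + 2 * (f $ b * h b f))"
    if "k < b" for k b
  proof -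
    have "f $ k \<noteq> f $ b" using ordered_coneD(2)[OF f that] by simp
    then show ?thesis
      unfolding divided_diff_commute[of h f b k] unfolding divided_diff_def by (rule divided_diff_identities(2))
  qed
  have "(\<Sum>i\<in>UNIV. \<Sum>j\<in>UNIV - {i}. divided_diff h f i j * f $ i * f $ j)
      = (\<Sum>k\<in>UNIV. \<Sum>b | k < b. 2 * (((f $ k)\<^sup>2 * h k f - (f $ b)\<^sup>2 * h b f) / (f $ k - f $ b))
          - (2 * (f $ k * h k f) + 2 * (f $ b * h b f)))"
    unfolding sum_off_diagonal_pairs by (intro sum.cong refl) (simp add: pair)
  also have "\<dots> = (\<Sum>k\<in>UNIV. \<Sum>b | k < b. 2 * (((f $ k)\<^sup>2 * h k f - (f $ b)\<^sup>2 * h b f) / (f $ k - f $ b)))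
      - (\<Sum>k\<in>UNIV. \<Sum>b | k < b. 2 * (f $ k * h k f) + 2 * (f $ b * h b f))"
    by (simp only: sum_subtractf)
  also have "(\<Sum>k\<in>UNIV. \<Sum>b | k < b. 2 * (f $ k * h k f) + 2 * (f $ b * h b f))
      = (real CARD('q) - 1) * (2 * (\<Sum>k\<in>UNIV. f $ k * h k f))"
    by (simp only: sum_pairs_add sum_distrib_left)
  finally show ?thesis by (simp only: mult.assoc mult.left_commute)
qed

lemma Delta_hat_expand:
  fixes f :: "'q::{finite,linorder} rvec"
  shows "Delta_hat \<nu> a h f =
    2 * (real a - real CARD('q) + 1) * (\<Sum>k\<in>UNIV. h k f) + 2 * (\<Sum>k\<in>UNIV. f $ k * h_diag_deriv h k f)
    + 2 * (\<Sum>k\<in>UNIV. \<Sum>b | k < b. 2 * ((f $ k * h k f - f $ b * h b f) / (f $ k - f $ b)))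
    + (real \<nu> + real CARD('q) - 2) * (\<Sum>k\<in>UNIV. f $ k * (h k f)\<^sup>2)
    - 2 * (\<Sum>k\<in>UNIV. (f $ k)\<^sup>2 * h_diag_deriv h k f * h k f)
    - (\<Sum>k\<in>UNIV. \<Sum>b | k < b. 2 * (((f $ k)\<^sup>2 * (h k f)\<^sup>2 - (f $ b)\<^sup>2 * (h b f)\<^sup>2) / (f $ k - f $ b)))"
  unfolding Delta_hat_def Let_def
  by (simp add: sum.distrib sum_subtractf sum_distrib_left sum_distrib_right mult_ac)

lemma partial_diff_square:
  fixes h :: "'q::finite \<Rightarrow> real^'q \<Rightarrow> real"
  assumes "h k differentiable at f"
  shows "(\<lambda>f. (h k f)\<^sup>2) differentiable at f"
    and "partial_diff (\<lambda>k f. (h k f)\<^sup>2) f k k = 2 * h k f * partial_diff h f k k"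
proof -
  have "(h k has_derivative frechet_derivative (h k) (at f)) (at f)"
    using assms by (simp add: frechet_derivative_works)
  from has_derivative_power[OF this, of 2]
  have D: "((\<lambda>f. (h k f)\<^sup>2) has_derivative (\<lambda>v. 2 * h k f * frechet_derivative (h k) (at f) v)) (at f)"
    by (simp add: mult_ac)
  show "(\<lambda>f. (h k f)\<^sup>2) differentiable at f" using D by (rule differentiableI)
  show "partial_diff (\<lambda>k f. (h k f)\<^sup>2) f k k = 2 * h k f * partial_diff h f k k"
    by (simp add: partial_diff_def frechet_derivative_at[OF D, symmetric])
qed

lemma partial_diff_weighted_square:
  fixes h :: "'q::finite \<Rightarrow> real^'q \<Rightarrow> real"
  assumes "h k differentiable at f"
  shows "(\<lambda>f. f $ k * (h k f)\<^sup>2) differentiable at f"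
    and "partial_diff (\<lambda>k f. f $ k * (h k f)\<^sup>2) f k k = (h k f)\<^sup>2 + 2 * f $ k * h k f * partial_diff h f k k"
proof -
  have sq: "((\<lambda>f. (h k f)\<^sup>2) has_derivative frechet_derivative (\<lambda>f. (h k f)\<^sup>2) (at f)) (at f)"
    using partial_diff_square(1)[of h k f, OF assms] by (simp add: frechet_derivative_works)
  have nth: "((\<lambda>f :: real^'q. f $ k) has_derivative (\<lambda>v. v $ k)) (at f)"
    by (rule bounded_linear_imp_has_derivative[OF bounded_linear_vec_nth])
  have D: "((\<lambda>f. f $ k * (h k f)\<^sup>2) has_derivative
      (\<lambda>v. f $ k * frechet_derivative (\<lambda>f. (h k f)\<^sup>2) (at f) v + v $ k * (h k f)\<^sup>2)) (at f)"
    by (rule has_derivative_mult[OF nth sq])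
  show "(\<lambda>f. f $ k * (h k f)\<^sup>2) differentiable at f" using D by (rule differentiableI)
  have "partial_diff (\<lambda>k f. f $ k * (h k f)\<^sup>2) f k k
      = f $ k * partial_diff (\<lambda>k f. (h k f)\<^sup>2) f k k + (h k f)\<^sup>2"
    by (simp add: partial_diff_def frechet_derivative_at[OF D, symmetric])
  then show "partial_diff (\<lambda>k f. f $ k * (h k f)\<^sup>2) f k k = (h k f)\<^sup>2 + 2 * f $ k * h k f * partial_diff h f k k"
    by (simp add: partial_diff_square(2)[of h k f, OF assms])
qed

section \<open>The nonzero eigenvalues as roots of a pencil\<close>

lemma eigenvalue_iff_det: "eigenvalue A c \<longleftrightarrow> det (A - mat c) = 0"
  by (auto simp: eigenvalue_def det_eq_0_iff_kernel matrix_vector_mult_diff_rdistrib mat_mult_vec)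

lemma eigenvalue_product_commute:
  fixes A :: "complex^'b^'a" and B :: "complex^'a^'b"
  assumes "c \<noteq> 0" and "eigenvalue (A ** B) c"
  shows "eigenvalue (B ** A) c"
proof -
  obtain v where v: "v \<noteq> 0" "A ** B *v v = c *s v" using assms by (auto simp: eigenvalue_def)
  have "B *v v \<noteq> 0"
    using v assms(1) by (auto simp flip: matrix_vector_mul_assoc)
  moreover have "(B ** A) *v (B *v v) = c *s (B *v v)"
    using arg_cong[OF v(2), of "\<lambda>x. B *v x"]
    by (simp add: vector_scalar_commute matrix_vector_mul_assoc matrix_mul_assoc)
  ultimately show ?thesis by (auto simp: eigenvalue_def)
qed

lemma nonzero_spectrum_unique:
  assumes "nonzero_spectrum W f" "nonzero_spectrum W g"
  shows "f = g"
proof (rule ordered_cone_unique)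
  have "complex_of_real ` range (($) f) = complex_of_real ` range (($) g)"
    using assms by (simp add: nonzero_spectrum_def image_image)
  then show "range (($) f) = range (($) g)"
    by (subst (asm) inj_image_eq_iff) (auto simp: inj_def)
qed (use assms in \<open>auto simp: nonzero_spectrum_def\<close>)

lemma zero_notin_range_ordered_cone:
  assumes "f \<in> ordered_cone"
  shows "0 \<notin> range (\<lambda>k. complex_of_real (f $ k))"
proof
  assume "0 \<in> range (\<lambda>k. complex_of_real (f $ k))"
  then obtain k where "complex_of_real (f $ k) = 0" by auto
  then show False using ordered_coneD(1)[OF assms, of k] by simp
qed

lemma F_of_eqI: "nonzero_spectrum (z\<^sup>\<dagger> ** z ** matrix_inv s) f \<Longrightarrow> F_of z s = f"
  unfolding F_of_def using nonzero_spectrum_unique by blast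

lemma distinct_spectrumD:
  fixes z :: "('m::finite, 'p::finite) cmat"
  assumes "distinct_spectrum TYPE('q::{finite,linorder}) z s"
  shows "pos_def_hermitian s" "nonzero_spectrum (z\<^sup>\<dagger> ** z ** matrix_inv s) (F_of z s :: 'q rvec)"
    "(F_of z s :: 'q rvec) \<in> ordered_cone"
proof -
  show "pos_def_hermitian s" and ns: "nonzero_spectrum (z\<^sup>\<dagger> ** z ** matrix_inv s) (F_of z s :: 'q rvec)"
    using assms F_of_eqI[of z s] unfolding distinct_spectrum_def by auto
  show "(F_of z s :: 'q rvec) \<in> ordered_cone" using ns by (simp add: nonzero_spectrum_def)
qed

text \<open>\<open>q\<close> distinct positive roots of a definite pencil are all its roots; so in both regimes a
  decreasing family of positive roots is already the full nonzero spectrum.\<close>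

lemma nonzero_spectrum_tall:
  fixes z :: "('m::finite, 'p::{finite,linorder}) cmat" and f :: "'p rvec"
  assumes s: "pos_def_hermitian s" and f: "f \<in> ordered_cone"
    and root: "\<And>k. det (z\<^sup>\<dagger> ** z - mat (of_real (f $ k)) ** s) = 0"
  shows "nonzero_spectrum (z\<^sup>\<dagger> ** z ** matrix_inv s) f"
proof -
  have inv: "invertible s" using s by (rule pos_def_hermitian_invertible)
  have "z\<^sup>\<dagger> ** z - mat c ** s = (z\<^sup>\<dagger> ** z ** matrix_inv s - mat c) ** s" for c
    by (simp add: matrix_mult_diff_left matrix_inv_left inv flip: matrix_mul_assoc)
  then have "det (z\<^sup>\<dagger> ** z - mat c ** s) = 0 \<longleftrightarrow> eigenvalue (z\<^sup>\<dagger> ** z ** matrix_inv s) c" for c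
    using inv by (simp add: eigenvalue_iff_det det_mul invertible_det_nz)
  then have "{c. eigenvalue (z\<^sup>\<dagger> ** z ** matrix_inv s) c} = range (\<lambda>k. complex_of_real (f $ k))"
    using definite_pencil_roots_range[OF _ s root ordered_coneD(4)[OF f]]
    by (simp add: conj_transpose_mult)
  moreover have "0 \<notin> range (\<lambda>k. complex_of_real (f $ k))"
    by (rule zero_notin_range_ordered_cone[OF f])
  ultimately show ?thesis using f unfolding nonzero_spectrum_def by blast
qed

lemma pos_def_hermitian_mat_1: "pos_def_hermitian (mat 1 :: complex^'n^'n)"
  by (simp add: pos_def_hermitian_iff cinner_self)

text \<open>Here one also uses that \<open>Z\<^sup>* (Z S\<^sup>-\<^sup>1)\<close> and \<open>(Z S\<^sup>-\<^sup>1) Z\<^sup>*\<close> have the same nonzero eigenvalues.\<close>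

lemma nonzero_spectrum_wide:
  fixes z :: "('m::{finite,linorder}, 'p::finite) cmat" and f :: "'m rvec"
  assumes s: "pos_def_hermitian s" and f: "f \<in> ordered_cone"
    and root: "\<And>k. det (z ** matrix_inv s ** z\<^sup>\<dagger> - mat (of_real (f $ k)) ** mat 1) = 0"
  shows "nonzero_spectrum (z\<^sup>\<dagger> ** z ** matrix_inv s) f"
proof -
  have herm: "(z ** matrix_inv s ** z\<^sup>\<dagger>)\<^sup>\<dagger> = z ** matrix_inv s ** z\<^sup>\<dagger>"
    using pos_def_hermitian_matrix_inv[OF s]
    by (simp add: conj_transpose_mult pos_def_hermitian_iff matrix_mul_assoc)
  have roots: "{c. eigenvalue (z ** matrix_inv s ** z\<^sup>\<dagger>) c} = range (\<lambda>k. complex_of_real (f $ k))"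
    using definite_pencil_roots_range[OF herm pos_def_hermitian_mat_1 root ordered_coneD(4)[OF f]]
    by (simp add: eigenvalue_iff_det)
  have zero: "0 \<notin> range (\<lambda>k. complex_of_real (f $ k))"
    by (rule zero_notin_range_ordered_cone[OF f])
  have swap: "eigenvalue (z ** matrix_inv s ** z\<^sup>\<dagger>) c \<longleftrightarrow> eigenvalue (z\<^sup>\<dagger> ** z ** matrix_inv s) c"
    if "c \<noteq> 0" for c
    using eigenvalue_product_commute[OF that, of "z ** matrix_inv s" "z\<^sup>\<dagger>"]
      eigenvalue_product_commute[OF that, of "z\<^sup>\<dagger>" "z ** matrix_inv s"]
    by (auto simp: matrix_mul_assoc)
  have "c \<in> range (\<lambda>k. complex_of_real (f $ k)) \<longleftrightarrow> c \<noteq> 0 \<and> eigenvalue (z\<^sup>\<dagger> ** z ** matrix_inv s) c" for c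
    using zero swap[of c] unfolding roots[symmetric] by (cases "c = 0") auto
  then show ?thesis using f unfolding nonzero_spectrum_def by blast
qed

lemma decomposition_AD:
  fixes A :: "('m::finite, 'p::{finite,linorder}) cmat \<Rightarrow> ('p, 'p) cmat \<Rightarrow> ('p, 'p) cmat"
  assumes A: "decomposition_A A" and d: "distinct_spectrum TYPE('p) z s"
  shows "invertible (A z s)" "(A z s)\<^sup>\<dagger> ** s ** A z s = mat 1"
    "(A z s)\<^sup>\<dagger> ** (z\<^sup>\<dagger> ** z) ** A z s = Diag (($) (F_of z s))"
proof -
  define X where "X = A z s"
  have *: "invertible X" "s = matrix_inv (X\<^sup>\<dagger>) ** matrix_inv X"
    "z\<^sup>\<dagger> ** z = matrix_inv (X\<^sup>\<dagger>) ** Diag (($) (F_of z s)) ** matrix_inv X"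
    using A d unfolding decomposition_A_def X_def by blast+
  have cancel: "X\<^sup>\<dagger> ** (matrix_inv (X\<^sup>\<dagger>) ** B ** matrix_inv X) ** X = B" for B
  proof -
    have "X\<^sup>\<dagger> ** (matrix_inv (X\<^sup>\<dagger>) ** B ** matrix_inv X) ** X
        = (X\<^sup>\<dagger> ** matrix_inv (X\<^sup>\<dagger>)) ** B ** (matrix_inv X ** X)" by (simp add: matrix_mul_assoc)
    then show ?thesis by (simp add: matrix_inv_left matrix_inv_right invertible_conj_transpose *(1))
  qed
  show "invertible (A z s)" using *(1) by (simp add: X_def)
  show "(A z s)\<^sup>\<dagger> ** s ** A z s = mat 1"
    unfolding X_def[symmetric] by (subst *(2)) (use cancel[of "mat 1"] in simp)
  show "(A z s)\<^sup>\<dagger> ** (z\<^sup>\<dagger> ** z) ** A z s = Diag (($) (F_of z s))"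
    unfolding X_def[symmetric] by (subst *(3)) (rule cancel)
qed

lemma decomposition_UD:
  fixes U :: "('m::{finite,linorder}, 'p::finite) cmat \<Rightarrow> ('p, 'p) cmat \<Rightarrow> ('m, 'm) cmat"
  assumes U: "decomposition_U U" and d: "distinct_spectrum TYPE('m) z s"
  shows "matrix_inv (U z s) = (U z s)\<^sup>\<dagger>" "(U z s)\<^sup>\<dagger> ** mat 1 ** U z s = mat 1"
    "(U z s)\<^sup>\<dagger> ** (z ** matrix_inv s ** z\<^sup>\<dagger>) ** U z s = Diag (($) (F_of z s))"
proof -
  define X where "X = U z s"
  have *: "X ** X\<^sup>\<dagger> = mat 1" "X\<^sup>\<dagger> ** X = mat 1"
    "z ** matrix_inv s ** z\<^sup>\<dagger> = X ** Diag (($) (F_of z s)) ** X\<^sup>\<dagger>"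
    using U d unfolding decomposition_U_def X_def unitary_def by blast+
  show "matrix_inv (U z s) = (U z s)\<^sup>\<dagger>" using matrix_inv_unique[OF *(1)] by (simp add: X_def)
  show "(U z s)\<^sup>\<dagger> ** mat 1 ** U z s = mat 1" using *(2) by (simp add: X_def)
  have "X\<^sup>\<dagger> ** (X ** Diag (($) (F_of z s)) ** X\<^sup>\<dagger>) ** X = (X\<^sup>\<dagger> ** X) ** Diag (($) (F_of z s)) ** (X\<^sup>\<dagger> ** X)"
    by (simp add: matrix_mul_assoc)
  then show "(U z s)\<^sup>\<dagger> ** (z ** matrix_inv s ** z\<^sup>\<dagger>) ** U z s = Diag (($) (F_of z s))"
    by (simp add: * flip: X_def)
qed

text \<open>A simple spectrum survives on a short segment through the point, so identities that hold at points
  of simple spectrum may be differentiated there.\<close>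

lemma distinct_spectrum_persists_tall:
  fixes A :: "('m::finite, 'p::{finite,linorder}) cmat \<Rightarrow> ('p, 'p) cmat \<Rightarrow> ('p, 'p) cmat"
    and z :: "real \<Rightarrow> ('m, 'p) cmat"
  assumes A: "decomposition_A A" and d: "distinct_spectrum TYPE('p) (z 0) (s 0)"
    and z: "(z \<longlongrightarrow> z 0) (at 0)" and s: "(s \<longlongrightarrow> s 0) (at 0)" "\<And>t. (s t)\<^sup>\<dagger> = s t"
  shows "\<forall>\<^sub>F t in nhds (0::real). distinct_spectrum TYPE('p) (z t) (s t)"
proof -
  note ds = distinct_spectrumD[OF d]
  have "((\<lambda>t. (z t)\<^sup>\<dagger> ** z t) \<longlongrightarrow> (z 0)\<^sup>\<dagger> ** z 0) (at 0)"
    by (intro tendsto_matrix_mult bounded_linear.tendsto[OF bounded_linear_conj_transpose] z)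
  moreover have "((z t)\<^sup>\<dagger> ** z t)\<^sup>\<dagger> = (z t)\<^sup>\<dagger> ** z t" for t by (simp add: conj_transpose_mult)
  ultimately have "\<forall>\<^sub>F t in at 0. \<exists>g \<in> (ordered_cone :: 'p rvec set). \<forall>k. \<bar>g $ k - F_of (z 0) (s 0) $ k\<bar> < 1 \<and>
      det ((z t)\<^sup>\<dagger> ** z t - mat (of_real (g $ k)) ** s t) = 0"
    by (rule pencil_roots_persist[OF _ _ s decomposition_AD(2,3)[OF A d] ds(3) zero_less_one])
  then
  have "\<forall>\<^sub>F t in at 0. \<exists>g \<in> (ordered_cone :: 'p rvec set). \<forall>k. det ((z t)\<^sup>\<dagger> ** z t - mat (of_real (g $ k)) ** s t) = 0"
    by (rule eventually_mono) blast
  then have "\<forall>\<^sub>F t in at 0. distinct_spectrum TYPE('p) (z t) (s t)"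
    using pos_def_hermitian_persists[OF s ds(1)]
    by eventually_elim (auto simp: distinct_spectrum_def intro!: nonzero_spectrum_tall)
  then show ?thesis using d by (simp add: eventually_nhds_conv_at)
qed

lemma distinct_spectrum_persists_wide:
  fixes U :: "('m::{finite,linorder}, 'p::finite) cmat \<Rightarrow> ('p, 'p) cmat \<Rightarrow> ('m, 'm) cmat"
    and z :: "real \<Rightarrow> ('m, 'p) cmat"
  assumes U: "decomposition_U U" and d: "distinct_spectrum TYPE('m) (z 0) (s 0)"
    and z: "(z \<longlongrightarrow> z 0) (at 0)" and s: "(s \<longlongrightarrow> s 0) (at 0)" "\<And>t. (s t)\<^sup>\<dagger> = s t"
  shows "\<forall>\<^sub>F t in nhds (0::real). distinct_spectrum TYPE('m) (z t) (s t)"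
proof -
  note ds = distinct_spectrumD[OF d]
  \<comment> \<open>Off the invertible matrices \<open>matrix_inv\<close> is unspecified and might not be Hermitian.\<close>
  define N where "N t = (if invertible (s t) then z t ** matrix_inv (s t) ** (z t)\<^sup>\<dagger> else 0)" for t
  have pd: "\<forall>\<^sub>F t in at 0. pos_def_hermitian (s t)" by (rule pos_def_hermitian_persists[OF s ds(1)])
  have N: "\<forall>\<^sub>F t in at 0. z t ** matrix_inv (s t) ** (z t)\<^sup>\<dagger> = N t"
    using pd by eventually_elim (simp add: N_def pos_def_hermitian_invertible)
  have lim: "((\<lambda>t. z t ** matrix_inv (s t) ** (z t)\<^sup>\<dagger>) \<longlongrightarrow> z 0 ** matrix_inv (s 0) ** (z 0)\<^sup>\<dagger>) (at 0)"
    by (intro tendsto_matrix_mult bounded_linear.tendsto[OF bounded_linear_conj_transpose]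
        tendsto_matrix_inv z s pos_def_hermitian_invertible ds)
  have herm: "(N t)\<^sup>\<dagger> = N t" for t
    using hermitian_matrix_inv[OF s(2)[of t]]
    by (simp add: N_def conj_transpose_mult matrix_mul_assoc)
  have "\<forall>\<^sub>F t in at 0. \<exists>g \<in> (ordered_cone :: 'm rvec set). \<forall>k. \<bar>g $ k - F_of (z 0) (s 0) $ k\<bar> < 1 \<and>
      det (N t - mat (of_real (g $ k)) ** mat 1) = 0"
    by (rule pencil_roots_persist[OF Lim_transform_eventually[OF lim N] herm tendsto_const
          conj_transpose_mat_1 decomposition_UD(2,3)[OF U d] ds(3) zero_less_one])
  then
  have "\<forall>\<^sub>F t in at 0. \<exists>g \<in> (ordered_cone :: 'm rvec set). \<forall>k. det (N t - mat (of_real (g $ k)) ** mat 1) = 0"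
    by (rule eventually_mono) blast
  then have "\<forall>\<^sub>F t in at 0. distinct_spectrum TYPE('m) (z t) (s t)"
    using pd N
  proof eventually_elim
    case (elim t)
    then show ?case
      unfolding distinct_spectrum_def by (metis nonzero_spectrum_wide)
  qed
  then show ?thesis using d by (simp add: eventually_nhds_conv_at)
qed

section \<open>The divergences of the shrinkage estimators\<close>

lemma deriv_z_entry:
  assumes "\<And>v. ((\<lambda>t. G (z + t *\<^sub>R v)) has_vector_derivative DG v) (at 0)"
  shows "deriv_z i j (\<lambda>z. G z $ i $ j) z
       = 1/2 * (DG (unit_mat i j 1) $ i $ j - \<i> * DG (unit_mat i j \<i>) $ i $ j)"
proof -
  have "dir_deriv (\<lambda>z. G z $ i $ j) z v = DG v $ i $ j" for v
    unfolding dir_deriv_def by (intro vector_derivative_at has_vector_derivative_nth assms)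
  then show ?thesis by (simp add: deriv_z_def)
qed

text \<open>\<open>\<partial>/\<partial>s\<^sub>j\<^sub>l\<close> is the complex-linear extension of the directional derivative, taken in the
  direction \<open>E\<^sub>l\<^sub>j\<close>, which is not itself Hermitian.\<close>

lemma deriv_s_entry_linear:
  fixes M :: "complex^'p^'p \<Rightarrow> complex^'p^'p"
  assumes M: "\<And>v. v\<^sup>\<dagger> = v \<Longrightarrow> ((\<lambda>t. M (s + t *\<^sub>R v)) has_vector_derivative DM v) (at 0)"
    and lin: "\<And>u v w a b. (\<And>k l. w $ k $ l = a * u $ k $ l + b * v $ k $ l) \<Longrightarrow>
        DM w $ i $ k = a * DM u $ i $ k + b * DM v $ i $ k"
  shows "deriv_s j l (\<lambda>s. M s $ i $ k) s = DM (unit_mat l j 1) $ i $ k"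
proof -
  have D: "dir_deriv (\<lambda>s. M s $ i $ k) s v = DM v $ i $ k" if "v\<^sup>\<dagger> = v" for v
    unfolding dir_deriv_def by (intro vector_derivative_at has_vector_derivative_nth M that)
  have re: "(herm_re_dir j l)\<^sup>\<dagger> = herm_re_dir j l"
    by (auto simp: vec_eq_iff herm_re_dir_def unit_mat_nth)
  have im: "(herm_im_dir j l)\<^sup>\<dagger> = herm_im_dir j l" if "j \<noteq> l"
    using that by (auto simp: vec_eq_iff herm_im_dir_def unit_mat_nth)
  show ?thesis
  proof (cases "j = l")
    case True
    then show ?thesis using D[OF re] by (simp add: deriv_s_def herm_re_dir_def)
  next
    case False
    have "DM (unit_mat l j 1) $ i $ k
        = 1/2 * DM (herm_re_dir j l) $ i $ k + \<i>/2 * DM (herm_im_dir j l) $ i $ k"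
      by (rule lin) (use False in \<open>auto simp: herm_re_dir_def herm_im_dir_def unit_mat_nth\<close>)
    then show ?thesis
      using False by (simp add: deriv_s_def D[OF re] D[OF im] algebra_simps)
  qed
qed

lemma trace_unit_mat_sandwich:
  "(\<Sum>i\<in>UNIV. \<Sum>j\<in>UNIV. (C ** unit_mat i j 1 ** E) $ i $ j) = trace C * trace E"
  by (simp add: mult_unit_mat_mult trace_def sum_product)

text \<open>The operator \<open>\<partial>/\<partial>z\<close> keeps the complex-linear part of a real differential.  Of the Hermitian
  perturbation \<open>Q v R + (Q v R)\<^sup>*\<close> this is \<open>Q v R\<close>; the term \<open>C v E\<close> contributes \<open>tr C tr E\<close>.\<close>

lemma tr_re_nabla_response:
  fixes P :: "complex^'q^'m" and T :: "complex^'p^'q" and Q :: "complex^'m^'q" and R :: "complex^'q^'p"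
  assumes deriv: "\<And>v. ((\<lambda>t. G (z + t *\<^sub>R v)) has_vector_derivative
      P ** spectral_diff d g (Q ** v ** R + (Q ** v ** R)\<^sup>\<dagger>) ** T + C ** v ** E) (at 0)"
    and QP: "Q ** P = Diag \<alpha>" and TR: "T ** R = Diag \<beta>"
  shows "tr_re_nabla G z = (\<Sum>i\<in>UNIV. \<Sum>j\<in>UNIV - {i}. d i j * \<alpha> i * \<beta> j)
      + (\<Sum>i\<in>UNIV. g i i * \<alpha> i * \<beta> i) + Re (trace C * trace E)"
proof -
  define L where "L v = P ** spectral_diff d g v ** T" for v
  have "deriv_z i j (\<lambda>z. G z $ i $ j) z
      = L (Q ** unit_mat i j 1 ** R) $ i $ j + (C ** unit_mat i j 1 ** E) $ i $ j" for i j
  proof -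
    define w where "w c = Q ** unit_mat i j c ** R + (Q ** unit_mat i j c ** R)\<^sup>\<dagger>" for c
    have w: "w c $ k $ l = c * Q $ k $ i * R $ j $ l + cnj (c * Q $ l $ i * R $ j $ k)" for c k l
      by (simp only: w_def vector_add_component conj_transpose_nth mult_unit_mat_mult)
    have "L (Q ** unit_mat i j 1 ** R) $ i $ j = 1/2 * L (w 1) $ i $ j + (- \<i>/2) * L (w \<i>) $ i $ j"
      unfolding L_def
      by (rule spectral_diff_sandwich_linear) (simp add: w mult_unit_mat_mult algebra_simps)
    then show ?thesis
      unfolding deriv_z_entry[of G, OF deriv] w_def L_def
      by (simp add: mult_unit_mat_mult algebra_simps)
  qed
  then have "(\<Sum>i\<in>UNIV. \<Sum>j\<in>UNIV. deriv_z i j (\<lambda>z. G z $ i $ j) z)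
      = (\<Sum>i\<in>UNIV. \<Sum>j\<in>UNIV. L (Q ** unit_mat i j 1 ** R) $ i $ j) + trace C * trace E"
    by (simp add: sum.distrib trace_unit_mat_sandwich)
  then show ?thesis
    unfolding tr_re_nabla_def L_def spectral_divergence[OF QP TR] by simp
qed

lemma trace_D_S_response:
  fixes P :: "complex^'q^'p" and T :: "complex^'p^'q" and Q :: "complex^'p^'q" and R :: "complex^'q^'p"
  assumes deriv: "\<And>v. v\<^sup>\<dagger> = v \<Longrightarrow> ((\<lambda>t. M (s + t *\<^sub>R v)) has_vector_derivative
      P ** spectral_diff d g (Q ** v ** R) ** T + C ** v ** E) (at 0)"
    and QP: "Q ** P = Diag \<alpha>" and TR: "T ** R = Diag \<beta>"
  shows "trace (D_S M s) = of_real ((\<Sum>i\<in>UNIV. \<Sum>j\<in>UNIV - {i}. d i j * \<alpha> i * \<beta> j)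
      + (\<Sum>i\<in>UNIV. g i i * \<alpha> i * \<beta> i)) + trace C * trace E"
proof -
  define DM where "DM v = P ** spectral_diff d g (Q ** v ** R) ** T + C ** v ** E" for v
  have lin: "DM w $ i $ k = a * DM u $ i $ k + b * DM v $ i $ k"
    if w: "\<And>k l. w $ k $ l = a * u $ k $ l + b * v $ k $ l" for u v w a b i k
  proof -
    have mult: "(A ** w ** B) $ k $ l = a * (A ** u ** B) $ k $ l + b * (A ** v ** B) $ k $ l"
      for A :: "complex^'p^'c" and B :: "complex^'d^'p" and k l
      by (simp add: matrix_mult_nth w sum_distrib_left sum_distrib_right algebra_simps flip: sum.distrib)
    have "(P ** spectral_diff d g (Q ** w ** R) ** T) $ i $ k
        = a * (P ** spectral_diff d g (Q ** u ** R) ** T) $ i $ k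
          + b * (P ** spectral_diff d g (Q ** v ** R) ** T) $ i $ k"
      by (rule spectral_diff_sandwich_linear) (rule mult)
    then show ?thesis by (simp add: DM_def mult algebra_simps)
  qed
  have "trace (D_S M s) = (\<Sum>j\<in>UNIV. \<Sum>l\<in>UNIV. DM (unit_mat l j 1) $ l $ j)"
    by (simp add: trace_def D_S_def deriv_s_entry_linear[of M s DM, OF deriv[folded DM_def] lin])
  also have "\<dots> = (\<Sum>l\<in>UNIV. \<Sum>j\<in>UNIV. DM (unit_mat l j 1) $ l $ j)" by (rule sum.swap)
  finally show ?thesis
    by (simp add: DM_def sum.distrib trace_unit_mat_sandwich spectral_divergence[OF QP TR])
qed

lemma trace_sandwich:
  fixes X :: "complex^'q^'q"
  assumes "invertible X"
  shows "trace (X ** B ** matrix_inv X) = trace B"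
proof -
  have "trace ((X ** B) ** matrix_inv X) = trace (matrix_inv X ** (X ** B))" by (rule trace_mul_sym)
  then show ?thesis by (simp add: matrix_mul_assoc matrix_inv_left assms)
qed

lemma has_vector_derivative_line: "((\<lambda>t. z + t *\<^sub>R v) has_vector_derivative v) (at 0)"
  by (auto intro!: derivative_eq_intros simp: has_vector_derivative_def)

text \<open>In a tall model the correction is \<open>Z \<Phi>\<close> with \<open>\<Phi>\<close> the spectral function of \<open>S\<^sup>-\<^sup>1 Z\<^sup>* Z\<close>.\<close>

lemma tr_re_nabla_tall:
  fixes A :: "('m::finite, 'p::{finite,linorder}) cmat \<Rightarrow> ('p, 'p) cmat \<Rightarrow> ('p, 'p) cmat"
  assumes A: "decomposition_A A" and d: "distinct_spectrum TYPE('p) z s"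
    and h: "\<And>k. h k differentiable at f" and f: "f = F_of z s"
  shows "tr_re_nabla (\<lambda>z. estimator_A h A z s - z) z
    = real CARD('m) * (\<Sum>k\<in>UNIV. h k f)
      + (\<Sum>i\<in>UNIV. \<Sum>j\<in>UNIV - {i}. divided_diff h f i j * f $ i)
      + (\<Sum>i\<in>UNIV. partial_diff h f i i * f $ i)"
proof -
  define X where "X = A z s"
  define \<Phi> where "\<Phi> z = A z s ** Diag (\<lambda>k. h k (F_of z s)) ** matrix_inv (A z s)" for z
  note AD = decomposition_AD[OF A d, folded X_def] and ds = distinct_spectrumD[OF d]
  have s: "s\<^sup>\<dagger> = s" using ds(1) by (simp add: pos_def_hermitian_iff)
  have G: "estimator_A h A z s - z = z ** \<Phi> z" for z
    by (simp add: estimator_A_def \<Phi>_def matrix_add_ldistrib matrix_mul_assoc)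
  have tr: "trace (\<Phi> z) = of_real (\<Sum>k\<in>UNIV. h k f)"
    unfolding \<Phi>_def by (simp add: trace_sandwich decomposition_AD[OF A d] trace_Diag f)
  have "tr_re_nabla (\<lambda>z. estimator_A h A z s - z) z
      = (\<Sum>i\<in>UNIV. \<Sum>j\<in>UNIV - {i}. divided_diff h f i j * f $ i * 1)
      + (\<Sum>i\<in>UNIV. partial_diff h f i i * f $ i * 1) + Re (trace (mat 1 :: ('m, 'm) cmat) * trace (\<Phi> z))"
  proof (rule tr_re_nabla_response[where g="partial_diff h f"])
    fix v
    have line: "((\<lambda>t. z + t *\<^sub>R v) has_vector_derivative v) (at 0)" by (rule has_vector_derivative_line)
    have N: "((\<lambda>t. (z + t *\<^sub>R v)\<^sup>\<dagger> ** (z + t *\<^sub>R v)) has_vector_derivative z\<^sup>\<dagger> ** v + v\<^sup>\<dagger> ** z) (at 0)"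
      using has_vector_derivative_matrix_mult[OF has_vector_derivative_conj_transpose[OF line] line] by simp
    have "\<forall>\<^sub>F t in nhds 0. distinct_spectrum TYPE('p) (z + t *\<^sub>R v) s"
      using distinct_spectrum_persists_tall[OF A, where z="\<lambda>t. z + t *\<^sub>R v" and s="\<lambda>_. s"] d s
        has_vector_derivative_imp_tendsto[OF line] by simp
    then have ev: "\<forall>\<^sub>F t in nhds 0. pos_def_hermitian s \<and> F_of (z + t *\<^sub>R v) s \<in> (ordered_cone :: 'p rvec set) \<and>
        (A (z + t *\<^sub>R v) s)\<^sup>\<dagger> ** s ** A (z + t *\<^sub>R v) s = mat 1 \<and>
        (A (z + t *\<^sub>R v) s)\<^sup>\<dagger> ** ((z + t *\<^sub>R v)\<^sup>\<dagger> ** (z + t *\<^sub>R v)) ** A (z + t *\<^sub>R v) s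
          = Diag (($) (F_of (z + t *\<^sub>R v) s))"
      by eventually_elim (simp add: distinct_spectrumD decomposition_AD[OF A])
    have w: "X\<^sup>\<dagger> ** (z\<^sup>\<dagger> ** v + v\<^sup>\<dagger> ** z) ** X = X\<^sup>\<dagger> ** z\<^sup>\<dagger> ** v ** X + (X\<^sup>\<dagger> ** z\<^sup>\<dagger> ** v ** X)\<^sup>\<dagger>"
      by (simp add: conj_transpose_mult matrix_add_ldistrib matrix_mult_add_left matrix_mul_assoc)
    have "((\<lambda>t. \<Phi> (z + t *\<^sub>R v)) has_vector_derivative
        X ** spectral_diff (divided_diff h f) (partial_diff h f) (X\<^sup>\<dagger> ** (z\<^sup>\<dagger> ** v + v\<^sup>\<dagger> ** z) ** X) ** matrix_inv X) (at 0)"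
      using pencil_function_derivative[OF N _ has_vector_derivative_const s ev, of h X f] h
      by (simp add: \<Phi>_def X_def f conj_transpose_mult)
    from has_vector_derivative_matrix_mult[OF line this]
    show "((\<lambda>t. estimator_A h A (z + t *\<^sub>R v) s - (z + t *\<^sub>R v)) has_vector_derivative
        z ** X ** spectral_diff (divided_diff h f) (partial_diff h f)
          (X\<^sup>\<dagger> ** z\<^sup>\<dagger> ** v ** X + (X\<^sup>\<dagger> ** z\<^sup>\<dagger> ** v ** X)\<^sup>\<dagger>) ** matrix_inv X + mat 1 ** v ** \<Phi> z) (at 0)"
      by (simp add: G w matrix_mul_assoc)
    show "X\<^sup>\<dagger> ** z\<^sup>\<dagger> ** (z ** X) = Diag (($) f)" using AD(3) by (simp add: f matrix_mul_assoc)
    show "matrix_inv X ** X = Diag (\<lambda>_. 1)" by (simp add: Diag_1 matrix_inv_left AD)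
  qed
  then show ?thesis by (simp add: tr trace_I)
qed

lemma estimator_A_gram:
  fixes A :: "('m::finite, 'p::{finite,linorder}) cmat \<Rightarrow> ('p, 'p) cmat \<Rightarrow> ('p, 'p) cmat"
  assumes A: "decomposition_A A" and d: "distinct_spectrum TYPE('p) z s"
  shows "(estimator_A h A z s - z)\<^sup>\<dagger> ** (estimator_A h A z s - z)
       = s ** (A z s ** Diag (\<lambda>k. F_of z s $ k * (h k (F_of z s))\<^sup>2) ** matrix_inv (A z s))"
proof -
  define X where "X = A z s"
  define f where "f = (F_of z s :: 'p rvec)"
  define H where "H = Diag (\<lambda>k. h k f)"
  note AD = decomposition_AD[OF A d, folded X_def f_def]
  have G: "estimator_A h A z s - z = z ** X ** H ** matrix_inv X"
    by (simp add: estimator_A_def X_def f_def H_def matrix_add_ldistrib matrix_mul_assoc)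
  have sX: "s ** X = (matrix_inv X)\<^sup>\<dagger>"
  proof -
    have "(matrix_inv X)\<^sup>\<dagger> ** (X\<^sup>\<dagger> ** s ** X) = (X ** matrix_inv X)\<^sup>\<dagger> ** s ** X"
      by (simp add: conj_transpose_mult matrix_mul_assoc)
    then show ?thesis by (simp add: AD matrix_inv_right)
  qed
  have "(estimator_A h A z s - z)\<^sup>\<dagger> ** (estimator_A h A z s - z)
      = (matrix_inv X)\<^sup>\<dagger> ** H ** (X\<^sup>\<dagger> ** (z\<^sup>\<dagger> ** z) ** X) ** H ** matrix_inv X"
    by (simp add: G conj_transpose_mult matrix_mul_assoc H_def)
  also have "\<dots> = s ** X ** (H ** Diag (($) f) ** H) ** matrix_inv X"
    unfolding AD(3) sX by (simp only: matrix_mul_assoc)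
  also have "H ** Diag (($) f) ** H = Diag (\<lambda>k. f $ k * (h k f)\<^sup>2)"
    by (simp add: H_def Diag_mult_Diag power2_eq_square mult_ac)
  finally show ?thesis by (simp add: X_def f_def matrix_mul_assoc)
qed

text \<open>Since \<open>G\<^sup>* G = S \<Psi>\<close> with \<open>\<Psi>\<close> the spectral function of \<open>f h\<^sup>2\<close>, the factor \<open>S\<close> contributes \<open>p tr \<Psi>\<close> and the
  perturbation \<open>- X\<^sup>* dS X diag(f)\<close> of the pencil contributes the remaining terms.\<close>

lemma stein_haff_tall:
  fixes A :: "('m::finite, 'p::{finite,linorder}) cmat \<Rightarrow> ('p, 'p) cmat \<Rightarrow> ('p, 'p) cmat"
  assumes A: "decomposition_A A" and d: "distinct_spectrum TYPE('p) z s"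
    and h: "\<And>k. h k differentiable at f" and f: "f = F_of z s"
  defines "\<psi> \<equiv> \<lambda>k f. f $ k * (h k f)\<^sup>2"
    and "GG \<equiv> \<lambda>s. (estimator_A h A z s - z)\<^sup>\<dagger> ** (estimator_A h A z s - z)"
  shows "trace (GG s ** matrix_inv s) = of_real (\<Sum>k\<in>UNIV. \<psi> k f)"
    and "trace (D_S GG s) = of_real (real CARD('p) * (\<Sum>k\<in>UNIV. \<psi> k f)
      - (\<Sum>i\<in>UNIV. \<Sum>j\<in>UNIV - {i}. divided_diff \<psi> f i j * f $ j)
      - (\<Sum>i\<in>UNIV. partial_diff \<psi> f i i * f $ i))"
proof -
  define X where "X = A z s"
  define \<Psi> where "\<Psi> s = A z s ** Diag (\<lambda>k. \<psi> k (F_of z s)) ** matrix_inv (A z s)" for s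
  note AD = decomposition_AD[OF A d, folded X_def] and ds = distinct_spectrumD[OF d]
  have s: "s\<^sup>\<dagger> = s" and sinv: "invertible s"
    using ds(1) by (simp_all add: pos_def_hermitian_iff pos_def_hermitian_invertible)
  have GG: "GG s = s ** \<Psi> s" if "distinct_spectrum TYPE('p) z s" for s
    unfolding GG_def \<Psi>_def \<psi>_def by (rule estimator_A_gram[OF A that])
  have tr: "trace (\<Psi> s) = of_real (\<Sum>k\<in>UNIV. \<psi> k f)"
    unfolding \<Psi>_def by (simp add: trace_sandwich decomposition_AD[OF A d] trace_Diag f)
  have "trace (GG s ** matrix_inv s) = trace (matrix_inv s ** (s ** \<Psi> s))"
    unfolding GG[OF d] by (rule trace_mul_sym)
  also have "\<dots> = trace (\<Psi> s)" by (simp add: matrix_mul_assoc matrix_inv_left sinv)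
  finally show "trace (GG s ** matrix_inv s) = of_real (\<Sum>k\<in>UNIV. \<psi> k f)" by (simp add: tr)
  have \<psi>: "\<psi> k differentiable at f" for k
    unfolding \<psi>_def by (rule partial_diff_weighted_square(1)) (rule h)
  have "trace (D_S GG s) = of_real
      ((\<Sum>i\<in>UNIV. \<Sum>j\<in>UNIV - {i}. divided_diff \<psi> f i j * - 1 * f $ j)
        + (\<Sum>i\<in>UNIV. partial_diff \<psi> f i i * - 1 * f $ i)) + trace (mat 1 :: ('p, 'p) cmat) * trace (\<Psi> s)"
  proof (rule trace_D_S_response[where g="partial_diff \<psi> f"])
    have "(- X\<^sup>\<dagger>) ** (s ** X) = - (mat 1)" using AD(2) by (simp add: matrix_mult_minus_left matrix_mul_assoc)
    then show "(- X\<^sup>\<dagger>) ** (s ** X) = Diag (\<lambda>_. - 1)" by (simp add: vec_eq_iff mat_nth)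
    show "matrix_inv X ** (X ** Diag (($) f)) = Diag (($) f)"
      by (simp add: matrix_mul_assoc matrix_inv_left AD)
    fix v :: "('p, 'p) cmat" assume v: "v\<^sup>\<dagger> = v"
    have line: "((\<lambda>t. s + t *\<^sub>R v) has_vector_derivative v) (at 0)" by (rule has_vector_derivative_line)
    have herm: "(s + t *\<^sub>R v)\<^sup>\<dagger> = s + t *\<^sub>R v" for t
      by (simp add: conj_transpose_add conj_transpose_scaleR s v)
    have dist: "\<forall>\<^sub>F t in nhds 0. distinct_spectrum TYPE('p) z (s + t *\<^sub>R v)"
      using distinct_spectrum_persists_tall[OF A, where z="\<lambda>_. z" and s="\<lambda>t. s + t *\<^sub>R v"] d herm
        has_vector_derivative_imp_tendsto[OF line] by simp
    then have ev: "\<forall>\<^sub>F t in nhds 0. pos_def_hermitian (s + t *\<^sub>R v) \<and> F_of z (s + t *\<^sub>R v) \<in> (ordered_cone :: 'p rvec set) \<and>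
        (A z (s + t *\<^sub>R v))\<^sup>\<dagger> ** (s + t *\<^sub>R v) ** A z (s + t *\<^sub>R v) = mat 1 \<and>
        (A z (s + t *\<^sub>R v))\<^sup>\<dagger> ** (z\<^sup>\<dagger> ** z) ** A z (s + t *\<^sub>R v) = Diag (($) (F_of z (s + t *\<^sub>R v)))"
      by eventually_elim (simp add: distinct_spectrumD decomposition_AD[OF A])
    have "((\<lambda>t. \<Psi> (s + t *\<^sub>R v)) has_vector_derivative
        X ** spectral_diff (divided_diff \<psi> f) (partial_diff \<psi> f)
          ((- X\<^sup>\<dagger>) ** v ** (X ** Diag (($) f))) ** matrix_inv X) (at 0)"
      using pencil_function_derivative[OF has_vector_derivative_const _ line herm ev, of \<psi> X f] \<psi>
      by (simp add: \<Psi>_def X_def f conj_transpose_mult matrix_mult_minus_left matrix_mul_assoc)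
    from has_vector_derivative_matrix_mult[OF line this]
    have "((\<lambda>t. (s + t *\<^sub>R v) ** \<Psi> (s + t *\<^sub>R v)) has_vector_derivative
        s ** X ** spectral_diff (divided_diff \<psi> f) (partial_diff \<psi> f)
          ((- X\<^sup>\<dagger>) ** v ** (X ** Diag (($) f))) ** matrix_inv X + mat 1 ** v ** \<Psi> s) (at 0)"
      by (simp add: matrix_mul_assoc)
    then show "((\<lambda>t. GG (s + t *\<^sub>R v)) has_vector_derivative
        s ** X ** spectral_diff (divided_diff \<psi> f) (partial_diff \<psi> f)
          ((- X\<^sup>\<dagger>) ** v ** (X ** Diag (($) f))) ** matrix_inv X + mat 1 ** v ** \<Psi> s) (at 0)"
      by (rule has_vector_derivative_transform_eventually)
         (use dist d in \<open>auto simp: GG eventually_nhds_conv_at elim!: eventually_mono\<close>)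
  qed
  then show "trace (D_S GG s) = of_real (real CARD('p) * (\<Sum>k\<in>UNIV. \<psi> k f)
      - (\<Sum>i\<in>UNIV. \<Sum>j\<in>UNIV - {i}. divided_diff \<psi> f i j * f $ j)
      - (\<Sum>i\<in>UNIV. partial_diff \<psi> f i i * f $ i))"
    by (simp add: tr trace_I sum_negf)
qed

text \<open>With the divided differences symmetrized, the two divergences add up to the integrand of the
  risk formula.\<close>

lemma unbiased_risk_tall:
  fixes A :: "('m::finite, 'p::{finite,linorder}) cmat \<Rightarrow> ('p, 'p) cmat \<Rightarrow> ('p, 'p) cmat"
  assumes A: "decomposition_A A" and d: "distinct_spectrum TYPE('p) z s"
    and h: "\<And>k. h k differentiable_on ordered_cone"
  defines "G \<equiv> \<lambda>z s. estimator_A h A z s - z"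
  shows "2 * tr_re_nabla (\<lambda>z. G z s) z
      + Re ((of_nat n - of_nat CARD('p)) * trace ((G z s)\<^sup>\<dagger> ** G z s ** matrix_inv s)
            + trace (D_S (\<lambda>s. (G z s)\<^sup>\<dagger> ** G z s) s))
      = Delta_hat n CARD('m) h (F_of z s)"
proof -
  define f where "f = (F_of z s :: 'p rvec)"
  have f: "f \<in> ordered_cone" using distinct_spectrumD(3)[OF d] by (simp add: f_def)
  have hd: "h k differentiable at f" for k
    using h f open_ordered_cone by (metis differentiable_on_def at_within_open)
  define \<psi> where "\<psi> = (\<lambda>k (f :: 'p rvec). f $ k * (h k f)\<^sup>2)"
  have \<psi>': "partial_diff \<psi> f k k = (h k f)\<^sup>2 + 2 * f $ k * h k f * h_diag_deriv h k f" for k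
    unfolding \<psi>_def partial_diff_weighted_square(2)[of h k f, OF hd]
    by (simp add: h_diag_deriv_eq_partial_diff[of h k f, OF hd])
  have eq: "(\<Sum>k\<in>UNIV. \<Sum>b | k < b. 2 * ((f $ k * \<psi> k f - f $ b * \<psi> b f) / (f $ k - f $ b)))
      = (\<Sum>k\<in>UNIV. \<Sum>b | k < b. 2 * (((f $ k)\<^sup>2 * (h k f)\<^sup>2 - (f $ b)\<^sup>2 * (h b f)\<^sup>2) / (f $ k - f $ b)))"
    by (simp add: \<psi>_def power2_eq_square mult_ac)
  have diag: "(\<Sum>i\<in>UNIV. partial_diff \<psi> f i i * f $ i)
      = (\<Sum>k\<in>UNIV. \<psi> k f) + 2 * (\<Sum>k\<in>UNIV. (f $ k)\<^sup>2 * h_diag_deriv h k f * h k f)"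
    by (simp add: \<psi>' sum_distrib_left flip: sum.distrib) (simp add: \<psi>_def algebra_simps power2_eq_square)
  define S where "S = (\<Sum>k\<in>UNIV. h k f)"
  define P where "P = (\<Sum>k\<in>UNIV. \<psi> k f)"
  define D1 where "D1 = (\<Sum>k\<in>UNIV. f $ k * h_diag_deriv h k f)"
  define D2 where "D2 = (\<Sum>k\<in>UNIV. (f $ k)\<^sup>2 * h_diag_deriv h k f * h k f)"
  define E1 where "E1 = (\<Sum>k\<in>UNIV. \<Sum>b | k < b. 2 * ((f $ k * h k f - f $ b * h b f) / (f $ k - f $ b)))"
  define E2 where "E2 = (\<Sum>k\<in>UNIV. \<Sum>b | k < b. 2 * (((f $ k)\<^sup>2 * (h k f)\<^sup>2 - (f $ b)\<^sup>2 * (h b f)\<^sup>2) / (f $ k - f $ b)))"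
  have D1: "(\<Sum>k\<in>UNIV. partial_diff h f k k * f $ k) = D1"
    by (simp add: D1_def h_diag_deriv_eq_partial_diff[OF hd] mult.commute)
  have nabla: "tr_re_nabla (\<lambda>z. G z s) z = real CARD('m) * S + (E1 - (real CARD('p) - 1) * S) + D1"
    unfolding G_def tr_re_nabla_tall[OF A d hd f_def] sum_divided_diff_left[OF f]
    by (simp only: S_def E1_def D1)
  have haff: "trace ((G z s)\<^sup>\<dagger> ** G z s ** matrix_inv s) = of_real P"
    "trace (D_S (\<lambda>s. (G z s)\<^sup>\<dagger> ** G z s) s)
      = of_real (real CARD('p) * P - (E2 - (real CARD('p) - 1) * P) - (P + 2 * D2))"
    using stein_haff_tall[where h=h and f=f, OF A d hd f_def]
    unfolding G_def sum_divided_diff_right \<psi>_def[symmetric] sum_divided_diff_left[OF f] eq diag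
    by (simp_all only: P_def E2_def D2_def \<psi>_def)
  have "Delta_hat n CARD('m) h f = 2 * (real CARD('m) - real CARD('p) + 1) * S + 2 * D1 + 2 * E1
      + (real n + real CARD('p) - 2) * P - 2 * D2 - E2"
    unfolding Delta_hat_expand S_def D1_def E1_def D2_def E2_def P_def \<psi>_def ..
  then show ?thesis
    unfolding nabla haff f_def[symmetric] by (simp add: algebra_simps)
qed

text \<open>In a wide model the correction is \<open>\<Phi> Z\<close> with \<open>\<Phi>\<close> the spectral function of \<open>Z S\<^sup>-\<^sup>1 Z\<^sup>*\<close>.\<close>

lemma tr_re_nabla_wide:
  fixes U :: "('m::{finite,linorder}, 'p::finite) cmat \<Rightarrow> ('p, 'p) cmat \<Rightarrow> ('m, 'm) cmat"
  assumes U: "decomposition_U U" and d: "distinct_spectrum TYPE('m) z s"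
    and h: "\<And>k. h k differentiable at f" and f: "f = F_of z s"
  shows "tr_re_nabla (\<lambda>z. estimator_U h U z s - z) z
    = real CARD('p) * (\<Sum>k\<in>UNIV. h k f)
      + (\<Sum>i\<in>UNIV. \<Sum>j\<in>UNIV - {i}. divided_diff h f i j * f $ j)
      + (\<Sum>i\<in>UNIV. partial_diff h f i i * f $ i)"
proof -
  define X where "X = U z s"
  define \<Phi> where "\<Phi> z = U z s ** Diag (\<lambda>k. h k (F_of z s)) ** matrix_inv (U z s)" for z
  define R where "R = matrix_inv s ** z\<^sup>\<dagger> ** X"
  note UD = decomposition_UD[OF U d, folded X_def] and ds = distinct_spectrumD[OF d]
  have inv: "invertible X" using UD(2) by (rule invertible_of_congruence)
  have si: "(matrix_inv s)\<^sup>\<dagger> = matrix_inv s"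
    using pos_def_hermitian_matrix_inv[OF ds(1)] by (simp add: pos_def_hermitian_iff)
  have s: "s\<^sup>\<dagger> = s" using ds(1) by (simp add: pos_def_hermitian_iff)
  have G: "estimator_U h U z s - z = \<Phi> z ** z" if "distinct_spectrum TYPE('m) z s" for z
    by (simp add: estimator_U_def \<Phi>_def matrix_mult_add_left decomposition_UD[OF U that])
  have tr: "trace (\<Phi> z) = of_real (\<Sum>k\<in>UNIV. h k f)"
    unfolding \<Phi>_def X_def[symmetric] by (simp add: trace_sandwich inv trace_Diag f)
  have "tr_re_nabla (\<lambda>z. estimator_U h U z s - z) z
      = (\<Sum>i\<in>UNIV. \<Sum>j\<in>UNIV - {i}. divided_diff h f i j * 1 * f $ j)
      + (\<Sum>i\<in>UNIV. partial_diff h f i i * 1 * f $ i) + Re (trace (\<Phi> z) * trace (mat 1 :: ('p, 'p) cmat))"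
  proof (rule tr_re_nabla_response[where g="partial_diff h f"])
    fix v
    have line: "((\<lambda>t. z + t *\<^sub>R v) has_vector_derivative v) (at 0)" by (rule has_vector_derivative_line)
    have "((\<lambda>t. (z + t *\<^sub>R v) ** matrix_inv s) has_vector_derivative v ** matrix_inv s) (at 0)"
      using has_vector_derivative_matrix_mult[OF line has_vector_derivative_const] by simp
    from has_vector_derivative_matrix_mult[OF this has_vector_derivative_conj_transpose[OF line]]
    have N: "((\<lambda>t. (z + t *\<^sub>R v) ** matrix_inv s ** (z + t *\<^sub>R v)\<^sup>\<dagger>) has_vector_derivative
        z ** matrix_inv s ** v\<^sup>\<dagger> + v ** matrix_inv s ** z\<^sup>\<dagger>) (at 0)" by simp
    have herm: "(z ** matrix_inv s ** z\<^sup>\<dagger>)\<^sup>\<dagger> = z ** matrix_inv s ** z\<^sup>\<dagger>" for z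
      by (simp add: conj_transpose_mult si matrix_mul_assoc)
    have dist: "\<forall>\<^sub>F t in nhds 0. distinct_spectrum TYPE('m) (z + t *\<^sub>R v) s"
      using distinct_spectrum_persists_wide[OF U, where z="\<lambda>t. z + t *\<^sub>R v" and s="\<lambda>_. s"] d s
        has_vector_derivative_imp_tendsto[OF line] by simp
    then have ev: "\<forall>\<^sub>F t in nhds 0. pos_def_hermitian (mat 1 :: ('m, 'm) cmat) \<and>
        F_of (z + t *\<^sub>R v) s \<in> (ordered_cone :: 'm rvec set) \<and>
        (U (z + t *\<^sub>R v) s)\<^sup>\<dagger> ** mat 1 ** U (z + t *\<^sub>R v) s = mat 1 \<and>
        (U (z + t *\<^sub>R v) s)\<^sup>\<dagger> ** ((z + t *\<^sub>R v) ** matrix_inv s ** (z + t *\<^sub>R v)\<^sup>\<dagger>) ** U (z + t *\<^sub>R v) s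
          = Diag (($) (F_of (z + t *\<^sub>R v) s))"
    proof eventually_elim
      case (elim t)
      then show ?case
        using distinct_spectrumD(3)[OF elim] decomposition_UD(2,3)[OF U elim] pos_def_hermitian_mat_1 by blast
    qed
    have w: "X\<^sup>\<dagger> ** (z ** matrix_inv s ** v\<^sup>\<dagger> + v ** matrix_inv s ** z\<^sup>\<dagger>) ** X
        = X\<^sup>\<dagger> ** v ** R + (X\<^sup>\<dagger> ** v ** R)\<^sup>\<dagger>"
      by (simp add: R_def conj_transpose_mult si matrix_add_ldistrib matrix_mult_add_left matrix_mul_assoc
          add.commute)
    have "((\<lambda>t. \<Phi> (z + t *\<^sub>R v)) has_vector_derivative
        X ** spectral_diff (divided_diff h f) (partial_diff h f) (X\<^sup>\<dagger> ** v ** R + (X\<^sup>\<dagger> ** v ** R)\<^sup>\<dagger>) ** matrix_inv X) (at 0)"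
      using pencil_function_derivative[OF N herm has_vector_derivative_const conj_transpose_mat_1 ev, of h X f] h
      by (simp add: \<Phi>_def X_def f w[unfolded X_def])
    from has_vector_derivative_matrix_mult[OF this line]
    have "((\<lambda>t. \<Phi> (z + t *\<^sub>R v) ** (z + t *\<^sub>R v)) has_vector_derivative
        X ** spectral_diff (divided_diff h f) (partial_diff h f) (X\<^sup>\<dagger> ** v ** R + (X\<^sup>\<dagger> ** v ** R)\<^sup>\<dagger>)
          ** (matrix_inv X ** z) + \<Phi> z ** v ** mat 1) (at 0)"
      by (simp add: matrix_mul_assoc add.commute)
    then show "((\<lambda>t. estimator_U h U (z + t *\<^sub>R v) s - (z + t *\<^sub>R v)) has_vector_derivative
        X ** spectral_diff (divided_diff h f) (partial_diff h f) (X\<^sup>\<dagger> ** v ** R + (X\<^sup>\<dagger> ** v ** R)\<^sup>\<dagger>)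
          ** (matrix_inv X ** z) + \<Phi> z ** v ** mat 1) (at 0)"
      by (rule has_vector_derivative_transform_eventually)
         (use dist d in \<open>auto simp: G eventually_nhds_conv_at elim!: eventually_mono\<close>)
    show "X\<^sup>\<dagger> ** X = Diag (\<lambda>_. 1)" using UD(2) by (simp add: Diag_1)
    show "matrix_inv X ** z ** R = Diag (($) f)" using UD(3) by (simp add: R_def UD(1) f matrix_mul_assoc)
  qed
  then show ?thesis by (simp add: tr trace_I)
qed

lemma estimator_U_gram:
  fixes U :: "('m::{finite,linorder}, 'p::finite) cmat \<Rightarrow> ('p, 'p) cmat \<Rightarrow> ('m, 'm) cmat"
  assumes U: "decomposition_U U" and d: "distinct_spectrum TYPE('m) z s"
  shows "(estimator_U h U z s - z)\<^sup>\<dagger> ** (estimator_U h U z s - z)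
       = z\<^sup>\<dagger> ** (U z s ** Diag (\<lambda>k. (h k (F_of z s))\<^sup>2) ** matrix_inv (U z s)) ** z"
proof -
  define X where "X = U z s"
  define H where "H = Diag (\<lambda>k. h k (F_of z s))"
  note UD = decomposition_UD[OF U d, folded X_def]
  have G: "estimator_U h U z s - z = X ** H ** X\<^sup>\<dagger> ** z"
    by (simp add: estimator_U_def X_def H_def matrix_mult_add_left)
  have "(estimator_U h U z s - z)\<^sup>\<dagger> ** (estimator_U h U z s - z) = z\<^sup>\<dagger> ** X ** H ** (X\<^sup>\<dagger> ** mat 1 ** X) ** H ** X\<^sup>\<dagger> ** z"
    by (simp add: G conj_transpose_mult matrix_mul_assoc H_def)
  also have "\<dots> = z\<^sup>\<dagger> ** (X ** (H ** H) ** matrix_inv X) ** z"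
    unfolding UD(2) by (simp add: UD(1) matrix_mul_assoc)
  also have "H ** H = Diag (\<lambda>k. (h k (F_of z s))\<^sup>2)"
    by (simp add: H_def Diag_mult_Diag power2_eq_square)
  finally show ?thesis by (simp add: X_def)
qed

text \<open>Since \<open>G\<^sup>* G = Z\<^sup>* \<Theta> Z\<close> with \<open>\<Theta>\<close> the spectral function of \<open>h\<^sup>2\<close>, the matrix \<open>S\<close> enters only through the
  pencil, by \<open>d(S\<^sup>-\<^sup>1) = - S\<^sup>-\<^sup>1 dS S\<^sup>-\<^sup>1\<close>.\<close>

lemma stein_haff_wide:
  fixes U :: "('m::{finite,linorder}, 'p::finite) cmat \<Rightarrow> ('p, 'p) cmat \<Rightarrow> ('m, 'm) cmat"
  assumes U: "decomposition_U U" and d: "distinct_spectrum TYPE('m) z s"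
    and h: "\<And>k. h k differentiable at f" and f: "f = F_of z s"
  defines "\<theta> \<equiv> \<lambda>k f. (h k f)\<^sup>2"
    and "GG \<equiv> \<lambda>s. (estimator_U h U z s - z)\<^sup>\<dagger> ** (estimator_U h U z s - z)"
  shows "trace (GG s ** matrix_inv s) = of_real (\<Sum>k\<in>UNIV. f $ k * \<theta> k f)"
    and "trace (D_S GG s) = of_real (- (\<Sum>i\<in>UNIV. \<Sum>j\<in>UNIV - {i}. divided_diff \<theta> f i j * f $ i * f $ j)
      - (\<Sum>i\<in>UNIV. partial_diff \<theta> f i i * (f $ i)\<^sup>2))"
proof -
  define X where "X = U z s"
  define \<Theta> where "\<Theta> s = U z s ** Diag (\<lambda>k. \<theta> k (F_of z s)) ** matrix_inv (U z s)" for s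
  define R where "R = matrix_inv s ** z\<^sup>\<dagger> ** X"
  define Q where "Q = - (X\<^sup>\<dagger> ** z ** matrix_inv s)"
  note UD = decomposition_UD[OF U d, folded X_def] and ds = distinct_spectrumD[OF d]
  have inv: "invertible X" using UD(2) by (rule invertible_of_congruence)
  have s: "s\<^sup>\<dagger> = s" and sinv: "invertible s"
    using ds(1) by (simp_all add: pos_def_hermitian_iff pos_def_hermitian_invertible)
  have GG: "GG s = z\<^sup>\<dagger> ** \<Theta> s ** z" if "distinct_spectrum TYPE('m) z s" for s
    unfolding GG_def \<Theta>_def \<theta>_def by (rule estimator_U_gram[OF U that])
  have "trace (GG s ** matrix_inv s) = trace (z\<^sup>\<dagger> ** (\<Theta> s ** (z ** matrix_inv s)))"
    unfolding GG[OF d] by (simp only: matrix_mul_assoc)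
  also have "\<dots> = trace (\<Theta> s ** (z ** matrix_inv s) ** z\<^sup>\<dagger>)" by (rule trace_mul_sym)
  also have "\<Theta> s ** (z ** matrix_inv s) ** z\<^sup>\<dagger>
      = X ** (Diag (\<lambda>k. \<theta> k f) ** (X\<^sup>\<dagger> ** (z ** matrix_inv s ** z\<^sup>\<dagger>) ** X)) ** matrix_inv X"
  proof -
    have "X ** (Diag (\<lambda>k. \<theta> k f) ** (X\<^sup>\<dagger> ** (z ** matrix_inv s ** z\<^sup>\<dagger>) ** X)) ** matrix_inv X
        = X ** Diag (\<lambda>k. \<theta> k f) ** matrix_inv X ** (z ** matrix_inv s ** z\<^sup>\<dagger>) ** (X ** matrix_inv X)"
      by (simp only: UD(1) matrix_mul_assoc)
    then show ?thesis
      by (simp add: matrix_inv_right[OF inv] \<Theta>_def f matrix_mul_assoc flip: X_def)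
  qed
  also have "trace \<dots> = of_real (\<Sum>k\<in>UNIV. f $ k * \<theta> k f)"
    unfolding UD(3) by (simp add: trace_sandwich inv Diag_mult_Diag trace_Diag f mult.commute)
  finally show "trace (GG s ** matrix_inv s) = of_real (\<Sum>k\<in>UNIV. f $ k * \<theta> k f)" .
  have \<theta>: "\<theta> k differentiable at f" for k
    unfolding \<theta>_def by (rule partial_diff_square(1)) (rule h)
  have "trace (D_S GG s) = of_real
      ((\<Sum>i\<in>UNIV. \<Sum>j\<in>UNIV - {i}. divided_diff \<theta> f i j * - (f $ i) * f $ j)
        + (\<Sum>i\<in>UNIV. partial_diff \<theta> f i i * - (f $ i) * f $ i))
      + trace (0 :: ('p, 'p) cmat) * trace (0 :: ('p, 'p) cmat)"
  proof (rule trace_D_S_response[where g="partial_diff \<theta> f"])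
    have "Q ** (z\<^sup>\<dagger> ** X) = - Diag (($) f)"
      unfolding Q_def f UD(3)[symmetric] by (simp add: matrix_mult_minus_left matrix_mul_assoc)
    then show "Q ** (z\<^sup>\<dagger> ** X) = Diag (\<lambda>i. - (f $ i))" by (simp add: vec_eq_iff)
    show "matrix_inv X ** z ** R = Diag (($) f)" using UD(3) by (simp add: R_def UD(1) f matrix_mul_assoc)
    fix v :: "('p, 'p) cmat" assume v: "v\<^sup>\<dagger> = v"
    have line: "((\<lambda>t. s + t *\<^sub>R v) has_vector_derivative v) (at 0)" by (rule has_vector_derivative_line)
    have herm: "(s + t *\<^sub>R v)\<^sup>\<dagger> = s + t *\<^sub>R v" for t
      by (simp add: conj_transpose_add conj_transpose_scaleR s v)
    \<comment> \<open>Off the invertible matrices \<open>matrix_inv\<close> is unspecified and might not be Hermitian.\<close>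
    define N where "N t = (if invertible (s + t *\<^sub>R v) then z ** matrix_inv (s + t *\<^sub>R v) ** z\<^sup>\<dagger> else 0)" for t
    have dist: "\<forall>\<^sub>F t in nhds 0. distinct_spectrum TYPE('m) z (s + t *\<^sub>R v)"
      using distinct_spectrum_persists_wide[OF U, where z="\<lambda>_. z" and s="\<lambda>t. s + t *\<^sub>R v"] d herm
        has_vector_derivative_imp_tendsto[OF line] by simp
    have N: "N t = z ** matrix_inv (s + t *\<^sub>R v) ** z\<^sup>\<dagger>" if "distinct_spectrum TYPE('m) z (s + t *\<^sub>R v)" for t
      using distinct_spectrumD(1)[OF that] by (simp add: N_def pos_def_hermitian_invertible)
    have hermN: "(N t)\<^sup>\<dagger> = N t" for t
      using hermitian_matrix_inv[OF herm[of t]] by (simp add: N_def conj_transpose_mult matrix_mul_assoc)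
    have "((\<lambda>t. z ** matrix_inv (s + t *\<^sub>R v) ** z\<^sup>\<dagger>) has_vector_derivative
        z ** (- (matrix_inv s ** v ** matrix_inv s)) ** z\<^sup>\<dagger>) (at 0)"
      using has_vector_derivative_sandwich[OF has_vector_derivative_matrix_inv[OF line]] sinv by simp
    then have N': "(N has_vector_derivative z ** (- (matrix_inv s ** v ** matrix_inv s)) ** z\<^sup>\<dagger>) (at 0)"
      by (rule has_vector_derivative_transform_eventually)
         (use dist d in \<open>auto simp: N eventually_nhds_conv_at elim!: eventually_mono\<close>)
    have ev: "\<forall>\<^sub>F t in nhds 0. pos_def_hermitian (mat 1 :: ('m, 'm) cmat) \<and>
        F_of z (s + t *\<^sub>R v) \<in> (ordered_cone :: 'm rvec set) \<and>
        (U z (s + t *\<^sub>R v))\<^sup>\<dagger> ** mat 1 ** U z (s + t *\<^sub>R v) = mat 1 \<and>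
        (U z (s + t *\<^sub>R v))\<^sup>\<dagger> ** N t ** U z (s + t *\<^sub>R v) = Diag (($) (F_of z (s + t *\<^sub>R v)))"
      using dist
    proof eventually_elim
      case (elim t)
      then show ?case
        using distinct_spectrumD(3)[OF elim] decomposition_UD(2,3)[OF U elim] pos_def_hermitian_mat_1 N[OF elim]
        by simp
    qed
    have Q: "X\<^sup>\<dagger> ** (z ** (- (matrix_inv s ** v ** matrix_inv s)) ** z\<^sup>\<dagger>) ** X = Q ** v ** R"
      by (simp add: Q_def R_def matrix_mult_minus_left matrix_mult_minus_right matrix_mul_assoc)
    have "((\<lambda>t. \<Theta> (s + t *\<^sub>R v)) has_vector_derivative X ** spectral_diff (divided_diff \<theta> f) (partial_diff \<theta> f) (Q ** v ** R) ** matrix_inv X) (at 0)"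
      using pencil_function_derivative[OF N' hermN has_vector_derivative_const conj_transpose_mat_1 ev, of \<theta> X f] \<theta>
      by (simp add: \<Theta>_def f Q flip: X_def)
    from has_vector_derivative_sandwich[OF this, of "z\<^sup>\<dagger>" z]
    have "((\<lambda>t. z\<^sup>\<dagger> ** \<Theta> (s + t *\<^sub>R v) ** z) has_vector_derivative
        z\<^sup>\<dagger> ** X ** spectral_diff (divided_diff \<theta> f) (partial_diff \<theta> f) (Q ** v ** R) ** (matrix_inv X ** z)
          + 0 ** v ** 0) (at 0)"
      by (simp add: matrix_mul_assoc)
    then show "((\<lambda>t. GG (s + t *\<^sub>R v)) has_vector_derivative
        z\<^sup>\<dagger> ** X ** spectral_diff (divided_diff \<theta> f) (partial_diff \<theta> f) (Q ** v ** R) ** (matrix_inv X ** z)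
          + 0 ** v ** 0) (at 0)"
      by (rule has_vector_derivative_transform_eventually)
         (use dist d in \<open>auto simp: GG eventually_nhds_conv_at elim!: eventually_mono\<close>)
  qed
  then show "trace (D_S GG s) = of_real (- (\<Sum>i\<in>UNIV. \<Sum>j\<in>UNIV - {i}. divided_diff \<theta> f i j * f $ i * f $ j)
      - (\<Sum>i\<in>UNIV. partial_diff \<theta> f i i * (f $ i)\<^sup>2))"
    by (simp add: sum_negf power2_eq_square mult.assoc trace_def)
qed

lemma unbiased_risk_wide:
  fixes U :: "('m::{finite,linorder}, 'p::finite) cmat \<Rightarrow> ('p, 'p) cmat \<Rightarrow> ('m, 'm) cmat"
  assumes U: "decomposition_U U" and d: "distinct_spectrum TYPE('m) z s"
    and h: "\<And>k. h k differentiable_on ordered_cone" and n: "n > CARD('p)"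
  defines "G \<equiv> \<lambda>z s. estimator_U h U z s - z"
  shows "2 * tr_re_nabla (\<lambda>z. G z s) z
      + Re ((of_nat n - of_nat CARD('p)) * trace ((G z s)\<^sup>\<dagger> ** G z s ** matrix_inv s)
            + trace (D_S (\<lambda>s. (G z s)\<^sup>\<dagger> ** G z s) s))
      = Delta_hat (n + CARD('m) - CARD('p)) CARD('p) h (F_of z s)"
proof -
  define f where "f = (F_of z s :: 'm rvec)"
  have f: "f \<in> ordered_cone" using distinct_spectrumD(3)[OF d] by (simp add: f_def)
  have hd: "h k differentiable at f" for k
    using h f open_ordered_cone by (metis differentiable_on_def at_within_open)
  define \<theta> where "\<theta> = (\<lambda>k (f :: 'm rvec). (h k f)\<^sup>2)"
  have diag: "(\<Sum>i\<in>UNIV. partial_diff \<theta> f i i * (f $ i)\<^sup>2) = 2 * (\<Sum>k\<in>UNIV. (f $ k)\<^sup>2 * h_diag_deriv h k f * h k f)"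
    unfolding \<theta>_def partial_diff_square(2)[of h _ f, OF hd]
    by (simp add: h_diag_deriv_eq_partial_diff[OF hd] sum_distrib_left mult_ac)
  define S where "S = (\<Sum>k\<in>UNIV. h k f)"
  define P where "P = (\<Sum>k\<in>UNIV. f $ k * (h k f)\<^sup>2)"
  define D1 where "D1 = (\<Sum>k\<in>UNIV. f $ k * h_diag_deriv h k f)"
  define D2 where "D2 = (\<Sum>k\<in>UNIV. (f $ k)\<^sup>2 * h_diag_deriv h k f * h k f)"
  define E1 where "E1 = (\<Sum>k\<in>UNIV. \<Sum>b | k < b. 2 * ((f $ k * h k f - f $ b * h b f) / (f $ k - f $ b)))"
  define E2 where "E2 = (\<Sum>k\<in>UNIV. \<Sum>b | k < b. 2 * (((f $ k)\<^sup>2 * (h k f)\<^sup>2 - (f $ b)\<^sup>2 * (h b f)\<^sup>2) / (f $ k - f $ b)))"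
  have D1: "(\<Sum>k\<in>UNIV. partial_diff h f k k * f $ k) = D1"
    by (simp add: D1_def h_diag_deriv_eq_partial_diff[OF hd] mult.commute)
  have nabla: "tr_re_nabla (\<lambda>z. G z s) z = real CARD('p) * S + (E1 - (real CARD('m) - 1) * S) + D1"
    unfolding G_def tr_re_nabla_wide[OF U d hd f_def] sum_divided_diff_right sum_divided_diff_left[OF f]
    by (simp only: S_def E1_def D1)
  have haff: "trace ((G z s)\<^sup>\<dagger> ** G z s ** matrix_inv s) = of_real P"
    "trace (D_S (\<lambda>s. (G z s)\<^sup>\<dagger> ** G z s) s)
      = of_real (- (E2 - 2 * (real CARD('m) - 1) * P) - 2 * D2)"
    using stein_haff_wide[where h=h and f=f, OF U d hd f_def]
    unfolding G_def \<theta>_def[symmetric] sum_divided_diff_both[OF f] diag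
    by (simp_all only: P_def E2_def D2_def \<theta>_def)
  have "Delta_hat (n + CARD('m) - CARD('p)) CARD('p) h f
      = 2 * (real CARD('p) - real CARD('m) + 1) * S + 2 * D1 + 2 * E1
      + (real (n + CARD('m) - CARD('p)) + real CARD('m) - 2) * P - 2 * D2 - E2"
    unfolding Delta_hat_expand S_def D1_def E1_def D2_def E2_def P_def ..
  also have "real (n + CARD('m) - CARD('p)) = real n + real CARD('m) - real CARD('p)"
    using n by (simp add: of_nat_diff)
  finally show ?thesis
    unfolding nabla haff f_def[symmetric] by (simp add: algebra_simps)
qed

section \<open>Cyclic vectors and simple spectrum\<close>

text \<open>Converts an index into one of the exponents \<open>0, \<dots>, q - 1\<close>.\<close>

definition index_rank :: "'q::{finite,linorder} \<Rightarrow> nat" where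
  "index_rank k = card {b. b < k}"

lemma index_rank_strict_mono: "k < b \<Longrightarrow> index_rank k < index_rank (b :: 'q::{finite,linorder})"
  unfolding index_rank_def by (intro psubset_card_mono) auto

lemma inj_index_rank: "inj (index_rank :: 'q::{finite,linorder} \<Rightarrow> nat)"
  by (metis index_rank_strict_mono injI less_irrefl linorder_neqE)

lemma range_index_rank: "range (index_rank :: 'q::{finite,linorder} \<Rightarrow> nat) = {..<CARD('q)}"
proof (rule card_subset_eq)
  have "index_rank k < CARD('q)" for k :: 'q
    unfolding index_rank_def by (intro psubset_card_mono) auto
  then show "range (index_rank :: 'q \<Rightarrow> nat) \<subseteq> {..<CARD('q)}" by auto
  show "card (range (index_rank :: 'q \<Rightarrow> nat)) = card {..<CARD('q)}"
    by (simp add: card_image inj_index_rank)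
qed simp

lemma sum_index_rank: "(\<Sum>j\<in>(UNIV :: 'q::{finite,linorder} set). g (index_rank j)) = (\<Sum>i<CARD('q). g i)"
  using sum.reindex[OF inj_index_rank[where 'q='q], of g] by (simp add: range_index_rank comp_def)

definition krylov :: "complex^'q^'q \<Rightarrow> complex^'q \<Rightarrow> nat \<Rightarrow> complex^'q" where
  "krylov W e i = (((*v) W) ^^ i) e"

lemma krylov_0 [simp]: "krylov W e 0 = e"
  and krylov_Suc: "krylov W e (Suc i) = W *v krylov W e i"
  by (simp_all add: krylov_def)

definition krylov_matrix :: "('q::{finite,linorder}, 'q) cmat \<Rightarrow> (complex, 'q) vec \<Rightarrow> ('q, 'q) cmat" where
  "krylov_matrix W e = (\<chi> i j. krylov W e (index_rank j) $ i)"

text \<open>This is the vector \<open>p(W) e\<close>.\<close>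

definition poly_act :: "complex^'q^'q \<Rightarrow> complex^'q \<Rightarrow> complex poly \<Rightarrow> complex^'q" where
  "poly_act W e p = (\<Sum>i\<le>degree p. coeff p i *s krylov W e i)"

lemma poly_act_eq: "degree p \<le> n \<Longrightarrow> poly_act W e p = (\<Sum>i\<le>n. coeff p i *s krylov W e i)"
  unfolding poly_act_def
  by (rule sum.mono_neutral_left) (auto simp: coeff_eq_0 not_le vec_eq_iff)

lemma matrix_vector_mult_sum: "W *v (\<Sum>i\<in>I. u i) = (\<Sum>i\<in>I. W *v u i)" for W :: "complex^'b^'a"
  by (induction I rule: infinite_finite_induct) (simp_all add: matrix_vector_right_distrib)

lemma poly_act_diff: "poly_act W e (p - r) = poly_act W e p - poly_act W e r"
proof -
  define n where "n = max (degree p) (degree r)"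
  have "degree (p - r) \<le> n" "degree p \<le> n" "degree r \<le> n" by (auto simp: n_def degree_diff_le_max)
  then show ?thesis
    by (simp add: poly_act_eq vector_sub_rdistrib sum_subtractf)
qed

lemma poly_act_smult: "poly_act W e (smult c p) = c *s poly_act W e p"
proof -
  have "poly_act W e (smult c p) = (\<Sum>i\<le>degree p. c *s (coeff p i *s krylov W e i))"
    by (simp add: poly_act_eq[OF degree_smult_le] vector_smult_assoc)
  also have "\<dots> = c *s poly_act W e p" by (simp add: poly_act_def vec_eq_iff sum_distrib_left mult.assoc)
  finally show ?thesis .
qed

lemma poly_act_pCons_0: "poly_act W e (pCons 0 p) = W *v poly_act W e p"
proof -
  have "degree (pCons 0 p) \<le> Suc (degree p)" by (rule degree_pCons_le)
  then have "poly_act W e (pCons 0 p) = (\<Sum>i\<le>Suc (degree p). coeff (pCons 0 p) i *s krylov W e i)"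
    by (rule poly_act_eq)
  also have "\<dots> = (\<Sum>i\<le>degree p. coeff p i *s (W *v krylov W e i))"
    by (simp add: sum.atMost_Suc_shift krylov_Suc del: sum.atMost_Suc)
  finally show ?thesis by (simp add: poly_act_def matrix_vector_mult_sum vector_scalar_commute)
qed

lemma poly_act_linear_factor:
  "poly_act W e ([:- c, 1:] * p) = W *v poly_act W e p - c *s poly_act W e p"
proof -
  have "[:- c, 1:] * p = pCons 0 p - smult c p" by simp
  then show ?thesis by (simp only: poly_act_diff poly_act_pCons_0 poly_act_smult)
qed

lemma poly_act_krylov_matrix:
  fixes W :: "('q::{finite,linorder}, 'q) cmat"
  assumes "degree p < CARD('q)"
  shows "poly_act W e p = krylov_matrix W e *v (\<chi> j. coeff p (index_rank j))"
proof -
  have "poly_act W e p = (\<Sum>i<CARD('q). coeff p i *s krylov W e i)"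
    using poly_act_eq[of p "CARD('q) - 1" W e] assms by (simp add: lessThan_Suc_atMost[symmetric])
  also have "\<dots> = (\<Sum>j\<in>(UNIV :: 'q set). coeff p (index_rank j) *s krylov W e (index_rank j))"
    by (rule sum_index_rank[symmetric])
  also have "\<dots> = krylov_matrix W e *v (\<chi> j. coeff p (index_rank j))"
    by (simp add: vec_eq_iff krylov_matrix_def matrix_vector_mult_def mult.commute)
  finally show ?thesis .
qed

definition poly_of_vec :: "(complex, 'q::{finite,linorder}) vec \<Rightarrow> complex poly" where
  "poly_of_vec c = (\<Sum>j\<in>UNIV. monom (c $ j) (index_rank j))"

lemma coeff_poly_of_vec: "coeff (poly_of_vec c) (index_rank j) = c $ j"
proof -
  have "coeff (poly_of_vec c) (index_rank j) = (\<Sum>i\<in>UNIV. if i = j then c $ i else 0)"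
    unfolding poly_of_vec_def coeff_sum coeff_monom
    by (intro sum.cong refl) (auto dest: injD[OF inj_index_rank])
  then show ?thesis by simp
qed

lemma degree_poly_of_vec: "degree (poly_of_vec (c :: (complex, 'q::{finite,linorder}) vec)) < CARD('q)"
proof -
  have "degree (poly_of_vec c) \<le> CARD('q) - 1"
    unfolding poly_of_vec_def
  proof (rule degree_sum_le)
    fix j :: 'q
    have "index_rank j < CARD('q)" using range_index_rank by blast
    then show "degree (monom (c $ j) (index_rank j)) \<le> CARD('q) - 1"
      using degree_monom_le[of "c $ j" "index_rank j"] by simp
  qed simp
  then show ?thesis by (simp add: less_Suc_eq_le[symmetric])
qed

text \<open>The coefficient vector of \<open>p\<close> lies in the kernel of the Krylov matrix.\<close>

lemma cyclic_annihilator_trivial: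
  fixes W :: "('q::{finite,linorder}, 'q) cmat"
  assumes cyclic: "det (krylov_matrix W e) \<noteq> 0" and deg: "degree p < CARD('q)" and act: "poly_act W e p = 0"
  shows "p = 0"
proof -
  define c :: "(complex, 'q) vec" where "c = (\<chi> j. coeff p (index_rank j))"
  have "krylov_matrix W e *v c = 0"
    using act by (simp only: poly_act_krylov_matrix[OF deg] c_def)
  then have "c = 0"
    using cyclic det_eq_0_iff_kernel[THEN iffD2, OF exI[of _ c], of "krylov_matrix W e"] by argo
  then have "coeff p (index_rank j) = 0" for j :: 'q by (simp add: c_def vec_eq_iff)
  moreover have "degree p \<in> range (index_rank :: 'q \<Rightarrow> nat)" using deg by (simp add: range_index_rank)
  then obtain j :: 'q where "degree p = index_rank j" by blast
  ultimately have "coeff p (degree p) = 0" by metis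
  then show "p = 0" by simp
qed

text \<open>A matrix that is self-adjoint for the inner product of \<open>T\<close> has no nontrivial Jordan blocks, and
  its eigenvalues are real; with a cyclic vector its minimal polynomial has degree \<open>q\<close>.  By the
  fundamental theorem of algebra there are then \<open>q\<close> distinct eigenvalues.\<close>

lemma cyclic_imp_distinct_roots:
  fixes W N T :: "('q::{finite,linorder}, 'q) cmat"
  assumes N: "N\<^sup>\<dagger> = N" and T: "pos_def_hermitian T" and TW: "T ** W = N"
    and cyclic: "det (krylov_matrix W e) \<noteq> 0"
  shows "card {c. det (N - mat c ** T) = 0} = CARD('q)"
proof (rule antisym)
  show "card {c. det (N - mat c ** T) = 0} \<le> CARD('q)" by (rule definite_pencil_roots[OF N T])
  have Tinv: "invertible T" using T by (rule pos_def_hermitian_invertible)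
  have Therm: "T\<^sup>\<dagger> = T" using T by (simp add: pos_def_hermitian_iff)
  have eigen: "det (N - mat c ** T) = 0" if "u \<noteq> 0" "W *v u = c *s u" for c u
  proof -
    have "(N - mat c ** T) *v u = T *v (W *v u) - c *s (T *v u)"
      by (simp add: TW matrix_vector_mult_diff_rdistrib mat_mult_vec flip: matrix_vector_mul_assoc)
        (simp add: matrix_vector_mul_assoc TW)
    also have "\<dots> = 0" by (simp add: that(2) vector_scalar_commute)
    finally show ?thesis using that(1) unfolding det_eq_0_iff_kernel by blast
  qed
  obtain c where c: "krylov_matrix W e *v c = krylov W e CARD('q)"
  proof -
    have "krylov_matrix W e *v (matrix_inv (krylov_matrix W e) *v krylov W e CARD('q)) = krylov W e CARD('q)"
      using cyclic by (simp add: matrix_vector_mul_assoc matrix_inv_right invertible_det_nz)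
    then show thesis by (rule that)
  qed
  define \<mu> where "\<mu> = monom 1 CARD('q) - poly_of_vec c"
  have coeff_\<mu>: "coeff \<mu> CARD('q) = 1"
    using degree_poly_of_vec[of c] by (simp add: \<mu>_def coeff_eq_0)
  have deg: "degree \<mu> = CARD('q)"
  proof (rule antisym)
    show "degree \<mu> \<le> CARD('q)"
      unfolding \<mu>_def using degree_poly_of_vec[of c] by (intro degree_diff_le degree_monom_le) simp
    show "CARD('q) \<le> degree \<mu>" using coeff_\<mu> by (intro le_degree) simp
  qed
  have "\<mu> \<noteq> 0" using coeff_\<mu> by auto
  have "poly_act W e (monom 1 CARD('q)) = krylov W e CARD('q)"
    by (simp add: poly_act_def degree_monom_eq coeff_monom if_distrib[of "\<lambda>x. x *s _"] cong: if_cong)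
  moreover have "poly_act W e (poly_of_vec c) = krylov W e CARD('q)"
    by (simp add: poly_act_krylov_matrix[OF degree_poly_of_vec] coeff_poly_of_vec c)
  ultimately have act: "poly_act W e \<mu> = 0" by (simp add: \<mu>_def poly_act_diff)
  have root: "poly_act W e \<nu> \<noteq> 0 \<and> W *v poly_act W e \<nu> = a *s poly_act W e \<nu> \<and> det (N - mat a ** T) = 0"
    if \<nu>: "\<mu> = [:- a, 1:] * \<nu>" for a \<nu>
  proof -
    have "\<nu> \<noteq> 0" using \<nu> \<open>\<mu> \<noteq> 0\<close> by auto
    then have "degree \<mu> = Suc (degree \<nu>)" unfolding \<nu> by (subst degree_mult_eq) auto
    then have "degree \<nu> < CARD('q)" using deg by simp
    with \<open>\<nu> \<noteq> 0\<close> have nz: "poly_act W e \<nu> \<noteq> 0" using cyclic_annihilator_trivial[OF cyclic] by metis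
    have "W *v poly_act W e \<nu> - a *s poly_act W e \<nu> = 0"
      using act unfolding \<nu> poly_act_linear_factor .
    then have "W *v poly_act W e \<nu> = a *s poly_act W e \<nu>" by simp
    with nz eigen show ?thesis by blast
  qed
  have "rsquarefree \<mu>"
    unfolding rsquarefree_def
  proof (intro conjI allI)
    fix a
    \<comment> \<open>A double root would give \<open>x\<close> with \<open>y = (W - a) x \<noteq> 0\<close> and \<open>(W - a) y = 0\<close>, hence \<open>y\<^sup>* T y = 0\<close>.\<close>
    have "\<not> order a \<mu> \<ge> 2"
    proof
      assume "order a \<mu> \<ge> 2"
      then have "[:- a, 1:] ^ 2 dvd \<mu>" using order_divides[of a 2 \<mu>] by simp
      then obtain \<kappa> where "\<mu> = [:- a, 1:] ^ 2 * \<kappa>" by (rule dvdE)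
      then have \<kappa>: "\<mu> = [:- a, 1:] * ([:- a, 1:] * \<kappa>)" by (simp only: power2_eq_square mult.assoc)
      define x where "x = poly_act W e \<kappa>"
      define y where "y = poly_act W e ([:- a, 1:] * \<kappa>)"
      have y: "y \<noteq> 0" "W *v y = a *s y" "det (N - mat a ** T) = 0"
        using root[OF \<kappa>] by (auto simp: y_def)
      have a: "cnj a = a" using definite_pencil_root_real[OF N T y(3)] by (simp add: complex_eq_iff)
      have yx: "y = W *v x - a *s x" by (simp only: y_def x_def poly_act_linear_factor)
      have "T *v y = N *v x - a *s (T *v x)"
        by (simp add: yx matrix_vector_mult_diff_distrib matrix_vector_mul_assoc TW vector_scalar_commute)
      then have "cinner y (T *v y) = cinner y (N *v x) - a * cinner y (T *v x)"
        by (simp only: cinner_diff_right cinner_scale_right)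
      also have "\<dots> = cinner (N *v y) x - a * cinner (T *v y) x"
        by (simp add: cinner_matrix_right N Therm)
      also have "N *v y = a *s (T *v y)"
        using arg_cong[OF y(2), of "\<lambda>u. T *v u"] by (simp add: matrix_vector_mul_assoc TW vector_scalar_commute)
      finally have "cinner y (T *v y) = 0" by (simp add: cinner_scale_left a)
      then show False using T y(1) by (simp add: pos_def_hermitian_iff) (metis less_irrefl zero_complex.sel(1))
    qed
    then show "order a \<mu> = 0 \<or> order a \<mu> = 1" by linarith
  qed (rule \<open>\<mu> \<noteq> 0\<close>)
  then have "\<mu> = smult (lead_coeff \<mu>) (\<Prod>a | poly \<mu> a = 0. [:- a, 1:])"
    by (rule complex_poly_decompose_rsquarefree[symmetric])
  also have "degree \<dots> \<le> card {a. poly \<mu> a = 0}"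
    by (intro order_trans[OF degree_smult_le] degree_prod_linear_le poly_roots_finite \<open>\<mu> \<noteq> 0\<close>)
  finally have "CARD('q) \<le> card {a. poly \<mu> a = 0}" by (simp only: deg)
  moreover have "{a. poly \<mu> a = 0} \<subseteq> {c. det (N - mat c ** T) = 0}"
    using root by (auto simp: poly_eq_0_iff_dvd dvd_def)
  ultimately show "CARD('q) \<le> card {c. det (N - mat c ** T) = 0}"
    by (rule order_trans[OF _ card_mono[OF definite_pencil_roots(1)[OF N T]]])
qed

lemma ordered_cone_enumeration:
  assumes "finite R" "card R = CARD('q)" "\<And>x. x \<in> R \<Longrightarrow> x > 0"
  obtains f :: "'q::{finite,linorder} rvec" where "f \<in> ordered_cone" "\<And>k. f $ k \<in> R"
proof -
  define xs where "xs = rev (sorted_list_of_set R)"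
  have len: "length xs = CARD('q)" using assms by (simp add: xs_def)
  have set: "set xs = R" using assms by (simp add: xs_def)
  have "sorted_wrt (>) xs" unfolding xs_def by (simp add: sorted_wrt_rev)
  then have less: "xs ! i > xs ! j" if "i < j" "j < CARD('q)" for i j
    using that len by (simp add: sorted_wrt_iff_nth_less)
  have rank: "index_rank k < CARD('q)" for k :: 'q using range_index_rank by blast
  define f :: "'q rvec" where "f = (\<chi> k. xs ! index_rank k)"
  have mem: "f $ k \<in> R" for k using rank[of k] len set by (auto simp: f_def)
  have "f $ b < f $ k" if "k < b" for k b
    unfolding f_def using less[OF index_rank_strict_mono[OF that] rank] by simp
  then have "f \<in> ordered_cone"
    unfolding ordered_cone_def using mem assms(3) by auto
  with mem show thesis using that by blast
qed

text \<open>Positive semidefiniteness of \<open>N\<close> makes its roots nonnegative, and invertibility makes them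
  positive.\<close>

lemma cyclic_imp_ordered_roots:
  fixes W N T :: "('q::{finite,linorder}, 'q) cmat"
  assumes N: "N\<^sup>\<dagger> = N" "\<And>v. Re (cinner v (N *v v)) \<ge> 0" and T: "pos_def_hermitian T"
    and \<delta>: "\<delta> \<noteq> 0" "Im \<delta> = 0" and TW: "T ** W = mat \<delta> ** N"
    and cyclic: "det (krylov_matrix W e) \<noteq> 0" and inv: "det W \<noteq> 0"
  obtains f :: "'q rvec" where "f \<in> ordered_cone" "\<And>k. det (N - mat (of_real (f $ k)) ** T) = 0"
proof -
  have \<delta>': "cnj \<delta> = \<delta>" using \<delta>(2) by (simp add: complex_eq_iff)
  have herm: "(mat \<delta> ** N)\<^sup>\<dagger> = mat \<delta> ** N"
  proof -
    have "cnj (N $ j $ i) = N $ i $ j" for i j using N(1) by (metis conj_transpose_nth)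
    then show ?thesis by (simp add: vec_eq_iff \<delta>')
  qed
  have roots: "det (mat \<delta> ** N - mat (\<delta> * c) ** T) = 0 \<longleftrightarrow> det (N - mat c ** T) = 0" for c
  proof -
    have "mat \<delta> ** N - mat (\<delta> * c) ** T = mat \<delta> ** (N - mat c ** T)"
      by (simp add: vec_eq_iff algebra_simps)
    moreover have "det (mat \<delta> :: ('q, 'q) cmat) \<noteq> 0"
      using \<delta>(1) by (subst det_diagonal) (auto simp: mat_nth)
    ultimately show ?thesis by (simp add: det_mul)
  qed
  have "{c. det (mat \<delta> ** N - mat c ** T) = 0} = (*) \<delta> ` {c. det (N - mat c ** T) = 0}"
  proof (rule set_eqI)
    fix c
    show "c \<in> {c. det (mat \<delta> ** N - mat c ** T) = 0} \<longleftrightarrow> c \<in> (*) \<delta> ` {c. det (N - mat c ** T) = 0}"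
      using roots[of "c / \<delta>"] \<delta>(1) by (auto simp: roots image_iff intro: exI[of _ "c / \<delta>"])
  qed
  then have card: "card {c. det (N - mat c ** T) = 0} = CARD('q)"
    using cyclic_imp_distinct_roots[OF herm T TW cyclic] \<delta>(1)
    by (simp add: card_image inj_on_def)
  define R where "R = Re ` {c. det (N - mat c ** T) = 0}"
  have real: "Im c = 0" if "det (N - mat c ** T) = 0" for c
    by (rule definite_pencil_root_real[OF N(1) T that])
  have "card R = CARD('q)"
    unfolding R_def card[symmetric]
    by (rule card_image, rule inj_onI) (simp add: complex_eq_iff real)
  moreover have "finite R" unfolding R_def by (intro finite_imageI definite_pencil_roots N T)
  moreover have R: "det (N - mat (of_real x) ** T) = 0" if xR: "x \<in> R" for x
  proof -
    obtain c where c: "det (N - mat c ** T) = 0" "x = Re c" using xR unfolding R_def by blast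
    then have "c = of_real x" using real[OF c(1)] by (simp add: complex_eq_iff)
    then show ?thesis using c(1) by simp
  qed
  have "x > 0" if x: "x \<in> R" for x
  proof -
    obtain v where v: "v \<noteq> 0" "(N - mat (of_real x) ** T) *v v = 0"
      using R[OF x] unfolding det_eq_0_iff_kernel by blast
    then have Nv: "N *v v = of_real x *s (T *v v)"
      by (simp add: matrix_vector_mult_diff_rdistrib mat_mult_vec flip: matrix_vector_mul_assoc)
    have "det T \<noteq> 0" using T by (simp add: pos_def_hermitian_invertible flip: invertible_det_nz)
    then have "det (T ** W) \<noteq> 0" using inv by (simp add: det_mul)
    then have "det N \<noteq> 0" unfolding TW by (simp add: det_mul)
    then have "N *v v \<noteq> 0" using v(1) unfolding det_eq_0_iff_kernel by blast
    then have "x \<noteq> 0" unfolding Nv by auto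
    moreover have "Re (cinner v (N *v v)) = x * Re (cinner v (T *v v))"
      by (simp add: Nv cinner_scale_right)
    moreover have "Re (cinner v (T *v v)) > 0" using T v(1) by (simp add: pos_def_hermitian_iff)
    ultimately show ?thesis using N(2)[of v] by (simp add: zero_le_mult_iff)
  qed
  ultimately obtain f :: "'q rvec" where "f \<in> ordered_cone" "\<And>k. f $ k \<in> R"
    using ordered_cone_enumeration by blast
  with R that show thesis by blast
qed

section \<open>Polynomial functions along lines\<close>

text \<open>The parameter is real and the values are complex, so that conjugation preserves the class.\<close>

definition polynomial_in_t :: "(real \<Rightarrow> complex) \<Rightarrow> bool" where
  "polynomial_in_t f \<longleftrightarrow> (\<exists>p. \<forall>t. f t = poly p (of_real t))"

named_theorems poly_t

lemma polynomial_in_t_const [poly_t]: "polynomial_in_t (\<lambda>t. c)"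
  unfolding polynomial_in_t_def by (rule exI[of _ "[:c:]"]) simp

lemma polynomial_in_t_linear [poly_t]: "polynomial_in_t (\<lambda>t. a + t *\<^sub>R b)"
  unfolding polynomial_in_t_def by (rule exI[of _ "[:a, b:]"]) (simp add: scaleR_conv_of_real)

lemma polynomial_in_t_mult [poly_t]: "polynomial_in_t f \<Longrightarrow> polynomial_in_t g \<Longrightarrow> polynomial_in_t (\<lambda>t. f t * g t)"
proof -
  assume "polynomial_in_t f" "polynomial_in_t g"
  then obtain p q where "\<forall>t. f t = poly p (of_real t)" "\<forall>t. g t = poly q (of_real t)"
    unfolding polynomial_in_t_def by (elim exE)
  then show "polynomial_in_t (\<lambda>t. f t * g t)"
    unfolding polynomial_in_t_def by (intro exI[of _ "p * q"]) simp
qed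

lemma polynomial_in_t_add: "polynomial_in_t f \<Longrightarrow> polynomial_in_t g \<Longrightarrow> polynomial_in_t (\<lambda>t. f t + g t)"
proof -
  assume "polynomial_in_t f" "polynomial_in_t g"
  then obtain p q where "\<forall>t. f t = poly p (of_real t)" "\<forall>t. g t = poly q (of_real t)"
    unfolding polynomial_in_t_def by (elim exE)
  then show "polynomial_in_t (\<lambda>t. f t + g t)"
    unfolding polynomial_in_t_def by (intro exI[of _ "p + q"]) simp
qed

lemma polynomial_in_t_sum [poly_t]: "(\<And>i. i \<in> I \<Longrightarrow> polynomial_in_t (f i)) \<Longrightarrow> polynomial_in_t (\<lambda>t. \<Sum>i\<in>I. f i t)"
  by (induction I rule: infinite_finite_induct) (auto intro: polynomial_in_t_add polynomial_in_t_const)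

lemma polynomial_in_t_prod [poly_t]: "(\<And>i. i \<in> I \<Longrightarrow> polynomial_in_t (f i)) \<Longrightarrow> polynomial_in_t (\<lambda>t. \<Prod>i\<in>I. f i t)"
  by (induction I rule: infinite_finite_induct) (auto intro: polynomial_in_t_mult polynomial_in_t_const)

lemma polynomial_in_t_cnj:
  assumes "polynomial_in_t f"
  shows "polynomial_in_t (\<lambda>t. cnj (f t))"
proof -
  obtain p where p: "\<And>t. f t = poly p (of_real t)" using assms by (auto simp: polynomial_in_t_def)
  have "cnj (f t) = poly (map_poly cnj p) (of_real t)" for t
    unfolding p poly_cnj complex_cnj_complex_of_real by (rule refl)
  then show ?thesis unfolding polynomial_in_t_def by (intro exI allI)
qed

lemma polynomial_in_t_finite_zeros:
  assumes "polynomial_in_t f" "f 0 \<noteq> 0"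
  shows "finite {t. f t = 0}"
proof -
  obtain p where p: "\<And>t. f t = poly p (of_real t)" using assms by (auto simp: polynomial_in_t_def)
  then have "p \<noteq> 0" using assms(2) by auto
  then have "finite (complex_of_real -` {x. poly p x = 0})"
    by (intro finite_vimageI poly_roots_finite) (auto simp: inj_def)
  then show ?thesis by (simp add: p vimage_def)
qed

definition matrix_polynomial_in_t :: "(real \<Rightarrow> complex^'b^'a) \<Rightarrow> bool" where
  "matrix_polynomial_in_t M \<longleftrightarrow> (\<forall>i j. polynomial_in_t (\<lambda>t. M t $ i $ j))"

lemma matrix_polynomial_in_t_mult:
  "matrix_polynomial_in_t M \<Longrightarrow> matrix_polynomial_in_t N \<Longrightarrow> matrix_polynomial_in_t (\<lambda>t. M t ** N t)"
  unfolding matrix_polynomial_in_t_def matrix_mult_nth by (auto intro!: poly_t)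

lemma matrix_polynomial_in_t_conj_transpose:
  "matrix_polynomial_in_t M \<Longrightarrow> matrix_polynomial_in_t (\<lambda>t. (M t)\<^sup>\<dagger>)"
  unfolding matrix_polynomial_in_t_def by (auto intro!: polynomial_in_t_cnj)

lemma polynomial_in_t_det: "matrix_polynomial_in_t M \<Longrightarrow> polynomial_in_t (\<lambda>t. det (M t))"
  unfolding matrix_polynomial_in_t_def det_def by (auto intro!: poly_t)

lemma matrix_polynomial_in_t_adjugate:
  assumes "matrix_polynomial_in_t M"
  shows "matrix_polynomial_in_t (\<lambda>t. adjugate (M t))"
proof -
  have "polynomial_in_t (\<lambda>t. if j = k then axis l 1 $ i else M t $ i $ j)" for i j k l
    using assms by (cases "j = k") (auto simp: matrix_polynomial_in_t_def intro: poly_t)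
  then show ?thesis
    unfolding matrix_polynomial_in_t_def adjugate_def vec_lambda_beta
    by (intro allI polynomial_in_t_det) (simp add: matrix_polynomial_in_t_def)
qed

lemma matrix_polynomial_in_t_krylov:
  assumes "matrix_polynomial_in_t M"
  shows "matrix_polynomial_in_t (\<lambda>t. krylov_matrix (M t) e)"
proof -
  have "polynomial_in_t (\<lambda>t. krylov (M t) e n $ i)" for n i
  proof (induction n arbitrary: i)
    case (Suc n)
    then show ?case
      using assms unfolding krylov_Suc matrix_vector_mult_def matrix_polynomial_in_t_def
      by (auto intro!: poly_t)
  qed (auto intro: poly_t)
  then show ?thesis by (simp add: matrix_polynomial_in_t_def krylov_matrix_def)
qed

section \<open>Null sets met by rays\<close>

text \<open>By Fubini the set \<open>{x. a + t x \<in> B}\<close> is null for almost every \<open>t\<close>; it is a dilate of \<open>B\<close>.\<close>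

lemma AE_lborel_if_countable_on_rays:
  fixes B :: "'a::euclidean_space set"
  assumes B: "B \<in> sets borel" and ray: "\<And>x. countable {t::real. a + t *\<^sub>R x \<in> B}"
  shows "AE x in lborel. x \<notin> B"
proof -
  have "(\<lambda>p :: 'a \<times> real. a + snd p *\<^sub>R fst p) \<in> borel_measurable borel"
    by (rule borel_measurable_continuous_onI) (intro continuous_intros)
  then have meas: "(\<lambda>p :: 'a \<times> real. a + snd p *\<^sub>R fst p) \<in> borel_measurable (lborel \<Otimes>\<^sub>M lborel)"
    by (simp add: lborel_prod)
  have set: "{p \<in> space ((lborel :: 'a measure) \<Otimes>\<^sub>M (lborel :: real measure)). a + snd p *\<^sub>R fst p \<notin> B}
      \<in> sets (lborel \<Otimes>\<^sub>M lborel)"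
    using measurable_sets[OF meas, of "- B"] B by (simp add: vimage_def Int_def conj_commute)
  have "AE x in (lborel :: 'a measure). AE t in lborel. a + t *\<^sub>R x \<notin> B"
  proof (rule AE_I2)
    fix x
    have "emeasure lborel {t. a + t *\<^sub>R x \<in> B} = 0" by (rule emeasure_lborel_countable[OF ray])
    moreover have "{t. a + t *\<^sub>R x \<in> B} \<in> sets lborel"
      using measurable_sets[of "\<lambda>t. a + t *\<^sub>R x" borel borel B] B by (simp add: vimage_def)
    ultimately show "AE t in lborel. a + t *\<^sub>R x \<notin> B"
      by (intro AE_I[of _ _ "{t. a + t *\<^sub>R x \<in> B}"]) auto
  qed
  then have "AE t in lborel. AE x in (lborel :: 'a measure). a + t *\<^sub>R x \<notin> B"
    using lborel_pair.AE_commute[of "\<lambda>x t. a + t *\<^sub>R x \<notin> B"] set by simp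
  moreover have "AE t in lborel. t \<noteq> (0 :: real)" by (rule AE_lborel_singleton)
  ultimately have "AE t in lborel. t \<noteq> (0 :: real) \<and> (AE x in (lborel :: 'a measure). a + t *\<^sub>R x \<notin> B)"
    by eventually_elim simp
  then have "\<exists>t :: real. t \<noteq> 0 \<and> (AE x in (lborel :: 'a measure). a + t *\<^sub>R x \<notin> B)"
    by (rule eventually_happens'[rotated]) (simp add: ae_filter_eq_bot_iff)
  then obtain t :: real where t: "t \<noteq> 0" "AE x in (lborel :: 'a measure). a + t *\<^sub>R x \<notin> B" by blast
  have "AE x in distr lborel borel (\<lambda>x. a + t *\<^sub>R x). x \<notin> B"
    using t(2) B by (subst AE_distr_iff) auto
  then have "AE x in density (distr lborel borel (\<lambda>x. a + t *\<^sub>R x)) (\<lambda>_. ennreal (\<bar>t\<bar> ^ DIM('a))). x \<notin> B"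
    by (subst AE_density) auto
  then show ?thesis by (subst lborel_affine[OF t(1), of a])
qed

section \<open>The spectrum is almost surely simple\<close>

definition ones :: "complex^'q" where
  "ones = (\<chi> i. 1)"

text \<open>\<open>simplicity W \<noteq> 0\<close> means that \<open>W\<close> is invertible and the all-ones vector is cyclic for it.\<close>

definition simplicity :: "('q::{finite,linorder}, 'q) cmat \<Rightarrow> complex" where
  "simplicity W = det (krylov_matrix W ones) * det W"

text \<open>The Krylov matrix is a Vandermonde matrix: a kernel vector is a polynomial of degree less than \<open>q\<close>
  that vanishes at the \<open>q\<close> distinct diagonal entries.\<close>

lemma simplicity_Diag:
  fixes d :: "'q::{finite,linorder} \<Rightarrow> real"
  assumes "inj d" "\<And>k. d k \<noteq> 0"
  shows "simplicity (Diag d) \<noteq> 0"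
proof -
  have power: "krylov (Diag d) ones i $ k = of_real (d k) ^ i" for i k
    by (induction i) (simp_all add: ones_def krylov_Suc matrix_vector_mult_def
        if_distrib[of "\<lambda>x. x * _"] cong: if_cong)
  have "c = 0" if "krylov_matrix (Diag d) ones *v c = 0" for c
  proof -
    have "poly (poly_of_vec c) (of_real (d k)) = 0" for k
    proof -
      have "poly (poly_of_vec c) (of_real (d k)) = (krylov_matrix (Diag d) ones *v c) $ k"
        by (simp add: poly_of_vec_def poly_sum poly_monom krylov_matrix_def matrix_vector_mult_def power mult.commute)
      then show ?thesis by (simp add: that)
    qed
    then have sub: "range (\<lambda>k. complex_of_real (d k)) \<subseteq> {x. poly (poly_of_vec c) x = 0}" by auto
    have card: "card (range (\<lambda>k. complex_of_real (d k))) = CARD('q)"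
      using assms(1) by (intro card_image) (auto simp: inj_def)
    have "poly_of_vec c = 0"
    proof (rule ccontr)
      assume nz: "poly_of_vec c \<noteq> 0"
      have "CARD('q) \<le> card {x. poly (poly_of_vec c) x = 0}"
        unfolding card[symmetric] by (rule card_mono[OF poly_roots_finite[OF nz] sub])
      also have "\<dots> \<le> degree (poly_of_vec c)" by (rule card_poly_roots_bound[OF nz])
      finally show False using degree_poly_of_vec[of c] by simp
    qed
    then have "c $ j = 0" for j using coeff_poly_of_vec[of c j] by simp
    then show ?thesis by (simp add: vec_eq_iff)
  qed
  then have "det (krylov_matrix (Diag d) ones) \<noteq> 0" unfolding det_eq_0_iff_kernel by blast
  then show ?thesis using assms(2) by (simp add: simplicity_def det_Diag)
qed

lemma polynomial_in_t_simplicity: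
  "matrix_polynomial_in_t M \<Longrightarrow> polynomial_in_t (\<lambda>t. simplicity (M t))"
  unfolding simplicity_def by (intro poly_t polynomial_in_t_det matrix_polynomial_in_t_krylov)

lemma continuous_on_vec_nth: "continuous_on S M \<Longrightarrow> continuous_on S (\<lambda>x. M x $ i)"
  by (intro continuous_intros)

lemma continuous_on_det: 
  fixes M :: "'b::topological_space \<Rightarrow> complex^'n^'n"
  assumes "\<And>i j. continuous_on S (\<lambda>x. M x $ i $ j)"
  shows "continuous_on S (\<lambda>x. det (M x))"
  unfolding det_def by (intro continuous_intros assms)

lemma continuous_on_matrix_mult:
  fixes M :: "'d::topological_space \<Rightarrow> complex^'b^'a" and N :: "'d \<Rightarrow> complex^'c^'b"
  shows "continuous_on S M \<Longrightarrow> continuous_on S N \<Longrightarrow> continuous_on S (\<lambda>x. M x ** N x)"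
  by (rule bounded_bilinear.continuous_on[OF bounded_bilinear_matrix_mult])

lemma continuous_on_adjugate:
  assumes "continuous_on S M"
  shows "continuous_on S (\<lambda>x. adjugate (M x))"
  unfolding adjugate_def
proof (intro continuous_on_vec_lambda continuous_on_det)
  fix i j k l
  show "continuous_on S (\<lambda>x. (\<chi> i j. if j = k then axis l 1 $ i else M x $ i $ j) $ i $ j)"
    by (cases "j = k") (auto intro!: continuous_intros assms)
qed

lemma continuous_on_simplicity:
  assumes "continuous_on S M"
  shows "continuous_on S (\<lambda>x. simplicity (M x))"
proof -
  have M: "continuous_on S (\<lambda>x. M x $ i $ j)" for i j
    by (intro continuous_on_vec_nth assms)
  have "continuous_on S (\<lambda>x. krylov (M x) ones n $ i)" for n i
  proof (induction n arbitrary: i)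
    case (Suc n)
    then show ?case
      unfolding krylov_Suc matrix_vector_mult_def vec_lambda_beta
      by (intro continuous_on_sum continuous_on_mult M)
  qed simp
  then have "continuous_on S (\<lambda>x. krylov_matrix (M x) ones $ i $ j)" for i j
    by (simp add: krylov_matrix_def)
  then show ?thesis
    unfolding simplicity_def by (intro continuous_on_mult continuous_on_det M)
qed

lemma matrix_polynomial_in_t_line: "matrix_polynomial_in_t (\<lambda>t. M + t *\<^sub>R N)"
proof -
  have "polynomial_in_t (\<lambda>t. (M + t *\<^sub>R N) $ i $ j)" for i j
    using polynomial_in_t_linear[of "M $ i $ j" "N $ i $ j"] by simp
  then show ?thesis by (simp add: matrix_polynomial_in_t_def)
qed

lemma linear_herm_of_coords: "linear herm_of_coords"
  by (rule linearI) (simp_all add: herm_of_coords_def vec_eq_iff complex_eq_iff)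

lemma herm_of_coords_mat_1: "herm_of_coords (mat 1) = mat 1"
  by (auto simp: herm_of_coords_def vec_eq_iff complex_eq_iff mat_def)

lemma adjugate_mat_1: "adjugate (mat 1 :: complex^'n^'n) = mat 1"
proof -
  have "invertible (mat 1 :: complex^'n^'n)" by (rule invertibleI[of _ "mat 1"]) simp
  then show ?thesis by (simp add: adjugate_eq)
qed

text \<open>On every line through \<open>(z0, I)\<close> the function \<open>simplicity\<close> is a polynomial in the line parameter that
  does not vanish at \<open>0\<close>, so it has finitely many zeros; and Hermitian matrices are linear in their
  real coordinates.\<close>

lemma AE_simplicity:
  fixes W :: "('m::finite, 'p::{finite,linorder}) cmat \<Rightarrow> ('p, 'p) cmat \<Rightarrow> ('q::{finite,linorder}, 'q) cmat"
  assumes cont: "continuous_on UNIV (\<lambda>p. W (fst p) (snd p))"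
    and poly: "\<And>z0 z s0 s. matrix_polynomial_in_t (\<lambda>t. W (z0 + t *\<^sub>R z) (s0 + t *\<^sub>R s))"
    and base: "simplicity (W z0 (mat 1)) \<noteq> 0"
  shows "AE s in herm_lborel. AE z in lborel. simplicity (W z s) \<noteq> 0"
proof -
  let ?P = "\<lambda>p. simplicity (W (fst p) (snd p))"
  have contP: "continuous_on UNIV ?P" by (rule continuous_on_simplicity[OF cont])
  have "continuous_on UNIV (herm_of_coords :: ('p rvec, 'p) vec \<Rightarrow> _)"
    by (intro linear_continuous_on linear_conv_bounded_linear[THEN iffD1] linear_herm_of_coords)
  then have conth: "continuous_on S (\<lambda>x. herm_of_coords (g x))" if "continuous_on S g"
    for S and g :: "'b::topological_space \<Rightarrow> ('p rvec, 'p) vec"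
    using continuous_on_compose2 that by blast
  define B :: "((('p rvec, 'p) vec) \<times> ('m, 'p) cmat) set" where
    "B = {p. simplicity (W (snd p) (herm_of_coords (fst p))) = 0}"
  have "continuous_on UNIV (\<lambda>p :: (('p rvec, 'p) vec) \<times> ('m, 'p) cmat. ?P (snd p, herm_of_coords (fst p)))"
    by (rule continuous_on_compose2[OF contP]) (auto intro!: continuous_intros conth)
  then have "closed B" unfolding B_def by (intro closed_Collect_eq) (auto intro: continuous_intros)
  then have B: "B \<in> sets borel" by (rule borel_closed)
  have "AE p in lborel. p \<notin> B"
  proof (rule AE_lborel_if_countable_on_rays[OF B])
    fix p
    have "polynomial_in_t (\<lambda>t. simplicity (W (z0 + t *\<^sub>R snd p) (mat 1 + t *\<^sub>R herm_of_coords (fst p))))"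
      by (rule polynomial_in_t_simplicity[OF poly])
    then have "finite {t. simplicity (W (z0 + t *\<^sub>R snd p) (mat 1 + t *\<^sub>R herm_of_coords (fst p))) = 0}"
      by (rule polynomial_in_t_finite_zeros) (simp add: base)
    then show "countable {t. (mat 1, z0) + t *\<^sub>R p \<in> B}"
      by (simp add: B_def linear_add[OF linear_herm_of_coords] linear_scale[OF linear_herm_of_coords]
          herm_of_coords_mat_1 countable_finite)
  qed
  then have "AE p in lborel \<Otimes>\<^sub>M lborel. p \<notin> B" by (subst lborel_prod)
  from lborel_pair.AE_pair[OF this]
  have AE: "AE x in lborel. AE z in lborel. simplicity (W z (herm_of_coords x)) \<noteq> 0"
    by (simp add: B_def)
  define C where "C = {p. simplicity (W (snd p) (fst p)) = 0}"
  have "continuous_on UNIV (\<lambda>p :: ('p, 'p) cmat \<times> ('m, 'p) cmat. ?P (snd p, fst p))"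
    by (rule continuous_on_compose2[OF contP]) (auto intro!: continuous_intros)
  then have "closed C" unfolding C_def by (intro closed_Collect_eq) (auto intro: continuous_intros)
  then have C: "C \<in> sets (borel \<Otimes>\<^sub>M borel)" unfolding borel_prod by (rule borel_closed)
  then have C': "C \<in> sets (borel \<Otimes>\<^sub>M lborel)"
    by (metis sets_lborel sets_pair_measure_cong)
  have null: "(AE z in lborel. simplicity (W z s) \<noteq> 0) \<longleftrightarrow> emeasure lborel (Pair s -` C) = 0" for s
  proof -
    have "Pair s -` C \<in> sets lborel" using sets_Pair1[OF C'] by simp
    from AE_iff_measurable[OF this] show ?thesis by (simp add: C_def vimage_def)
  qed
  have meas: "(\<lambda>s. emeasure lborel (Pair s -` C)) \<in> borel_measurable borel"
    by (rule lborel.measurable_emeasure_Pair[OF C'])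
  have "{s. emeasure lborel (Pair s -` C) = 0} \<in> sets borel"
    using measurable_sets[OF meas, of "{0}"] by (simp add: vimage_def)
  then show ?thesis
    unfolding herm_lborel_def null
    by (subst AE_distr_iff) (use AE in \<open>auto simp: null herm_of_coords_measurable\<close>)
qed

lemma distr_pair_independent:
  fixes X :: "'w \<Rightarrow> 'a::second_countable_topology" and Y :: "'w \<Rightarrow> 'b::second_countable_topology"
  assumes "prob_space M" and ind: "independent_rv M X Y"
  shows "distr M borel X \<Otimes>\<^sub>M distr M borel Y = distr M (borel \<Otimes>\<^sub>M borel) (\<lambda>\<omega>. (X \<omega>, Y \<omega>))"
proof -
  interpret prob_space M by fact
  have X: "X \<in> borel_measurable M" and Y: "Y \<in> borel_measurable M"
    using ind by (auto simp: independent_rv_def)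
  interpret dX: prob_space "distr M borel X" by (rule prob_space_distr[OF X])
  interpret dY: prob_space "distr M borel Y" by (rule prob_space_distr[OF Y])
  have XY: "(\<lambda>\<omega>. (X \<omega>, Y \<omega>)) \<in> measurable M (borel \<Otimes>\<^sub>M borel)"
    using X Y by simp
  show ?thesis
  proof (rule pair_measure_eqI)
    show "sigma_finite_measure (distr M borel X)" "sigma_finite_measure (distr M borel Y)" by unfold_locales
    show "sets (distr M borel X \<Otimes>\<^sub>M distr M borel Y) = sets (distr M (borel \<Otimes>\<^sub>M borel) (\<lambda>\<omega>. (X \<omega>, Y \<omega>)))"
      by (simp cong: sets_pair_measure_cong)
    fix A B assume "A \<in> sets (distr M borel X)" "B \<in> sets (distr M borel Y)"
    then have A: "A \<in> sets borel" and B: "B \<in> sets borel" by simp_all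
    have "prob ((X -` A \<inter> space M) \<inter> (Y -` B \<inter> space M)) = prob (X -` A \<inter> space M) * prob (Y -` B \<inter> space M)"
      using ind A B unfolding independent_rv_def by (intro indep_setD) auto
    moreover have "(\<lambda>\<omega>. (X \<omega>, Y \<omega>)) -` (A \<times> B) \<inter> space M = (X -` A \<inter> space M) \<inter> (Y -` B \<inter> space M)" by auto
    ultimately show "emeasure (distr M borel X) A * emeasure (distr M borel Y) B
        = emeasure (distr M (borel \<Otimes>\<^sub>M borel) (\<lambda>\<omega>. (X \<omega>, Y \<omega>))) (A \<times> B)"
      using A B X Y XY
      by (simp add: emeasure_distr emeasure_eq_measure ennreal_mult measurable_sets)
  qed
qed

text \<open>The joint law is the product of the marginal laws, and each of these is absolutely continuous.\<close>

lemma AE_independent_densities: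
  fixes Z :: "'w \<Rightarrow> 'a::second_countable_topology" and S :: "'w \<Rightarrow> 'b::second_countable_topology"
  assumes M: "prob_space M" and ind: "independent_rv M Z S"
    and Z: "distributed M \<mu> Z f" "sets \<mu> = sets borel" and S: "distributed M \<nu> S g" "sets \<nu> = sets borel"
    and P: "{p. P (fst p) (snd p)} \<in> sets (borel \<Otimes>\<^sub>M borel)"
    and AE: "AE s in \<nu>. AE z in \<mu>. P z s"
  shows "AE \<omega> in M. P (Z \<omega>) (S \<omega>)"
proof -
  interpret prob_space M by fact
  have Zm: "Z \<in> borel_measurable M" and Sm: "S \<in> borel_measurable M"
    using ind by (auto simp: independent_rv_def)
  have "distr M borel Z = density \<mu> f" "distr M borel S = density \<nu> g"
    using distributed_distr_eq_density[OF Z(1)] distributed_distr_eq_density[OF S(1)] Z(2) S(2)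
    by (metis distr_cong)+
  note dens = this
  interpret dZ: prob_space "distr M borel Z" by (rule prob_space_distr[OF Zm])
  interpret dS: prob_space "distr M borel S" by (rule prob_space_distr[OF Sm])
  interpret pair: pair_sigma_finite "distr M borel S" "distr M borel Z" ..
  interpret pair': pair_sigma_finite "distr M borel Z" "distr M borel S" ..
  have ae_dens: "AE x in density \<kappa> k. Q x" if "AE x in \<kappa>. Q x" "k \<in> borel_measurable \<kappa>" for \<kappa> :: "'c measure" and k Q
    using that by (subst AE_density) auto
  have "AE s in distr M borel S. AE z in distr M borel Z. P z s"
    unfolding dens
    by (rule ae_dens[OF _ distributed_borel_measurable[OF S(1)]])
       (use AE in \<open>eventually_elim, auto intro!: ae_dens distributed_borel_measurable[OF Z(1)]\<close>)
  moreover have sets: "sets (distr M borel Z \<Otimes>\<^sub>M distr M borel S) = sets (borel \<Otimes>\<^sub>M borel)"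
    by (simp cong: sets_pair_measure_cong)
  ultimately have "AE z in distr M borel Z. AE s in distr M borel S. P z s"
    using pair'.AE_commute[of P] P by (simp add: space_pair_measure)
  then have "AE p in distr M borel Z \<Otimes>\<^sub>M distr M borel S. P (fst p) (snd p)"
    using pair'.AE_pair_iff[of P] P sets by (simp add: space_pair_measure)
  then have "AE p in distr M (borel \<Otimes>\<^sub>M borel) (\<lambda>\<omega>. (Z \<omega>, S \<omega>)). P (fst p) (snd p)"
    by (simp only: distr_pair_independent[OF M ind])
  from AE_distrD[OF _ this] show ?thesis using Zm Sm by simp
qed

lemma AE_wishart_pos_def:
  assumes "distributed M herm_lborel S (\<lambda>s. ennreal (cwishart_density \<Sigma> n s))"
  shows "AE \<omega> in M. pos_def_hermitian (S \<omega>)"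
proof -
  have "AE s in density herm_lborel (\<lambda>s. ennreal (cwishart_density \<Sigma> n s)). pos_def_hermitian s"
    using distributed_borel_measurable[OF assms]
    by (subst AE_density) (auto simp: cwishart_density_def)
  then have "AE s in distr M herm_lborel S. pos_def_hermitian s"
    by (simp only: distributed_distr_eq_density[OF assms])
  with distributed_measurable[OF assms] show ?thesis by (rule AE_distrD)
qed

lemma gram_psd: "Re (cinner v ((z\<^sup>\<dagger> ** z) *v v)) \<ge> 0"
proof -
  have "cinner v ((z\<^sup>\<dagger> ** z) *v v) = cinner (z *v v) (z *v v)"
    by (simp add: cinner_matrix_left matrix_vector_mul_assoc)
  then show ?thesis by (simp add: cinner_self)
qed

lemma det_pos_def_real:
  assumes "pos_def_hermitian s"
  shows "Im (det s) = 0"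
proof -
  have "cnj (det s) = det s" using assms by (simp add: pos_def_hermitian_iff flip: det_conj_transpose)
  then show ?thesis by (simp add: complex_eq_iff)
qed

text \<open>In the tall case \<open>adj(S) Z\<^sup>* Z\<close> and in the wide case \<open>Z adj(S) Z\<^sup>*\<close> are polynomial substitutes for
  \<open>S\<^sup>-\<^sup>1 Z\<^sup>* Z\<close> and \<open>Z S\<^sup>-\<^sup>1 Z\<^sup>*\<close>.\<close>

lemma simplicity_imp_distinct_tall:
  fixes z :: "('m::finite, 'p::{finite,linorder}) cmat"
  assumes s: "pos_def_hermitian s" and simple: "simplicity (adjugate s ** (z\<^sup>\<dagger> ** z)) \<noteq> 0"
  shows "distinct_spectrum TYPE('p) z s"
proof -
  have inv: "invertible s" using s by (rule pos_def_hermitian_invertible)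
  have "s ** (adjugate s ** (z\<^sup>\<dagger> ** z)) = mat (det s) ** (s ** matrix_inv s) ** (z\<^sup>\<dagger> ** z)"
    unfolding adjugate_eq[OF inv] by (metis mat_commute matrix_mul_assoc)
  then have TW: "s ** (adjugate s ** (z\<^sup>\<dagger> ** z)) = mat (det s) ** (z\<^sup>\<dagger> ** z)"
    by (simp add: matrix_inv_right inv)
  obtain f :: "'p rvec" where "f \<in> ordered_cone" "\<And>k. det (z\<^sup>\<dagger> ** z - mat (of_real (f $ k)) ** s) = 0"
    by (rule cyclic_imp_ordered_roots[OF _ gram_psd s _ det_pos_def_real[OF s] TW, where e=ones])
       (use simple inv in \<open>auto simp: simplicity_def invertible_det_nz conj_transpose_mult\<close>)
  then show ?thesis unfolding distinct_spectrum_def using s nonzero_spectrum_tall by blast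
qed

lemma simplicity_imp_distinct_wide:
  fixes z :: "('m::{finite,linorder}, 'p::finite) cmat"
  assumes s: "pos_def_hermitian s" and simple: "simplicity (z ** adjugate s ** z\<^sup>\<dagger>) \<noteq> 0"
  shows "distinct_spectrum TYPE('m) z s"
proof -
  have inv: "invertible s" using s by (rule pos_def_hermitian_invertible)
  have si: "pos_def_hermitian (matrix_inv s)" by (rule pos_def_hermitian_matrix_inv[OF s])
  define N where "N = z ** matrix_inv s ** z\<^sup>\<dagger>"
  have N: "N\<^sup>\<dagger> = N" using si by (simp add: N_def conj_transpose_mult pos_def_hermitian_iff matrix_mul_assoc)
  have psd: "Re (cinner v (N *v v)) \<ge> 0" for v
  proof -
    have "cinner v (N *v v) = cinner (z\<^sup>\<dagger> *v v) (matrix_inv s *v (z\<^sup>\<dagger> *v v))"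
      by (simp add: N_def cinner_matrix_left matrix_vector_mul_assoc matrix_mul_assoc)
    moreover have "Re (cinner u (matrix_inv s *v u)) \<ge> 0" for u
      using si by (cases "u = 0") (auto simp: pos_def_hermitian_iff cinner_def less_imp_le)
    ultimately show ?thesis by simp
  qed
  have TW: "mat 1 ** (z ** adjugate s ** z\<^sup>\<dagger>) = mat (det s) ** N"
    unfolding adjugate_eq[OF inv] N_def
    by (simp add: vec_eq_iff matrix_mult_nth[of z] matrix_mult_nth[of _ "z\<^sup>\<dagger>"] sum_distrib_left sum_distrib_right mult_ac)
  obtain f :: "'m rvec" where "f \<in> ordered_cone" "\<And>k. det (N - mat (of_real (f $ k)) ** mat 1) = 0"
    by (rule cyclic_imp_ordered_roots[OF N psd pos_def_hermitian_mat_1 _ det_pos_def_real[OF s] TW, where e=ones])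
       (use simple inv in \<open>auto simp: simplicity_def invertible_det_nz\<close>)
  then show ?thesis unfolding distinct_spectrum_def N_def using s nonzero_spectrum_wide by blast
qed

text \<open>This supplies the base point: with \<open>S = I\<close> the matrix of the pencil is diagonal with distinct entries.\<close>

lemma rectangular_diagonal_exists:
  fixes d :: "'q::{finite,linorder} \<Rightarrow> real"
  assumes "CARD('q) \<le> CARD('m::finite)" and nonneg: "\<And>k. d k \<ge> 0"
  obtains z :: "('m::finite, 'q) cmat" where "z\<^sup>\<dagger> ** z = Diag d"
proof -
  obtain \<iota> :: "'q \<Rightarrow> 'm" where \<iota>: "inj \<iota>"
    using card_le_inj[of "UNIV :: 'q set" "UNIV :: 'm set"] assms by auto
  define z :: "('m, 'q) cmat" where
    "z = (\<chi> i k. if i = \<iota> k then of_real (sqrt (d k)) else 0)"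
  have "(z\<^sup>\<dagger> ** z) $ j $ k = Diag d $ j $ k" for j k
  proof (cases "j = k")
    case True
    have "(z\<^sup>\<dagger> ** z) $ k $ k = (\<Sum>i\<in>UNIV. if i = \<iota> k then of_real (d k) else 0)"
      unfolding matrix_mult_nth
      by (intro sum.cong) (auto simp: z_def nonneg simp flip: of_real_mult)
    then show ?thesis using True nonneg[of k] by simp
  next
    case False
    then have "\<iota> j \<noteq> \<iota> k" using \<iota> by (auto dest: injD)
    then have "(z\<^sup>\<dagger> ** z) $ j $ k = 0"
      unfolding matrix_mult_nth by (intro sum.neutral) (auto simp: z_def)
    then show ?thesis using False by simp
  qed
  then have "z\<^sup>\<dagger> ** z = Diag d" by (simp add: vec_eq_iff)
  then show thesis by (rule that)
qed

lemma simplicity_rank_Diag: "simplicity (Diag (\<lambda>k :: 'q::{finite,linorder}. real (Suc (index_rank k)))) \<noteq> 0"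
  by (rule simplicity_Diag) (auto simp: inj_def dest: injD[OF inj_index_rank])

lemma AE_distinct_spectrum_tall:
  fixes Z :: "'w \<Rightarrow> ('m::finite, 'p::{finite,linorder}) cmat"
  assumes "prob_space M" "CARD('p) \<le> CARD('m)"
    and Z: "distributed M lborel Z f" and S: "distributed M herm_lborel S (\<lambda>s. ennreal (cwishart_density \<Sigma> n s))"
    and ind: "independent_rv M Z S"
  shows "AE \<omega> in M. distinct_spectrum TYPE('p) (Z \<omega>) (S \<omega>)"
proof -
  define W where "W z s = adjugate s ** (z\<^sup>\<dagger> ** z)" for z :: "('m, 'p) cmat" and s
  have cont: "continuous_on UNIV (\<lambda>p. W (fst p) (snd p))"
    unfolding W_def
    by (intro continuous_on_matrix_mult continuous_on_adjugate continuous_intros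
        bounded_linear.continuous_on[OF bounded_linear_conj_transpose])
  obtain z0 :: "('m, 'p) cmat" where z0: "z0\<^sup>\<dagger> ** z0 = Diag (\<lambda>k. real (Suc (index_rank k)))"
    by (rule rectangular_diagonal_exists[of "\<lambda>k. real (Suc (index_rank k))", OF assms(2) of_nat_0_le_iff])
  have "AE s in herm_lborel. AE z in lborel. simplicity (W z s) \<noteq> 0"
  proof (rule AE_simplicity[OF cont])
    show "matrix_polynomial_in_t (\<lambda>t. W (z0 + t *\<^sub>R z) (s0 + t *\<^sub>R s))" for z0 z s0 s
      unfolding W_def
      by (intro matrix_polynomial_in_t_mult matrix_polynomial_in_t_adjugate
          matrix_polynomial_in_t_conj_transpose matrix_polynomial_in_t_line)
    show "simplicity (W z0 (mat 1)) \<noteq> 0"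
      unfolding W_def adjugate_mat_1 z0 matrix_mul_lid by (rule simplicity_rank_Diag)
  qed
  moreover have "{p. simplicity (W (fst p) (snd p)) \<noteq> 0} \<in> sets (borel \<Otimes>\<^sub>M borel)"
    unfolding borel_prod by (intro borel_open open_Collect_neq continuous_on_simplicity cont continuous_on_const)
  ultimately have "AE \<omega> in M. simplicity (W (Z \<omega>) (S \<omega>)) \<noteq> 0"
    by (intro AE_independent_densities[OF assms(1) ind Z _ S]) (auto simp: herm_lborel_def)
  then show ?thesis
    using AE_wishart_pos_def[OF S] by eventually_elim (auto simp: W_def intro: simplicity_imp_distinct_tall)
qed

lemma AE_distinct_spectrum_wide:
  fixes Z :: "'w \<Rightarrow> ('m::{finite,linorder}, 'p::{finite,linorder}) cmat"
  assumes "prob_space M" "CARD('m) \<le> CARD('p)"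
    and Z: "distributed M lborel Z f" and S: "distributed M herm_lborel S (\<lambda>s. ennreal (cwishart_density \<Sigma> n s))"
    and ind: "independent_rv M Z S"
  shows "AE \<omega> in M. distinct_spectrum TYPE('m) (Z \<omega>) (S \<omega>)"
proof -
  define W where "W z s = z ** adjugate s ** z\<^sup>\<dagger>" for z :: "('m, 'p) cmat" and s
  have cont: "continuous_on UNIV (\<lambda>p. W (fst p) (snd p))"
    unfolding W_def
    by (intro continuous_on_matrix_mult continuous_on_adjugate continuous_intros
        bounded_linear.continuous_on[OF bounded_linear_conj_transpose])
  obtain z0 :: "('p, 'm) cmat" where z0: "z0\<^sup>\<dagger> ** z0 = Diag (\<lambda>k. real (Suc (index_rank k)))"
    by (rule rectangular_diagonal_exists[of "\<lambda>k. real (Suc (index_rank k))", OF assms(2) of_nat_0_le_iff])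
  have "AE s in herm_lborel. AE z in lborel. simplicity (W z s) \<noteq> 0"
  proof (rule AE_simplicity[OF cont])
    show "matrix_polynomial_in_t (\<lambda>t. W (z0 + t *\<^sub>R z) (s0 + t *\<^sub>R s))" for z0 z s0 s
      unfolding W_def
      by (intro matrix_polynomial_in_t_mult matrix_polynomial_in_t_adjugate
          matrix_polynomial_in_t_conj_transpose matrix_polynomial_in_t_line)
    show "simplicity (W (z0\<^sup>\<dagger>) (mat 1)) \<noteq> 0"
      unfolding W_def adjugate_mat_1 matrix_mul_rid conj_transpose_idem z0 by (rule simplicity_rank_Diag)
  qed
  moreover have "{p. simplicity (W (fst p) (snd p)) \<noteq> 0} \<in> sets (borel \<Otimes>\<^sub>M borel)"
    unfolding borel_prod by (intro borel_open open_Collect_neq continuous_on_simplicity cont continuous_on_const)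
  ultimately have "AE \<omega> in M. simplicity (W (Z \<omega>) (S \<omega>)) \<noteq> 0"
    by (intro AE_independent_densities[OF assms(1) ind Z _ S]) (auto simp: herm_lborel_def)
  then show ?thesis
    using AE_wishart_pos_def[OF S] by eventually_elim (auto simp: W_def intro: simplicity_imp_distinct_wide)
qed

section \<open>The second moment of a density proportional to \<open>exp(-Q)\<close>\<close>

lemma nn_integral_lborel_affine:
  fixes g :: "'a::euclidean_space \<Rightarrow> ennreal"
  assumes g: "g \<in> borel_measurable borel" and c: "c \<noteq> 0"
  shows "(\<integral>\<^sup>+x. g x \<partial>lborel) = ennreal (\<bar>c\<bar> ^ DIM('a)) * (\<integral>\<^sup>+x. g (b + c *\<^sub>R x) \<partial>lborel)"
proof -
  have g': "(\<lambda>x. g (b + c *\<^sub>R x)) \<in> borel_measurable borel"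
    by (rule measurable_compose[OF _ g]) measurable
  have "(\<integral>\<^sup>+x. g x \<partial>lborel)
      = (\<integral>\<^sup>+x. g x \<partial>density (distr lborel borel (\<lambda>x. b + c *\<^sub>R x)) (\<lambda>_. ennreal (\<bar>c\<bar> ^ DIM('a))))"
    by (subst lborel_affine[OF c, of b]) (rule refl)
  also have "\<dots> = (\<integral>\<^sup>+x. ennreal (\<bar>c\<bar> ^ DIM('a)) * g (b + c *\<^sub>R x) \<partial>lborel)"
    using g by (simp add: nn_integral_density nn_integral_distr)
  finally show ?thesis using g' by (simp add: nn_integral_cmult)
qed

text \<open>Write \<open>exp(-Q)\<close> as the integral of \<open>2 c Q exp(-c\<^sup>2 Q)\<close> over \<open>c \<ge> 1\<close> and exchange the integrals.  By
  homogeneity the inner one is a power of \<open>c\<close> times the second moment, so no Gaussian integral is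
  evaluated.\<close>

lemma second_moment_quadratic_exponential:
  fixes Q :: "'a::euclidean_space \<Rightarrow> real"
  assumes meas: "Q \<in> borel_measurable borel" and pos: "\<And>x. x \<noteq> 0 \<Longrightarrow> Q x > 0"
    and hom: "\<And>c x. Q (c *\<^sub>R x) = c\<^sup>2 * Q x"
  shows "(\<integral>\<^sup>+x. ennreal (Q x * exp (- Q x)) \<partial>lborel)
       = ennreal (real DIM('a) / 2) * (\<integral>\<^sup>+x. ennreal (exp (- Q x)) \<partial>lborel)"
proof -
  define D where "D = DIM('a)"
  have D: "D > 0" by (simp add: D_def)
  define J where "J = (\<integral>\<^sup>+x. ennreal (Q x * exp (- Q x)) \<partial>lborel)"
  define F where "F c x = ennreal (2 * c * Q x * exp (- (c\<^sup>2 * Q x))) * indicator {1..} c" for c x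
  have inner_c: "(\<integral>\<^sup>+c. F c x \<partial>lborel) = ennreal (exp (- Q x))" if "x \<noteq> 0" for x
  proof -
    have "(\<integral>\<^sup>+c. ennreal (2 * c * Q x * exp (- (c\<^sup>2 * Q x))) * indicator {1..} c \<partial>lborel)
        = ennreal (0 - (- exp (- (1\<^sup>2 * Q x))))"
    proof (rule nn_integral_FTC_atLeast[where F="\<lambda>c. - exp (- (c\<^sup>2 * Q x))"])
      show "((\<lambda>c. - exp (- (c\<^sup>2 * Q x))) has_real_derivative 2 * c * Q x * exp (- (c\<^sup>2 * Q x))) (at c)" for c
        by (auto intro!: derivative_eq_intros)
      show "((\<lambda>c. - exp (- (c\<^sup>2 * Q x))) \<longlongrightarrow> 0) at_top"
        using pos[OF that] by real_asymp
    qed (use pos[OF that] in auto)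
    then show ?thesis by (simp add: F_def)
  qed
  have inner_x: "(\<integral>\<^sup>+x. F c x \<partial>lborel) = ennreal (2 / c ^ (D + 1)) * indicator {1..} c * J" for c
  proof (cases "c \<ge> 1")
    case True
    have g: "(\<lambda>x. ennreal (Q x * exp (- Q x))) \<in> borel_measurable borel" using meas by measurable
    have J: "J = ennreal (c ^ D) * (\<integral>\<^sup>+x. ennreal (Q (c *\<^sub>R x) * exp (- Q (c *\<^sub>R x))) \<partial>lborel)"
      unfolding J_def using nn_integral_lborel_affine[OF g, of c 0] True by (simp add: D_def)
    have "F c x = ennreal (2 / c) * ennreal (Q (c *\<^sub>R x) * exp (- Q (c *\<^sub>R x)))" for x
      using True by (simp add: F_def hom power2_eq_square field_simps flip: ennreal_mult')
    then have "(\<integral>\<^sup>+x. F c x \<partial>lborel)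
        = ennreal (2 / c) * (\<integral>\<^sup>+x. ennreal (Q (c *\<^sub>R x) * exp (- Q (c *\<^sub>R x))) \<partial>lborel)"
      using meas by (simp add: nn_integral_cmult)
    moreover have split: "ennreal (2 / c ^ (D + 1)) * ennreal (c ^ D) = ennreal (2 / c)"
      using True by (simp flip: ennreal_mult)
    have "ennreal (2 / c) * (\<integral>\<^sup>+x. ennreal (Q (c *\<^sub>R x) * exp (- Q (c *\<^sub>R x))) \<partial>lborel)
        = ennreal (2 / c ^ (D + 1)) * J"
      unfolding J by (simp only: split flip: mult.assoc)
    ultimately show ?thesis using True by simp
  qed (simp add: F_def)
  have F_meas: "case_prod F \<in> borel_measurable (lborel \<Otimes>\<^sub>M lborel)"
    unfolding F_def using meas by measurable
  have "(\<integral>\<^sup>+x. ennreal (exp (- Q x)) \<partial>lborel) = (\<integral>\<^sup>+x. (\<integral>\<^sup>+c. F c x \<partial>lborel) \<partial>lborel)"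
    by (intro nn_integral_cong_AE eventually_mono[OF AE_lborel_singleton[of 0]]) (simp add: inner_c)
  also have "\<dots> = (\<integral>\<^sup>+c. (\<integral>\<^sup>+x. F c x \<partial>lborel) \<partial>lborel)"
    by (rule lborel_pair.Fubini'[OF F_meas])
  also have "\<dots> = (\<integral>\<^sup>+c. ennreal (2 / c ^ (D + 1)) * indicator {1..} c \<partial>lborel) * J"
    unfolding inner_x by (rule nn_integral_multc) measurable
  also have "(\<integral>\<^sup>+c. ennreal (2 / c ^ (D + 1)) * indicator {1..} c \<partial>lborel) = ennreal (0 - (- 2 / (real D * 1 ^ D)))"
  proof (rule nn_integral_FTC_atLeast[where F="\<lambda>c. - 2 / (real D * c ^ D)"])
    fix c :: real assume c: "1 \<le> c"
    have "((\<lambda>c. inverse (c ^ D)) has_real_derivative - (inverse (c ^ D) * (real D * c ^ (D - 1)) * inverse (c ^ D))) (at c)"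
      using c by (auto intro!: derivative_eq_intros)
    then have "((\<lambda>c. - 2 / real D * inverse (c ^ D)) has_real_derivative
        - 2 / real D * - (inverse (c ^ D) * (real D * c ^ (D - 1)) * inverse (c ^ D))) (at c)"
      by (rule DERIV_cmult)
    moreover have "- 2 / real D * - (inverse (c ^ D) * (real D * c ^ (D - 1)) * inverse (c ^ D)) = 2 / c ^ (D + 1)"
    proof -
      have cancel: "- 2 / r * - (inverse y * (r * x) * inverse y) = 2 * x / (y * y)" if "r \<noteq> 0" for r x y :: real
        using that by (simp add: divide_inverse)
      have "c ^ D = c * c ^ (D - 1)" using D by (cases D) auto
      then have "2 * c ^ (D - 1) / (c ^ D * c ^ D) = 2 / c ^ (D + 1)" using c by (simp add: field_simps)
      then show ?thesis using D by (subst cancel) auto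
    qed
    moreover have "(\<lambda>c. - 2 / real D * inverse (c ^ D)) = (\<lambda>c. - 2 / (real D * c ^ D))"
      by (simp add: divide_inverse mult.assoc)
    ultimately show "((\<lambda>c. - 2 / (real D * c ^ D)) has_real_derivative 2 / c ^ (D + 1)) (at c)"
      by (simp only:)
    show "0 \<le> 2 / c ^ (D + 1)" using c by simp
  next
    have "filterlim (\<lambda>c :: real. real D * c ^ D) at_top at_top"
      using D by (intro filterlim_tendsto_pos_mult_at_top[OF tendsto_const] filterlim_pow_at_top filterlim_ident) auto
    then show "((\<lambda>c. - 2 / (real D * c ^ D)) \<longlongrightarrow> 0) at_top"
      by (intro tendsto_divide_0[OF tendsto_const] filterlim_at_top_imp_at_infinity)
  qed measurable
  finally have I: "(\<integral>\<^sup>+x. ennreal (exp (- Q x)) \<partial>lborel) = ennreal (2 / real D) * J" by simp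
  have "ennreal (real D / 2) * ennreal (2 / real D) = ennreal (real D / 2 * (2 / real D))"
    by (rule ennreal_mult'[symmetric]) simp
  then have "ennreal (real D / 2) * ennreal (2 / real D) = 1" using D by simp
  then show ?thesis unfolding I J_def[symmetric] D_def[symmetric] by (simp flip: mult.assoc)
qed

lemma row_quadratic_form:
  "trace (x ** B ** x\<^sup>\<dagger>) = (\<Sum>i\<in>UNIV. cinner (\<chi> k. cnj (x $ i $ k)) (B *v (\<chi> k. cnj (x $ i $ k))))"
  unfolding trace_def
proof (rule sum.cong[OF refl])
  fix i
  have "(x ** B ** x\<^sup>\<dagger>) $ i $ i = (\<Sum>k\<in>UNIV. \<Sum>l\<in>UNIV. x $ i $ l * B $ l $ k * cnj (x $ i $ k))"
    by (simp add: matrix_mult_nth sum_distrib_right)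
  also have "\<dots> = (\<Sum>l\<in>UNIV. \<Sum>k\<in>UNIV. x $ i $ l * B $ l $ k * cnj (x $ i $ k))" by (rule sum.swap)
  finally show "(x ** B ** x\<^sup>\<dagger>) $ i $ i = cinner (\<chi> k. cnj (x $ i $ k)) (B *v (\<chi> k. cnj (x $ i $ k)))"
    by (simp add: cinner_def matrix_vector_mult_def sum_distrib_left mult.assoc)
qed

lemma trace_quadratic_form_pos:
  assumes B: "pos_def_hermitian B" and x: "x \<noteq> 0"
  shows "Re (trace (x ** B ** x\<^sup>\<dagger>)) > 0"
proof -
  have nonneg: "Re (cinner v (B *v v)) \<ge> 0" for v
    using B by (cases "v = 0") (auto simp: pos_def_hermitian_iff cinner_def less_imp_le)
  obtain i j where ij: "x $ i $ j \<noteq> 0" using x by (auto simp: vec_eq_iff)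
  then have "(\<chi> k. cnj (x $ i $ k)) \<noteq> 0" by (auto simp: vec_eq_iff)
  then have "0 < Re (cinner (\<chi> k. cnj (x $ i $ k)) (B *v (\<chi> k. cnj (x $ i $ k))))"
    using B by (simp add: pos_def_hermitian_iff)
  then show ?thesis
    unfolding row_quadratic_form Re_sum by (intro sum_pos2[of UNIV i]) (auto simp: nonneg)
qed

text \<open>The normalizing constant cancels: the density has total mass one, and the quadratic form in its
  exponent is the loss, on a real space of dimension \<open>2 m p\<close>.\<close>

lemma cnormal_loss:
  fixes Z :: "'w \<Rightarrow> complex^'p^'m"
  assumes M: "prob_space M" and \<Sigma>: "pos_def_hermitian \<Sigma>"
    and Z: "distributed M lborel Z (\<lambda>z. ennreal (cnormal_density \<Xi> \<Sigma> z))"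
  shows "integrable M (\<lambda>\<omega>. loss \<Xi> \<Sigma> (Z \<omega>))" "(\<integral>\<omega>. loss \<Xi> \<Sigma> (Z \<omega>) \<partial>M) = real (CARD('m) * CARD('p))"
proof -
  interpret prob_space M by fact
  define Q where "Q x = Re (trace (x ** matrix_inv \<Sigma> ** x\<^sup>\<dagger>))" for x :: "complex^'p^'m"
  define k where "k = 1 / (pi ^ (CARD('m) * CARD('p)) * Re (det \<Sigma>) ^ CARD('m))"
  have pos: "Q x > 0" if "x \<noteq> 0" for x
    unfolding Q_def by (rule trace_quadratic_form_pos[OF pos_def_hermitian_matrix_inv[OF \<Sigma>] that])
  have nonneg: "Q x \<ge> 0" for x
    using pos[of x] by (cases "x = 0") (auto simp: Q_def trace_def)
  have hom: "Q (c *\<^sub>R x) = c\<^sup>2 * Q x" for c x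
    by (simp add: Q_def conj_transpose_scaleR matrix_mult_scaleR trace_def power2_eq_square sum_distrib_left mult.assoc)
  have cont: "continuous_on UNIV Q"
    unfolding Q_def trace_def
    by (intro continuous_intros bounded_bilinear.continuous_on[OF bounded_bilinear_matrix_mult]
        bounded_linear.continuous_on[OF bounded_linear_conj_transpose])
  then have meas: "Q \<in> borel_measurable borel" by (rule borel_measurable_continuous_onI)
  have meas': "(\<lambda>z. Q (z - \<Xi>)) \<in> borel_measurable borel"
    by (rule measurable_compose[OF _ meas]) measurable
  have loss: "loss \<Xi> \<Sigma> z = Q (z - \<Xi>)" for z
    using trace_mul_sym[of "matrix_inv \<Sigma> ** (z - \<Xi>)\<^sup>\<dagger>" "z - \<Xi>"]
    by (simp add: loss_def Q_def matrix_mul_assoc)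
  have dens: "cnormal_density \<Xi> \<Sigma> z = k * exp (- Q (z - \<Xi>))" for z
    by (simp add: cnormal_density_def k_def Q_def)
  define I where "I = (\<integral>\<^sup>+x. ennreal (exp (- Q x)) \<partial>lborel)"
  have sm: "(\<integral>\<^sup>+x. ennreal (Q x * exp (- Q x)) \<partial>lborel) = ennreal (real DIM(complex^'p^'m) / 2) * I"
    unfolding I_def by (rule second_moment_quadratic_exponential[OF meas pos hom])
  have shift: "(\<integral>\<^sup>+z. g (z - \<Xi>) \<partial>lborel) = (\<integral>\<^sup>+x. g x \<partial>lborel)" if "g \<in> borel_measurable borel" for g
    using nn_integral_lborel_affine[OF that, of 1 "- \<Xi>"] by simp
  have "(\<integral>\<^sup>+z. ennreal (k * exp (- Q (z - \<Xi>))) \<partial>lborel) = 1"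
    using distributed_nn_integral[OF Z, of "\<lambda>_. 1"] by (simp add: dens emeasure_space_1)
  then have norm: "ennreal k * I = 1"
    using shift[of "\<lambda>x. ennreal (k * exp (- Q x))"] meas
    by (simp add: I_def nn_integral_cmult ennreal_mult'')
  have "k \<ge> 0"
  proof (rule ccontr)
    assume "\<not> k \<ge> 0"
    then show False using norm by (simp add: ennreal_neg)
  qed
  have "(\<integral>\<^sup>+\<omega>. ennreal (loss \<Xi> \<Sigma> (Z \<omega>)) \<partial>M) = (\<integral>\<^sup>+z. ennreal (k * exp (- Q (z - \<Xi>))) * ennreal (Q (z - \<Xi>)) \<partial>lborel)"
    using distributed_nn_integral[OF Z, of "\<lambda>z. ennreal (Q (z - \<Xi>))"] meas' by (simp add: loss dens)
  also have "\<dots> = (\<integral>\<^sup>+x. ennreal (k * exp (- Q x)) * ennreal (Q x) \<partial>lborel)"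
    by (rule shift) (use meas in measurable)
  also have "\<dots> = (\<integral>\<^sup>+x. ennreal k * ennreal (Q x * exp (- Q x)) \<partial>lborel)"
    using \<open>k \<ge> 0\<close> nonneg by (simp add: mult_ac flip: ennreal_mult)
  also have "\<dots> = ennreal k * (\<integral>\<^sup>+x. ennreal (Q x * exp (- Q x)) \<partial>lborel)"
    by (rule nn_integral_cmult) (use meas in measurable)
  also have "\<dots> = ennreal (real DIM(complex^'p^'m) / 2) * (ennreal k * I)"
    unfolding sm by (rule mult.left_commute)
  also have "\<dots> = ennreal (real (CARD('m) * CARD('p)))" by (simp add: norm)
  finally have nn: "(\<integral>\<^sup>+\<omega>. ennreal (loss \<Xi> \<Sigma> (Z \<omega>)) \<partial>M) = ennreal (real (CARD('m) * CARD('p)))" .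
  have "Z \<in> measurable M borel" using distributed_measurable[OF Z] by simp
  then have lm: "(\<lambda>\<omega>. loss \<Xi> \<Sigma> (Z \<omega>)) \<in> borel_measurable M"
    unfolding loss by (rule measurable_compose[OF _ meas'])
  show "integrable M (\<lambda>\<omega>. loss \<Xi> \<Sigma> (Z \<omega>))"
    using nn lm by (intro integrableI_nonneg) (auto simp: loss nonneg)
  show "(\<integral>\<omega>. loss \<Xi> \<Sigma> (Z \<omega>) \<partial>M) = real (CARD('m) * CARD('p))"
    using nn lm by (subst integral_eq_nn_integral) (auto simp: loss nonneg)
qed

section \<open>The risk\<close>

lemma loss_shift:
  "loss \<Xi> \<Sigma> (z + G) = loss \<Xi> \<Sigma> z
    + Re (trace (matrix_inv \<Sigma> ** ((z - \<Xi>)\<^sup>\<dagger> ** G + G\<^sup>\<dagger> ** (z - \<Xi>)))) + Re (trace (G\<^sup>\<dagger> ** G ** matrix_inv \<Sigma>))"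
proof -
  define D where "D = z - \<Xi>"
  have D: "z + G - \<Xi> = D + G" by (simp add: D_def)
  have "matrix_inv \<Sigma> ** (D + G)\<^sup>\<dagger> ** (D + G)
      = matrix_inv \<Sigma> ** D\<^sup>\<dagger> ** D + matrix_inv \<Sigma> ** (D\<^sup>\<dagger> ** G + G\<^sup>\<dagger> ** D) + matrix_inv \<Sigma> ** (G\<^sup>\<dagger> ** G)"
    by (simp add: conj_transpose_add matrix_add_ldistrib matrix_mult_add_left matrix_mul_assoc)
  then show ?thesis
    unfolding loss_def D D_def[symmetric]
    by (simp add: trace_add trace_mul_sym[of "G\<^sup>\<dagger> ** G"])
qed

text \<open>Stein's identity in \<open>Z\<close> and the Stein-Haff identity in \<open>S\<close> remove the unknown \<open>\<Xi>\<close> and \<open>\<Sigma>\<close> from the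
  cross term and from the quadratic term.\<close>

lemma risk_from_stein_identities:
  fixes Z :: "'w \<Rightarrow> complex^'p^'m"
  assumes M: "prob_space M" and \<Sigma>: "pos_def_hermitian \<Sigma>"
    and Z: "distributed M lborel Z (\<lambda>z. ennreal (cnormal_density \<Xi> \<Sigma> z))"
    and st: "stein_identity M Z S \<Xi> \<Sigma> (\<lambda>z s. est z s - z)"
    and sh: "stein_haff_identity M Z S \<Sigma> n (\<lambda>z s. est z s - z)"
    and \<Delta>: "integrable M \<Delta>"
    and ae: "AE \<omega> in M. 2 * tr_re_nabla (\<lambda>z. est z (S \<omega>) - z) (Z \<omega>)
      + Re ((of_nat n - of_nat CARD('p)) *
              trace ((est (Z \<omega>) (S \<omega>) - Z \<omega>)\<^sup>\<dagger> ** (est (Z \<omega>) (S \<omega>) - Z \<omega>) ** matrix_inv (S \<omega>))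
            + trace (D_S (\<lambda>s. (est (Z \<omega>) s - Z \<omega>)\<^sup>\<dagger> ** (est (Z \<omega>) s - Z \<omega>)) (S \<omega>))) = \<Delta> \<omega>"
  shows "risk M Z S \<Xi> \<Sigma> est = real (CARD('m) * CARD('p)) + (\<integral>\<omega>. \<Delta> \<omega> \<partial>M)"
proof -
  define G where "G \<omega> = est (Z \<omega>) (S \<omega>) - Z \<omega>" for \<omega>
  define a where "a \<omega> = trace (matrix_inv \<Sigma> ** ((Z \<omega> - \<Xi>)\<^sup>\<dagger> ** G \<omega> + (G \<omega>)\<^sup>\<dagger> ** (Z \<omega> - \<Xi>)))" for \<omega>
  define b where "b \<omega> = 2 * tr_re_nabla (\<lambda>z. est z (S \<omega>) - z) (Z \<omega>)" for \<omega>
  define c where "c \<omega> = trace ((G \<omega>)\<^sup>\<dagger> ** G \<omega> ** matrix_inv \<Sigma>)" for \<omega>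
  define d where "d \<omega> = (of_nat n - of_nat CARD('p)) * trace ((G \<omega>)\<^sup>\<dagger> ** G \<omega> ** matrix_inv (S \<omega>))
      + trace (D_S (\<lambda>s. (est (Z \<omega>) s - Z \<omega>)\<^sup>\<dagger> ** (est (Z \<omega>) s - Z \<omega>)) (S \<omega>))" for \<omega>
  have ab: "integrable M a" "integrable M b" "(\<integral>\<omega>. a \<omega> \<partial>M) = complex_of_real (\<integral>\<omega>. b \<omega> \<partial>M)"
    using st unfolding stein_identity_def Let_def a_def b_def G_def by blast+
  have cd: "integrable M c" "integrable M d" "(\<integral>\<omega>. c \<omega> \<partial>M) = (\<integral>\<omega>. d \<omega> \<partial>M)"
    using sh unfolding stein_haff_identity_def Let_def c_def d_def G_def by blast+
  note L = cnormal_loss[OF M \<Sigma> Z]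
  have "loss \<Xi> \<Sigma> (est (Z \<omega>) (S \<omega>)) = loss \<Xi> \<Sigma> (Z \<omega>) + Re (a \<omega>) + Re (c \<omega>)" for \<omega>
    using loss_shift[of \<Xi> \<Sigma> "Z \<omega>" "G \<omega>"] by (simp add: a_def c_def G_def)
  then have "risk M Z S \<Xi> \<Sigma> est = (\<integral>\<omega>. loss \<Xi> \<Sigma> (Z \<omega>) + Re (a \<omega>) + Re (c \<omega>) \<partial>M)"
    by (simp add: risk_def)
  also have "\<dots> = real (CARD('m) * CARD('p)) + Re (\<integral>\<omega>. a \<omega> \<partial>M) + Re (\<integral>\<omega>. c \<omega> \<partial>M)"
    using L ab cd by (simp add: integral_Re)
  also have "\<dots> = real (CARD('m) * CARD('p)) + (\<integral>\<omega>. b \<omega> + Re (d \<omega>) \<partial>M)"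
    using ab cd by (simp add: integral_Re)
  also have "(\<integral>\<omega>. b \<omega> + Re (d \<omega>) \<partial>M) = (\<integral>\<omega>. \<Delta> \<omega> \<partial>M)"
  proof (rule integral_cong_AE)
    show "AE \<omega> in M. b \<omega> + Re (d \<omega>) = \<Delta> \<omega>" using ae by (simp add: b_def d_def G_def)
  qed (use ab cd \<Delta> in auto)
  finally show ?thesis .
qed

theorem proposition3:
  fixes M :: "'w measure"
    and Z :: "'w \<Rightarrow> ('m::{finite,linorder}, 'p::{finite,linorder}) cmat"
    and S :: "'w \<Rightarrow> ('p, 'p) cmat"
    and \<Xi> :: "('m, 'p) cmat"
    and \<Sigma> :: "('p, 'p) cmat"
    and n :: nat
  assumes "prob_space M"
    and "CARD('m) \<noteq> CARD('p)"
    and "n > CARD('p)"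
    and "pos_def_hermitian \<Sigma>"
    and "distributed M lborel Z (\<lambda>z. ennreal (cnormal_density \<Xi> \<Sigma> z))"
    and "distributed M herm_lborel S (\<lambda>s. ennreal (cwishart_density \<Sigma> n s))"
    and "independent_rv M Z S"
  shows
    "(CARD('m) > CARD('p) \<longrightarrow>
       (\<forall>(h :: 'p \<Rightarrow> 'p rvec \<Rightarrow> real) A.
          decomposition_A A \<longrightarrow>
          regular M Z S \<Xi> \<Sigma> n (estimator_A h A) h (Delta_hat n CARD('m) h) \<longrightarrow>
          risk M Z S \<Xi> \<Sigma> (estimator_A h A) =
            real (CARD('m) * CARD('p))
            + (\<integral>\<omega>. Delta_hat n CARD('m) h (F_of (Z \<omega>) (S \<omega>)) \<partial>M)))
     \<and>
     (CARD('p) > CARD('m) \<longrightarrow>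
       (\<forall>(h :: 'm \<Rightarrow> 'm rvec \<Rightarrow> real) U.
          decomposition_U U \<longrightarrow>
          regular M Z S \<Xi> \<Sigma> n (estimator_U h U) h (Delta_hat (n + CARD('m) - CARD('p)) CARD('p) h) \<longrightarrow>
          risk M Z S \<Xi> \<Sigma> (estimator_U h U) =
            real (CARD('m) * CARD('p))
            + (\<integral>\<omega>. Delta_hat (n + CARD('m) - CARD('p)) CARD('p) h (F_of (Z \<omega>) (S \<omega>)) \<partial>M)))"
proof (intro conjI impI allI)
  fix h :: "'p \<Rightarrow> 'p rvec \<Rightarrow> real" and A
  assume lt: "CARD('m) > CARD('p)" and A: "decomposition_A A"
    and reg: "regular M Z S \<Xi> \<Sigma> n (estimator_A h A) h (Delta_hat n CARD('m) h)"
  have h: "h k differentiable_on ordered_cone" for k using reg by (simp add: regular_def)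
  show "risk M Z S \<Xi> \<Sigma> (estimator_A h A) = real (CARD('m) * CARD('p))
      + (\<integral>\<omega>. Delta_hat n CARD('m) h (F_of (Z \<omega>) (S \<omega>)) \<partial>M)"
  proof (rule risk_from_stein_identities[OF assms(1,4,5)])
    have "AE \<omega> in M. distinct_spectrum TYPE('p) (Z \<omega>) (S \<omega>)"
      using lt by (intro AE_distinct_spectrum_tall[OF assms(1) _ assms(5-7)]) simp
    then show "AE \<omega> in M. 2 * tr_re_nabla (\<lambda>z. estimator_A h A z (S \<omega>) - z) (Z \<omega>)
      + Re ((of_nat n - of_nat CARD('p)) *
              trace ((estimator_A h A (Z \<omega>) (S \<omega>) - Z \<omega>)\<^sup>\<dagger> ** (estimator_A h A (Z \<omega>) (S \<omega>) - Z \<omega>) ** matrix_inv (S \<omega>))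
            + trace (D_S (\<lambda>s. (estimator_A h A (Z \<omega>) s - Z \<omega>)\<^sup>\<dagger> ** (estimator_A h A (Z \<omega>) s - Z \<omega>)) (S \<omega>)))
      = Delta_hat n CARD('m) h (F_of (Z \<omega>) (S \<omega>))"
      by eventually_elim (rule unbiased_risk_tall[OF A _ h])
  qed (use reg in \<open>simp_all add: regular_def\<close>)
next
  fix h :: "'m \<Rightarrow> 'm rvec \<Rightarrow> real" and U
  assume lt: "CARD('p) > CARD('m)" and U: "decomposition_U U"
    and reg: "regular M Z S \<Xi> \<Sigma> n (estimator_U h U) h (Delta_hat (n + CARD('m) - CARD('p)) CARD('p) h)"
  have h: "h k differentiable_on ordered_cone" for k using reg by (simp add: regular_def)
  show "risk M Z S \<Xi> \<Sigma> (estimator_U h U) = real (CARD('m) * CARD('p))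
      + (\<integral>\<omega>. Delta_hat (n + CARD('m) - CARD('p)) CARD('p) h (F_of (Z \<omega>) (S \<omega>)) \<partial>M)"
  proof (rule risk_from_stein_identities[OF assms(1,4,5)])
    have "AE \<omega> in M. distinct_spectrum TYPE('m) (Z \<omega>) (S \<omega>)"
      using lt by (intro AE_distinct_spectrum_wide[OF assms(1) _ assms(5-7)]) simp
    then show "AE \<omega> in M. 2 * tr_re_nabla (\<lambda>z. estimator_U h U z (S \<omega>) - z) (Z \<omega>)
      + Re ((of_nat n - of_nat CARD('p)) *
              trace ((estimator_U h U (Z \<omega>) (S \<omega>) - Z \<omega>)\<^sup>\<dagger> ** (estimator_U h U (Z \<omega>) (S \<omega>) - Z \<omega>) ** matrix_inv (S \<omega>))
            + trace (D_S (\<lambda>s. (estimator_U h U (Z \<omega>) s - Z \<omega>)\<^sup>\<dagger> ** (estimator_U h U (Z \<omega>) s - Z \<omega>)) (S \<omega>)))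
      = Delta_hat (n + CARD('m) - CARD('p)) CARD('p) h (F_of (Z \<omega>) (S \<omega>))"
      by eventually_elim (rule unbiased_risk_wide[OF U _ h assms(3)])
  qed (use reg in \<open>simp_all add: regular_def\<close>)
qed

end
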